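(* Let $\mathbf X=\mathbf Y+\boldsymbol\theta$ where $\mathbf Y\in\mathbb{R}^d$ has mean zero and covariance $\Sigma=(\sigma_{ij})$ with largest eigenvalue $\kappa$, and suppose the zero bias vectors $\mathbf X^{ij}$ exist for all $i,j$ with $\sigma_{ij}\neq0$ (and that $\mathbf g_0\in W^{1,2}_z$ of the law of $\mathbf X$). Let $\lambda\ge0$, $\mathbf f=-\lambda\mathbf g_0$. Then $$E_{\boldsymbol\theta}\|S_\lambda(\mathbf X)-\boldsymbol\theta\|^2\le E\|\mathbf X-\boldsymbol\theta\|^2+E_{\boldsymbol\theta}\Big[\frac{\lambda}{\|\mathbf X\|^2}\big(\lambda-2(\mathrm{Tr}(\Sigma)-2\kappa)\big)\Big]+2B^*_\lambda,\quad B^*_\lambda=\Big|E_{\boldsymbol\theta}\sum_{i,j}\sigma_{ij}\big[\partial_jf_i(\mathbf X^{ij})-\partial_jf_i(\mathbf X)\big]\Big|.$$ When $\Sigma=\sigma^2\mathrm{Id}$, $B^*_\lambda=\lambda\sigma^2\big|E_{\boldsymbol\theta}\sum_{i=1}^d\big(\frac{\|\mathbf X^i\|^2-2(X^i_i)^2}{\|\mathbf X^i\|^4}-\frac{\|\mathbf X\|^2-2X_i^2}{\|\mathbf X\|^4}\big)\big|$. Assume now $\Sigma=\sigma^2\mathrm{Id}$, $\lambda\in[0,2\sigma^2(d-2)]$ and, for a sequence of problems indexed by $d$, $\|\boldsymbol\theta\|^2=O(d)$. (1) Suppose $\max_{1\le i\le d}E_{\boldsymbol\theta}\big[(d/\|\mathbf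 X^{\neg i}\|^2)^4\big]\le C_{-4}$ and $\sup_iE(X_i-\theta_i)^r\le C_r$ for $r=4,8$. Then for all $d\ge3$, $$B^*_\lambda\le\lambda\sum_{i=1}^d|\mathrm{Cov}_{\boldsymbol\theta}((X_i-\theta_i)^2,\|\mathbf X^{\neg i}\|^{-2})|+\frac{6\lambda\sqrt{C_{-4}}}{d^2}\Big(d\big(\sigma^2\sqrt{C_4}+\sqrt{C_8}/3\big)+\|\boldsymbol\theta\|^2(\sigma^2+C_4)\Big).$$ If moreover $\sum_{i}|\mathrm{Cov}_{\boldsymbol\theta}((X_i-\theta_i)^2,\|\mathbf X^{\neg i}\|^{-2})|=o(1)$, then $B^*_\lambda=o(d)$, and if $\lambda/(2\sigma^2(d-2))$ stays bounded away from $0$ and $1$, $S_\lambda$ has strictly smaller risk than $S_0$ for all large $d$. (2) Suppose $\mathbf Y$ is the $\mu$-mixture of $\mathbf Y_s$, $s\in\mathcal S$, each with mean zero, covariance $\sigma^2\mathrm{Id}$ and independent components, and $\max_iE_{\boldsymbol\theta}[(d/\|\mathbf X_s^{\neg i}\|^2)^2]\le C_{-2}$ for all $s$, where $\mathbf X_s=\mathbf Y_s+\boldsymbol\theta$. Then for any $X^*_{s,i}$ defined jointly with $\mathbf X_s$, independent of $\mathbf X_s^{\neg i}$, and having the $X_{s,i}$-zero bias distribution, $$B^*_\lambda\le\frac{25C_{-2}\lambda\sigma^2}{8d^2}\sum_{i=1}^d\int_{\mathcal S}E_{\boldsymbol\theta,s}\big|X_{s,i}^2-(X^*_{s,i})^2\big|\,d\mu(s).$$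 If $\max_iE[Y_{s,i}^4]\le C_4$ for all $s$, then $B^*_\lambda\le\frac{25C_{-2}\lambda}{8d^2}\big(dC_4/3+C_4^{3/4}\|\boldsymbol\theta\|_1+2\sigma^2\|\boldsymbol\theta\|_2^2+d\sigma^4\big)$, so $B^*_\lambda=O(1)$; and if $\lambda/(2\sigma^2(d-2))$ stays bounded away from $0$ and $1$, $S_\lambda$ has strictly smaller risk than $S_0$ for all large $d$.
   Context: Zero bias vectors: for mean zero $\mathbf Y$ with law $\nu$ and covariance $\Sigma=(\sigma_{ij})$ positive definite, a collection $\{\mathbf Y^{ij}:\sigma_{ij}\neq0\}$ with laws $\nu^{ij}$ are the zero bias vectors of $\mathbf Y$ if $E\langle\mathbf Y,\mathbf f(\mathbf Y)\rangle=E\sum_{i,j}\sigma_{ij}\partial_jf_i(\mathbf Y^{ij})$ for all $\mathbf f\in W^{1,2}_z(\nu)$, the space of $\mathbf f:\mathbb{R}^d\to\mathbb{R}^d$ with $\int\|\mathbf f\|^2d\nu+\sum_{i,j}\int|\partial_jf_i|^2d\nu^{ij}<\infty$; for $\mathbf X=\mathbf Y+\boldsymbol\theta$ set $\mathbf X^{ij}=\mathbf Y^{ij}+\boldsymbol\theta$; in the diagonal case write $\mathbf X^i=\mathbf X^{ii}$, with $i$-th coordinate $X^i_i$. Univariate zero bias: for real $X$ with mean $\theta$, variance $\sigma^2>0$, $X^*$ has the $X$-zero bias distribution if $E[(X-\theta)f(X)]=\sigma^2E[f'(X^* )]$ for all absolutely continuous $f$ with the expectation finite. Mixture: $\mathbf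 Y$ has law $\int m_s\,\mu(ds)$ where $\mathbf Y_s\sim m_s$, $\mu$ a probability on a measurable space $\mathcal S$, $E_{\boldsymbol\theta,s}$ expectation under $m_s$ shifted by $\boldsymbol\theta$. $\mathbf x^{\neg i}=(x_1,\dots,x_{i-1},x_{i+1},\dots,x_d)$. $\mathbf g_0(\mathbf x)=\mathbf x/\|\mathbf x\|^2$, $S_\lambda(\mathbf x)=\mathbf x(1-\lambda/\|\mathbf x\|^2)$, risk $E_{\boldsymbol\theta}\|S(\mathbf X)-\boldsymbol\theta\|^2$. Expressions involving only marginals of $\mathbf X$ and $\mathbf X^{ij}$ do not depend on their coupling. *)

theory Defs
  imports "HOL-Probability.Probability"
begin

text \<open>Vectors of R^d are represented as extensional functions nat => real
  (value undefined outside the index set {..<d}), i.e. elements of the space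
  of the product measure Rd d.  This allows the dimension d to vary, which is
  needed for the asymptotic (d to infinity) statements.\<close>

type_synonym rvec = "nat \<Rightarrow> real"

definition Rd :: "nat \<Rightarrow> rvec measure" where
  "Rd d = (\<Pi>\<^sub>M i\<in>{..<d}. (borel :: real measure))"

definition zvec :: "nat \<Rightarrow> rvec" where
  "zvec d = (\<lambda>i\<in>{..<d}. 0)"

definition vplus :: "nat \<Rightarrow> rvec \<Rightarrow> rvec \<Rightarrow> rvec" where
  "vplus d x y = (\<lambda>i\<in>{..<d}. x i + y i)"

definition sqn :: "nat \<Rightarrow> rvec \<Rightarrow> real" where
  "sqn d x = (\<Sum>i<d. (x i)\<^sup>2)"

definition sqdist :: "nat \<Rightarrow> rvec \<Rightarrow> rvec \<Rightarrow> real" where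
  "sqdist d x y = (\<Sum>i<d. (x i - y i)\<^sup>2)"

definition norm1 :: "nat \<Rightarrow> rvec \<Rightarrow> real" where
  "norm1 d x = (\<Sum>i<d. \<bar>x i\<bar>)"

definition sqn_not :: "nat \<Rightarrow> nat \<Rightarrow> rvec \<Rightarrow> real" where
  "sqn_not d i x = (\<Sum>j\<in>{..<d} - {i}. (x j)\<^sup>2)"

definition g0 :: "nat \<Rightarrow> rvec \<Rightarrow> rvec" where
  "g0 d x = (\<lambda>i\<in>{..<d}. x i / sqn d x)"

definition fl :: "nat \<Rightarrow> real \<Rightarrow> rvec \<Rightarrow> rvec" where
  "fl d lam x = (\<lambda>i\<in>{..<d}. - lam * (x i / sqn d x))"

definition Slam :: "nat \<Rightarrow> real \<Rightarrow> rvec \<Rightarrow> rvec" where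
  "Slam d lam x = (\<lambda>i\<in>{..<d}. x i * (1 - lam / sqn d x))"

definition pd :: "(rvec \<Rightarrow> rvec) \<Rightarrow> nat \<Rightarrow> nat \<Rightarrow> rvec \<Rightarrow> real" where
  "pd f i j x = deriv (\<lambda>t. f (x(j := x j + t)) i) 0"

definition posdef :: "nat \<Rightarrow> (nat \<Rightarrow> nat \<Rightarrow> real) \<Rightarrow> bool" where
  "posdef d S \<longleftrightarrow> (\<forall>v\<in>space (Rd d). v \<noteq> zvec d \<longrightarrow> (\<Sum>i<d. \<Sum>j<d. v i * S i j * v j) > 0)"

definition is_eigenvalue :: "nat \<Rightarrow> (nat \<Rightarrow> nat \<Rightarrow> real) \<Rightarrow> real \<Rightarrow> bool" where
  "is_eigenvalue d S k \<longleftrightarrow>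
     (\<exists>v\<in>space (Rd d). v \<noteq> zvec d \<and> (\<forall>i<d. (\<Sum>j<d. S i j * v j) = k * v i))"

definition largest_eigenvalue :: "nat \<Rightarrow> (nat \<Rightarrow> nat \<Rightarrow> real) \<Rightarrow> real \<Rightarrow> bool" where
  "largest_eigenvalue d S \<kappa> \<longleftrightarrow> is_eigenvalue d S \<kappa> \<and> (\<forall>k. is_eigenvalue d S k \<longrightarrow> k \<le> \<kappa>)"

definition trace :: "nat \<Rightarrow> (nat \<Rightarrow> nat \<Rightarrow> real) \<Rightarrow> real" where
  "trace d S = (\<Sum>i<d. S i i)"

definition mean_zero_cov :: "'a measure \<Rightarrow> nat \<Rightarrow> ('a \<Rightarrow> rvec) \<Rightarrow> (nat \<Rightarrow> nat \<Rightarrow> real) \<Rightarrow> bool" where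
  "mean_zero_cov M d Y S \<longleftrightarrow> prob_space M \<and> Y \<in> M \<rightarrow>\<^sub>M Rd d \<and>
     (\<forall>i<d. integrable M (\<lambda>\<omega>. (Y \<omega> i)\<^sup>2) \<and> (\<integral>\<omega>. Y \<omega> i \<partial>M) = 0) \<and>
     (\<forall>i<d. \<forall>j<d. S i j = (\<integral>\<omega>. Y \<omega> i * Y \<omega> j \<partial>M)) \<and> posdef d S"

text \<open>The class W^{1,2}_z: here taken as functions whose coordinate partial
  derivatives exist and are continuous on R^d minus the origin, with the
  square-integrability conditions w.r.t. the law of X and the laws of the X^{ij}.\<close>
definition Wz :: "'a measure \<Rightarrow> nat \<Rightarrow> (nat \<Rightarrow> nat \<Rightarrow> real) \<Rightarrow> ('a \<Rightarrow> rvec)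
    \<Rightarrow> (nat \<Rightarrow> nat \<Rightarrow> 'a \<Rightarrow> rvec) \<Rightarrow> (rvec \<Rightarrow> rvec) \<Rightarrow> bool" where
  "Wz M d S X Xz f \<longleftrightarrow>
     (\<forall>x\<in>space (Rd d) - {zvec d}. \<forall>i<d. \<forall>j<d.
         (\<lambda>t. f (x(j := x j + t)) i) differentiable (at 0)) \<and>
     (\<forall>i<d. \<forall>j<d. continuous_on (space (Rd d) - {zvec d}) (pd f i j)) \<and>
     (\<forall>i<d. (\<lambda>\<omega>. f (X \<omega>) i) \<in> borel_measurable M) \<and>
     integrable M (\<lambda>\<omega>. sqn d (f (X \<omega>))) \<and>
     (\<forall>i<d. \<forall>j<d. S i j \<noteq> 0 \<longrightarrow>
         (\<lambda>\<omega>. pd f i j (Xz i j \<omega>)) \<in> borel_measurable M \<and>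
         integrable M (\<lambda>\<omega>. (pd f i j (Xz i j \<omega>))\<^sup>2))"

definition zero_bias_vectors :: "'a measure \<Rightarrow> nat \<Rightarrow> rvec \<Rightarrow> (nat \<Rightarrow> nat \<Rightarrow> real)
    \<Rightarrow> ('a \<Rightarrow> rvec) \<Rightarrow> (nat \<Rightarrow> nat \<Rightarrow> 'a \<Rightarrow> rvec) \<Rightarrow> bool" where
  "zero_bias_vectors M d \<theta> S X Xz \<longleftrightarrow>
     (\<forall>i<d. \<forall>j<d. S i j \<noteq> 0 \<longrightarrow> Xz i j \<in> M \<rightarrow>\<^sub>M Rd d) \<and>
     (\<forall>f. Wz M d S X Xz f \<longrightarrow>
        (\<integral>\<omega>. (\<Sum>i<d. (X \<omega> i - \<theta> i) * f (X \<omega>) i) \<partial>M)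
          = (\<Sum>i<d. \<Sum>j<d. S i j * (\<integral>\<omega>. pd f i j (Xz i j \<omega>) \<partial>M)))"

definition Xof :: "nat \<Rightarrow> ('a \<Rightarrow> rvec) \<Rightarrow> rvec \<Rightarrow> 'a \<Rightarrow> rvec" where
  "Xof d Y \<theta> = (\<lambda>\<omega>. vplus d (Y \<omega>) \<theta>)"

text \<open>The standing setting: X = Y + theta, Y mean zero with covariance sigma,
  zero bias vectors X^{ij} exist, g0 in W^{1,2}_z (in particular g0(X) and the
  partial derivatives of g0 at X^{ij} are a.s. defined, i.e. X, X^{ij} are a.s.
  nonzero).\<close>
definition setting :: "'a measure \<Rightarrow> nat \<Rightarrow> ('a \<Rightarrow> rvec) \<Rightarrow> rvec \<Rightarrow> (nat \<Rightarrow> nat \<Rightarrow> real)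
    \<Rightarrow> (nat \<Rightarrow> nat \<Rightarrow> 'a \<Rightarrow> rvec) \<Rightarrow> bool" where
  "setting M d Y \<theta> S Xz \<longleftrightarrow>
     mean_zero_cov M d Y S \<and> \<theta> \<in> space (Rd d) \<and>
     zero_bias_vectors M d \<theta> S (Xof d Y \<theta>) Xz \<and>
     Wz M d S (Xof d Y \<theta>) Xz (g0 d) \<and>
     (AE \<omega> in M. Xof d Y \<theta> \<omega> \<noteq> zvec d) \<and>
     (\<forall>i<d. \<forall>j<d. S i j \<noteq> 0 \<longrightarrow> (AE \<omega> in M. Xz i j \<omega> \<noteq> zvec d))"

definition risk :: "'a measure \<Rightarrow> nat \<Rightarrow> rvec \<Rightarrow> ('a \<Rightarrow> rvec) \<Rightarrow> real \<Rightarrow> real" where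
  "risk M d \<theta> X lam = (\<integral>\<omega>. sqdist d (Slam d lam (X \<omega>)) \<theta> \<partial>M)"

text \<open>B^*_lambda = | E sum_{i,j} sigma_ij [d_j f_i(X^{ij}) - d_j f_i(X)] |, f = -lambda g0
  (written as the sum of differences of expectations, since X^{ij} and X need not be coupled)\<close>
definition Bstar :: "'a measure \<Rightarrow> nat \<Rightarrow> (nat \<Rightarrow> nat \<Rightarrow> real) \<Rightarrow> ('a \<Rightarrow> rvec)
    \<Rightarrow> (nat \<Rightarrow> nat \<Rightarrow> 'a \<Rightarrow> rvec) \<Rightarrow> real \<Rightarrow> real" where
  "Bstar M d S X Xz lam = \<bar>\<Sum>i<d. \<Sum>j<d. S i j *
      ((\<integral>\<omega>. pd (fl d lam) i j (Xz i j \<omega>) \<partial>M) - (\<integral>\<omega>. pd (fl d lam) i j (X \<omega>) \<partial>M))\<bar>"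

definition cov :: "'a measure \<Rightarrow> ('a \<Rightarrow> real) \<Rightarrow> ('a \<Rightarrow> real) \<Rightarrow> real" where
  "cov M A B = (\<integral>\<omega>. A \<omega> * B \<omega> \<partial>M) - (\<integral>\<omega>. A \<omega> \<partial>M) * (\<integral>\<omega>. B \<omega> \<partial>M)"

definition isotropic :: "nat \<Rightarrow> (nat \<Rightarrow> nat \<Rightarrow> real) \<Rightarrow> real \<Rightarrow> bool" where
  "isotropic d S s2 \<longleftrightarrow> s2 > 0 \<and> (\<forall>i<d. \<forall>j<d. S i j = (if i = j then s2 else 0))"

definition abs_cont_on :: "real \<Rightarrow> real \<Rightarrow> (real \<Rightarrow> real) \<Rightarrow> bool" where
  "abs_cont_on a b f \<longleftrightarrow> (\<forall>\<epsilon>>0. \<exists>\<delta>>0. \<forall>(n::nat) (u::nat \<Rightarrow> real) v.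
      (\<forall>k<n. a \<le> u k \<and> u k \<le> v k \<and> v k \<le> b) \<and> (\<forall>k<n. \<forall>l<n. k < l \<longrightarrow> v k \<le> u l) \<and>
      (\<Sum>k<n. v k - u k) < \<delta> \<longrightarrow> (\<Sum>k<n. \<bar>f (v k) - f (u k)\<bar>) < \<epsilon>)"

definition zero_bias_1d :: "'b measure \<Rightarrow> ('b \<Rightarrow> real) \<Rightarrow> real \<Rightarrow> real \<Rightarrow> ('b \<Rightarrow> real) \<Rightarrow> bool" where
  "zero_bias_1d N X m v Z \<longleftrightarrow> Z \<in> borel_measurable N \<and>
     (\<forall>f f'. (\<forall>a b. abs_cont_on a b f) \<and> (AE x in lborel. (f has_real_derivative f' x) (at x)) \<and>
        integrable N (\<lambda>\<omega>. (X \<omega> - m) * f (X \<omega>)) \<and> integrable N (\<lambda>\<omega>. f' (Z \<omega>)) \<longrightarrow>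
        (\<integral>\<omega>. (X \<omega> - m) * f (X \<omega>) \<partial>N) = v * (\<integral>\<omega>. f' (Z \<omega>) \<partial>N))"

definition mixture :: "'a measure \<Rightarrow> nat \<Rightarrow> ('a \<Rightarrow> rvec) \<Rightarrow> 's measure \<Rightarrow> ('s \<Rightarrow> 'b measure)
    \<Rightarrow> ('s \<Rightarrow> 'b \<Rightarrow> rvec) \<Rightarrow> bool" where
  "mixture M d Y \<mu> N Ys \<longleftrightarrow> prob_space \<mu> \<and>
     (\<forall>s\<in>space \<mu>. prob_space (N s) \<and> Ys s \<in> N s \<rightarrow>\<^sub>M Rd d) \<and>
     (\<forall>A\<in>sets (Rd d).
        (\<lambda>s. measure (N s) (Ys s -` A \<inter> space (N s))) \<in> borel_measurable \<mu> \<and>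
        measure M (Y -` A \<inter> space M) = (\<integral>s. measure (N s) (Ys s -` A \<inter> space (N s)) \<partial>\<mu>))"

definition iso_indep :: "'b measure \<Rightarrow> nat \<Rightarrow> ('b \<Rightarrow> rvec) \<Rightarrow> real \<Rightarrow> bool" where
  "iso_indep N d Y s2 \<longleftrightarrow>
     (\<forall>i<d. integrable N (\<lambda>\<omega>. (Y \<omega> i)\<^sup>2) \<and> (\<integral>\<omega>. Y \<omega> i \<partial>N) = 0) \<and>
     (\<forall>i<d. \<forall>j<d. (\<integral>\<omega>. Y \<omega> i * Y \<omega> j \<partial>N) = (if i = j then s2 else 0)) \<and>
     prob_space.indep_vars N (\<lambda>_. borel) (\<lambda>i \<omega>. Y \<omega> i) {..<d}"

definition mixture_hyps :: "'a measure \<Rightarrow> nat \<Rightarrow> ('a \<Rightarrow> rvec) \<Rightarrow> rvec \<Rightarrow> real \<Rightarrow> 's measure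
    \<Rightarrow> ('s \<Rightarrow> 'b measure) \<Rightarrow> ('s \<Rightarrow> 'b \<Rightarrow> rvec) \<Rightarrow> real \<Rightarrow> bool" where
  "mixture_hyps M d Y \<theta> s2 \<mu> N Ys Cm2 \<longleftrightarrow> mixture M d Y \<mu> N Ys \<and>
     (\<forall>s\<in>space \<mu>. iso_indep (N s) d (Ys s) s2 \<and>
        (\<forall>i<d. (AE \<omega> in N s. sqn_not d i (Xof d (Ys s) \<theta> \<omega>) \<noteq> 0) \<and>
           (\<integral>\<^sup>+\<omega>. ennreal ((real d / sqn_not d i (Xof d (Ys s) \<theta> \<omega>))\<^sup>2) \<partial>N s) \<le> ennreal Cm2))"


definition Rd_not :: "nat \<Rightarrow> nat \<Rightarrow> rvec measure" where
  "Rd_not d i = (\<Pi>\<^sub>M j\<in>{..<d} - {i}. (borel :: real measure))"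

definition part1_moments :: "'a measure \<Rightarrow> nat \<Rightarrow> ('a \<Rightarrow> rvec) \<Rightarrow> rvec \<Rightarrow> real \<Rightarrow> real \<Rightarrow> real \<Rightarrow> bool" where
  "part1_moments M d Y \<theta> Cm4 C4 C8 \<longleftrightarrow>
     (\<forall>i<d. (AE \<omega> in M. sqn_not d i (Xof d Y \<theta> \<omega>) \<noteq> 0) \<and>
        (\<integral>\<^sup>+\<omega>. ennreal ((real d / sqn_not d i (Xof d Y \<theta> \<omega>)) ^ 4) \<partial>M) \<le> ennreal Cm4) \<and>
     (\<forall>i<d. (\<integral>\<^sup>+\<omega>. ennreal ((Xof d Y \<theta> \<omega> i - \<theta> i) ^ 4) \<partial>M) \<le> ennreal C4 \<and>
        (\<integral>\<^sup>+\<omega>. ennreal ((Xof d Y \<theta> \<omega> i - \<theta> i) ^ 8) \<partial>M) \<le> ennreal C8)"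

definition cov_sum :: "'a measure \<Rightarrow> nat \<Rightarrow> ('a \<Rightarrow> rvec) \<Rightarrow> rvec \<Rightarrow> real" where
  "cov_sum M d Y \<theta> = (\<Sum>i<d. \<bar>cov M (\<lambda>\<omega>. (Xof d Y \<theta> \<omega> i - \<theta> i)\<^sup>2)
                                    (\<lambda>\<omega>. 1 / sqn_not d i (Xof d Y \<theta> \<omega>))\<bar>)"


definition indep_rv :: "'b measure \<Rightarrow> ('b \<Rightarrow> real) \<Rightarrow> ('b \<Rightarrow> 'c) \<Rightarrow> 'c measure \<Rightarrow> bool" where
  "indep_rv N Z W MW \<longleftrightarrow> Z \<in> borel_measurable N \<and> W \<in> N \<rightarrow>\<^sub>M MW \<and>
     (\<forall>A\<in>sets borel. \<forall>B\<in>sets MW.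
        measure N {\<omega>\<in>space N. Z \<omega> \<in> A \<and> W \<omega> \<in> B}
          = measure N {\<omega>\<in>space N. Z \<omega> \<in> A} * measure N {\<omega>\<in>space N. W \<omega> \<in> B})"

end

theory Submission
  imports Defs
begin

text \<open>Write \<open>\<xi>\<^sub>i = X\<^sub>i - \<theta>\<^sub>i\<close>, \<open>w\<^sub>i = \<parallel>X\<^sup>\<not>\<^sup>i\<parallel>\<^sup>2\<close> and \<open>R = \<parallel>X\<parallel>\<^sup>2\<close>. The general risk bound is Stein's identity for
  \<open>g\<^sub>0\<close> together with the Rayleigh quotient bound for \<open>X\<^sup>T \<Sigma> X\<close>. For \<open>\<Sigma> = \<sigma>\<^sup>2 Id\<close> the zero bias identity for
  \<open>g\<^sub>0\<close> gives \<open>B\<^sup>* = \<lambda> \<bar>\<Sum>\<^sub>i T\<^sub>i\<bar>\<close> with \<open>T\<^sub>i = E[\<xi>\<^sub>i X\<^sub>i / R - \<sigma>\<^sup>2 (R - 2 X\<^sub>i\<^sup>2) / R\<^sup>2]\<close>. The zero bias identity also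
  shows \<open>E[\<xi>\<^sub>i \<theta>\<^sub>i / (\<theta>\<^sub>i\<^sup>2 + w\<^sub>i)] = 0\<close>, since this weight does not involve \<open>X\<^sub>i\<close>, and subtracting it splits
  \<open>T\<^sub>i = Cov(\<xi>\<^sub>i\<^sup>2, 1/w\<^sub>i) - A\<^sub>i + B\<^sub>i\<close> with \<open>A\<^sub>i = E[\<xi>\<^sub>i\<^sup>2 \<kappa>\<^sub>i / w\<^sub>i]\<close> and \<open>B\<^sub>i\<close> nonnegative.

  Under independence the covariance vanishes and \<open>A\<^sub>i\<close>, \<open>B\<^sub>i\<close> are bounded separately; mixtures follow by
  integrating over \<open>\<mu>\<close>. Without independence, bounding each \<open>A\<^sub>i\<close> alone costs a term of order
  \<open>\<theta>\<^sub>i\<^sup>2 \<surd>C\<^sub>4\<close>, which for \<open>C\<^sub>4 < 1\<close> can exceed the claimed one. Instead the \<open>A\<^sub>i\<close> are bounded jointly, by a pointwise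
  inequality \<open>\<Sum> \<xi>\<^sub>i\<^sup>2 \<kappa>\<^sub>i / w\<^sub>i \<le> \<Sum> \<delta>\<^sub>i \<xi>\<^sub>i\<^sup>2 / w\<^sub>i + \<Sum> a\<^sub>i (\<xi>\<^sub>i\<^sup>2 / w\<^sub>i)\<^sup>2\<close> with \<open>0 \<le> \<delta>\<^sub>i \<le> 2\<close>, \<open>\<Sum> \<delta>\<^sub>i \<le> 9\<close> and
  \<open>\<Sum> a\<^sub>i \<le> 2d\<close>: as \<open>\<bar>1 - \<delta>\<^sub>i\<bar> \<le> 1\<close>, the covariances still enter with weight at most one, and what is left of the
  \<open>\<delta>\<^sub>i\<close>-term is offset by \<open>\<Sum> B\<^sub>i \<ge> 3 \<sigma>\<^sup>2 E[1/R]\<close>.\<close>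

subsection \<open>A pointwise inequality\<close>

text \<open>The weight subtracted is the value of \<open>x / (x^2 + w)\<close> at
  \<open>x = t\<close>. What remains of the score is \<open>(x - t)\<close> times an increment of
  that function, hence of second order in \<open>x - t\<close>; this is where the covariance with
  \<open>1 / w\<close> and the factor \<open>1 - kap\<close> come from.

  In the joint bound fourth powers of \<open>x - t\<close> alone cannot suffice: for
  \<open>x\<close> close to \<open>\<theta>\<close> the left hand side is only quadratic in
  \<open>x - \<theta>\<close>. This forces the linear weights \<open>\<delta>\<close>. The constants
  are dictated by the target. The total \<open>2 * d\<close> of the weights \<open>a\<close> times
  \<open>sqrt C8\<close> is exactly \<open>6 * d * sqrt C8 / 3\<close>. The total tilt 9 is the
  largest that can be paid for: with \<open>c = E R\<close> and \<open>p = sqrt Q * c\<close>, where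
  Jensen's inequality gives \<open>p \<ge> 1\<close>, the remaining requirement is
  \<open>9 * p \<le> 6 * p^2 + 3\<close>, an equality at \<open>p = 1\<close>.\<close>

lemma quadratic_nonneg:
  fixes a b c v :: real
  assumes a: "0 \<le> a" and c: "0 \<le> c" and b: "b\<^sup>2 \<le> 4 * a * c"
  shows "0 \<le> a * v\<^sup>2 + b * v + c"
proof (cases "a = 0")
  case True
  then show ?thesis using b c by simp
next
  case False
  have "4 * a * (a * v\<^sup>2 + b * v + c) = (2 * a * v + b)\<^sup>2 + (4 * a * c - b\<^sup>2)"
    by (simp add: power2_eq_square algebra_simps)
  also have "\<dots> \<ge> 0" using b by simp
  finally show ?thesis using a False by (simp add: zero_le_mult_iff)
qed

text \<open>A certificate: on \<open>v \<ge> 0\<close> the quartic dominates, coefficient by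
  coefficient, \<open>(v - r)^2\<close> times a nonnegative quadratic. The parameter
  \<open>r\<close> imitates a double root, so that nearly degenerate quartics are still
  covered.\<close>

lemma quartic_nonneg:
  fixes c0 c1 c2 c3 c4 r b g v :: real
  assumes v: "0 \<le> v" and a: "0 \<le> c4" and g: "0 \<le> g" and b: "0 \<le> b \<or> b\<^sup>2 \<le> 4 * c4 * g"
    and c3: "b - 2 * r * c4 \<le> c3" and c2: "g - 2 * r * b + r\<^sup>2 * c4 \<le> c2"
    and c1: "r\<^sup>2 * b - 2 * r * g \<le> c1" and c0: "r\<^sup>2 * g \<le> c0"
  shows "0 \<le> c4 * v ^ 4 + c3 * v ^ 3 + c2 * v\<^sup>2 + c1 * v + c0"
proof -
  have q: "0 \<le> c4 * v\<^sup>2 + b * v + g"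
    using b by (rule disjE) (use v a g quadratic_nonneg in auto)
  have "0 \<le> (v - r)\<^sup>2 * (c4 * v\<^sup>2 + b * v + g)" using q by simp
  moreover have "0 \<le> (c3 - (b - 2 * r * c4)) * v ^ 3" "0 \<le> (c2 - (g - 2 * r * b + r\<^sup>2 * c4)) * v\<^sup>2"
    "0 \<le> (c1 - (r\<^sup>2 * b - 2 * r * g)) * v"
    using v c3 c2 c1 by (intro mult_nonneg_nonneg; simp)+
  moreover have "c4 * v ^ 4 + c3 * v ^ 3 + c2 * v\<^sup>2 + c1 * v + c0
      = (v - r)\<^sup>2 * (c4 * v\<^sup>2 + b * v + g) + (c3 - (b - 2 * r * c4)) * v ^ 3
        + (c2 - (g - 2 * r * b + r\<^sup>2 * c4)) * v\<^sup>2 + (c1 - (r\<^sup>2 * b - 2 * r * g)) * v + (c0 - r\<^sup>2 * g)"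
    by (simp add: power2_eq_square power3_eq_cube power4_eq_xxxx algebra_simps)
  ultimately show ?thesis using c0 by linarith
qed

text \<open>In the normalisation \<open>\<parallel>\<theta>\<parallel>\<^sup>2 = d\<close>, \<open>\<parallel>x\<parallel>\<^sup>2 = \<rho> d\<close>, the pointwise inequality holds coordinatewise up to
  \<open>m (x\<^sub>i\<^sup>2 - \<rho> \<theta>\<^sub>i\<^sup>2) + z (1 - \<theta>\<^sub>i\<^sup>2)\<close>, which sums to zero: \<open>m\<close> and \<open>z\<close> are Lagrange multipliers for the two norm
  constraints. The conditions say that certain quadratics in \<open>\<theta>\<^sub>i\<close> have nonpositive discriminant. They are affine
  in \<open>\<rho>\<close>, so that a pair of multipliers valid at both ends of an interval is valid throughout.\<close>
definition multipliers :: "real \<Rightarrow> real \<Rightarrow> real \<Rightarrow> bool" where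
  "multipliers m z \<rho> \<longleftrightarrow> 0 \<le> m \<and> 0 \<le> z \<and> 0 \<le> m * (1 - \<rho>) - z \<and>
    (\<forall>v\<ge>0. 0 \<le> v\<^sup>2 / 2 - (3 - 9 * \<rho>) * v + (m * (1 - \<rho>) - z) \<and>
       v * (2 * m - 3 * v)\<^sup>2
         \<le> 4 * (v\<^sup>2 / 2 - (3 - 9 * \<rho>) * v + (m * (1 - \<rho>) - z)) * (v\<^sup>2 / 2 + m * v + z) \<and>
       m\<^sup>2 * v \<le> (v\<^sup>2 / 2 + 7 / 8 * \<rho> * v + (m * (1 - \<rho>) - z)) * (3 / 2 * v\<^sup>2 + m * v + z))"

lemma affine_nonneg_between:
  fixes a b :: "real"
  assumes "0 \<le> p + a * q" "0 \<le> p + b * q" "a \<le> x" "x \<le> b"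
  shows "0 \<le> p + x * q"
proof (cases "0 \<le> q")
  case True
  then have "a * q \<le> x * q" using assms by (intro mult_right_mono)
  then show ?thesis using assms by linarith
next
  case False
  then have "b * q \<le> x * q" using assms by (intro mult_right_mono_neg) auto
  then show ?thesis using assms by linarith
qed

text \<open>In each product of the conditions only one factor contains \<open>\<rho>\<close>, so no
  \<open>\<rho>^2\<close> arises and the two end points decide.\<close>

lemma multipliers_between:
  assumes a: "multipliers m z a" and b: "multipliers m z b" and "a \<le> \<rho>" "\<rho> \<le> b"
  shows "multipliers m z \<rho>"
proof -
  have 1: "0 \<le> m" "0 \<le> z" using a by (auto simp: multipliers_def)
  have 2: "0 \<le> m * (1 - \<rho>) - z"
    using affine_nonneg_between[of "m - z" a "- m" b \<rho>] a b assms(3,4)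
    by (simp add: multipliers_def algebra_simps)
  have 3: "0 \<le> v\<^sup>2 / 2 - (3 - 9 * \<rho>) * v + (m * (1 - \<rho>) - z)" if v: "v \<ge> 0" for v
  proof -
    have e: "x\<^sup>2 / 2 - (3 - 9 * r) * x + (m * (1 - r) - z) = (x\<^sup>2 / 2 - 3 * x + m - z) + r * (9 * x - m)"
      for x r :: real by (simp add: algebra_simps)
    show ?thesis unfolding e
      by (rule affine_nonneg_between[of _ a _ b])
        (use a b v assms(3,4) in \<open>auto simp: multipliers_def e[symmetric]\<close>)
  qed
  have 4: "v * (2 * m - 3 * v)\<^sup>2
      \<le> 4 * (v\<^sup>2 / 2 - (3 - 9 * \<rho>) * v + (m * (1 - \<rho>) - z)) * (v\<^sup>2 / 2 + m * v + z)" if v: "v \<ge> 0" for v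
  proof -
    have e: "4 * (v\<^sup>2 / 2 - (3 - 9 * r) * v + (m * (1 - r) - z)) * (v\<^sup>2 / 2 + m * v + z) - v * (2 * m - 3 * v)\<^sup>2
      = (4 * (v\<^sup>2 / 2 - 3 * v + m - z) * (v\<^sup>2 / 2 + m * v + z) - v * (2 * m - 3 * v)\<^sup>2)
        + r * (4 * (9 * v - m) * (v\<^sup>2 / 2 + m * v + z))" for r
      by (simp add: algebra_simps)
    have "0 \<le> 4 * (v\<^sup>2 / 2 - (3 - 9 * r) * v + (m * (1 - r) - z)) * (v\<^sup>2 / 2 + m * v + z) - v * (2 * m - 3 * v)\<^sup>2"
      if "multipliers m z r" for r using that v by (simp add: multipliers_def)
    from this[OF a] this[OF b] show ?thesis
      unfolding e using affine_nonneg_between[OF _ _ assms(3,4)] e[of \<rho>] by force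
  qed
  have 5: "m\<^sup>2 * v \<le> (v\<^sup>2 / 2 + 7 / 8 * \<rho> * v + (m * (1 - \<rho>) - z)) * (3 / 2 * v\<^sup>2 + m * v + z)" if v: "v \<ge> 0" for v
  proof -
    have e: "(v\<^sup>2 / 2 + 7 / 8 * r * v + (m * (1 - r) - z)) * (3 / 2 * v\<^sup>2 + m * v + z) - m\<^sup>2 * v
      = ((v\<^sup>2 / 2 + (m - z)) * (3 / 2 * v\<^sup>2 + m * v + z) - m\<^sup>2 * v)
        + r * ((7 / 8 * v - m) * (3 / 2 * v\<^sup>2 + m * v + z))" for r
      by (simp add: field_simps power2_eq_square)
    have "0 \<le> (v\<^sup>2 / 2 + 7 / 8 * r * v + (m * (1 - r) - z)) * (3 / 2 * v\<^sup>2 + m * v + z) - m\<^sup>2 * v"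
      if "multipliers m z r" for r using that v by (simp add: multipliers_def)
    from this[OF a] this[OF b] show ?thesis
      unfolding e using affine_nonneg_between[OF _ _ assms(3,4)] e[of \<rho>] by force
  qed
  show ?thesis unfolding multipliers_def using 1 2 3 4 5 by blast
qed

text \<open>Replaces the conditions quantified over \<open>v\<close> by finitely many numerical
  inequalities. The parameters with suffix 2 certify the second condition, a quartic with leading
  coefficient 1, and those with suffix 3 the third, with leading coefficient \<open>3 / 4\<close>.
  \<open>disc\<close> treats the remaining quadratic by its vertex.\<close>

lemma multipliersI:
  fixes m z \<rho> r2 b2 g2 r3 b3 g3 g h :: real
  assumes g: "g = 3 - 9 * \<rho>" and h: "h = m * (1 - \<rho>) - z" and "0 \<le> m" "0 \<le> z" "0 \<le> h" "0 \<le> \<rho>"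
    and disc: "g \<le> 0 \<or> g\<^sup>2 \<le> 2 * h"
    and g2: "0 \<le> g2" "0 \<le> b2 \<or> b2\<^sup>2 \<le> 4 * g2" "b2 - 2 * r2 \<le> 2 * m - 2 * g - 9"
      "g2 - 2 * r2 * b2 + r2\<^sup>2 \<le> 2 * z - 4 * g * m + 2 * h + 12 * m"
      "r2\<^sup>2 * b2 - 2 * r2 * g2 \<le> 4 * (h * m - g * z) - 4 * m\<^sup>2" "r2\<^sup>2 * g2 \<le> 4 * h * z"
    and g3: "0 \<le> g3" "0 \<le> b3 \<or> b3\<^sup>2 \<le> 3 * g3" "b3 - 3 / 2 * r3 \<le> m / 2 + 21 / 16 * \<rho>"
      "g3 - 2 * r3 * b3 + 3 / 4 * r3\<^sup>2 \<le> z / 2 + 7 / 8 * \<rho> * m + 3 / 2 * h"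
      "r3\<^sup>2 * b3 - 2 * r3 * g3 \<le> 7 / 8 * \<rho> * z + h * m - m\<^sup>2" "r3\<^sup>2 * g3 \<le> h * z"
  shows "multipliers m z \<rho>"
proof -
  have A: "0 \<le> v\<^sup>2 / 2 - g * v + h" if v: "v \<ge> 0" for v
  proof (cases "g \<le> 0")
    case True
    then have "g * v \<le> 0" using v by (simp add: mult_nonpos_nonneg)
    then show ?thesis using \<open>0 \<le> h\<close> by (smt (verit) zero_le_power2 divide_nonneg_nonneg)
  next
    case False
    then have "g\<^sup>2 \<le> 2 * h" using disc by simp
    moreover have "2 * (v\<^sup>2 / 2 - g * v + h) = (v - g)\<^sup>2 + (2 * h - g\<^sup>2)"
      by (simp add: power2_eq_square algebra_simps)
    ultimately show ?thesis by (smt (verit) zero_le_power2)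
  qed
  have B: "v * (2 * m - 3 * v)\<^sup>2 \<le> 4 * (v\<^sup>2 / 2 - g * v + h) * (v\<^sup>2 / 2 + m * v + z)" if v: "v \<ge> 0" for v
  proof -
    have "0 \<le> 1 * v ^ 4 + (2 * m - 2 * g - 9) * v ^ 3 + (2 * z - 4 * g * m + 2 * h + 12 * m) * v\<^sup>2
        + (4 * (h * m - g * z) - 4 * m\<^sup>2) * v + 4 * h * z"
      by (rule quartic_nonneg[where r = r2 and b = b2 and g = g2]) (use g2 v in auto)
    also have "\<dots> = 4 * (v\<^sup>2 / 2 - g * v + h) * (v\<^sup>2 / 2 + m * v + z) - v * (2 * m - 3 * v)\<^sup>2"
      by (simp add: power2_eq_square power3_eq_cube power4_eq_xxxx algebra_simps)
    finally show ?thesis by simp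
  qed
  have C: "m\<^sup>2 * v \<le> (v\<^sup>2 / 2 + 7 / 8 * \<rho> * v + h) * (3 / 2 * v\<^sup>2 + m * v + z)" if v: "v \<ge> 0" for v
  proof -
    have "0 \<le> 3 / 4 * v ^ 4 + (m / 2 + 21 / 16 * \<rho>) * v ^ 3 + (z / 2 + 7 / 8 * \<rho> * m + 3 / 2 * h) * v\<^sup>2
        + (7 / 8 * \<rho> * z + h * m - m\<^sup>2) * v + h * z"
      by (rule quartic_nonneg[where r = r3 and b = b3 and g = g3]) (use g3 v in auto)
    also have "\<dots> = (v\<^sup>2 / 2 + 7 / 8 * \<rho> * v + h) * (3 / 2 * v\<^sup>2 + m * v + z) - m\<^sup>2 * v"
      by (simp add: power2_eq_square power3_eq_cube power4_eq_xxxx algebra_simps)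
    finally show ?thesis by simp
  qed
  show ?thesis using A B C assms(3-5) unfolding multipliers_def g h by blast
qed

lemma multipliers_exist:
  assumes "0 \<le> \<rho>"
  shows "\<exists>m z. multipliers m z \<rho>"
proof -
  \<comment> \<open>The intervals, the multipliers and the approximate double roots \<open>r2\<close>, \<open>r3\<close> come from a numerical search.\<close>
  note I = multipliersI[OF refl refl]
  consider "\<rho> \<le> 17/100" | "17/100 \<le> \<rho>" "\<rho> \<le> 3/10" | "3/10 \<le> \<rho>" "\<rho> \<le> 42/100"
    | "42/100 \<le> \<rho>" "\<rho> \<le> 53/100" | "53/100 \<le> \<rho>" "\<rho> \<le> 66/100" | "66/100 \<le> \<rho>" "\<rho> \<le> 85/100"
    | "85/100 \<le> \<rho>" by linarith
  then show ?thesis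
  proof cases
    case 1
    have "multipliers 6 (3/5) 0"
      by (rule I[where ?r2.0 = "5/4" and ?b2.0 = "-3/4" and ?g2.0 = "5184/625" and ?r3.0 = 1 and ?b3.0 = 0 and ?g3.0 = 3])
         (simp_all add: power2_eq_square)
    moreover have "multipliers 6 (3/5) (17/100)"
      by (rule I[where ?r2.0 = "1/2" and ?b2.0 = "-3" and ?g2.0 = "5256/125" and ?r3.0 = "1/2" and ?b3.0 = 3 and ?g3.0 = "1314/125"])
         (simp_all add: power2_eq_square)
    ultimately show ?thesis using multipliers_between assms 1 by blast
  next
    case 2
    have "multipliers (9/4) (3/10) (17/100)"
      by (rule I[where ?r2.0 = "2/5" and ?b2.0 = "-27/4" and ?g2.0 = "1881/160" and ?r3.0 = 1 and ?b3.0 = "-3/4" and ?g3.0 = "9/20"])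
         (simp_all add: power2_eq_square)
    moreover have "multipliers (9/4) (3/10) (3/10)"
      by (rule I[where ?r2.0 = "1/4" and ?b2.0 = "-7" and ?g2.0 = "23" and ?r3.0 = "8/25" and ?b3.0 = "15/8" and ?g3.0 = "3825/1024"])
         (simp_all add: power2_eq_square)
    ultimately show ?thesis using multipliers_between 2 by blast
  next
    case 3
    have "multipliers (6/5) (17/100) (3/10)"
      by (rule I[where ?r2.0 = "19/100" and ?b2.0 = "-137/20" and ?g2.0 = "12" and ?r3.0 = "1/2" and ?b3.0 = "-3/4" and ?g3.0 = "9/20"])
         (simp_all add: power2_eq_square)
    moreover have "multipliers (6/5) (17/100) (42/100)"
      by (rule I[where ?r2.0 = "7/50" and ?b2.0 = "-7" and ?g2.0 = "17" and ?r3.0 = "11/50" and ?b3.0 = "11/8" and ?g3.0 = "4471/2420"])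
         (simp_all add: power2_eq_square)
    ultimately show ?thesis using multipliers_between 3 by blast
  next
    case 4
    have "multipliers (7/10) (3/25) (42/100)"
      by (rule I[where ?r2.0 = "59/20" and ?b2.0 = "-1/4" and ?g2.0 = "6864/435125" and ?r3.0 = "1/4" and ?b3.0 = "0" and ?g3.0 = "1/2"])
         (simp_all add: power2_eq_square)
    moreover have "multipliers (7/10) (3/25) (53/100)"
      by (rule I[where ?r2.0 = "9/100" and ?b2.0 = "-6" and ?g2.0 = "1672/135" and ?r3.0 = "4/25" and ?b3.0 = "19/20" and ?g3.0 = "627/640"])
         (simp_all add: power2_eq_square)
    ultimately show ?thesis using multipliers_between 4 by blast
  next
    case 5
    have "multipliers (7/20) (3/50) (53/100)"
      by (rule I[where ?r2.0 = "5/2" and ?b2.0 = "0" and ?g2.0 = "1/250" and ?r3.0 = "1/2" and ?b3.0 = "-27/200" and ?g3.0 = "1/40"])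
         (simp_all add: power2_eq_square)
    moreover have "multipliers (7/20) (3/50) (66/100)"
      by (rule I[where ?r2.0 = "5/2" and ?b2.0 = "0" and ?g2.0 = "177/78125" and ?r3.0 = "1/10" and ?b3.0 = "1/4" and ?g3.0 = "7/20"])
         (simp_all add: power2_eq_square)
    ultimately show ?thesis using multipliers_between 5 by blast
  next
    case 6
    have "multipliers (1/10) (1/100) (66/100)"
      by (rule I[where ?r2.0 = "3/2" and ?b2.0 = "0" and ?g2.0 = "4/9375" and ?r3.0 = "1/4" and ?b3.0 = "0" and ?g3.0 = "12/3125"])
         (simp_all add: power2_eq_square)
    moreover have "multipliers (1/10) (1/100) (85/100)"
      by (rule I[where ?r2.0 = "1" and ?b2.0 = "0" and ?g2.0 = "1/5000" and ?r3.0 = "3/10" and ?b3.0 = "-1/40" and ?g3.0 = "1/1800"])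
         (simp_all add: power2_eq_square)
    ultimately show ?thesis using multipliers_between 6 by blast
  next
    case 7
    \<comment> \<open>Without multipliers the second condition reads
      \<open>9 * v^3 \<le> v^4 + (18 * \<rho> - 6) * v^3\<close>, which holds for all
      \<open>v \<ge> 0\<close> once \<open>\<rho> \<ge> 5/6\<close>; the last range starts just
      above that value.\<close>
    have "multipliers 0 0 \<rho>"
      by (rule I[where ?r2.0 = "0" and ?b2.0 = "0" and ?g2.0 = "0" and ?r3.0 = "0" and ?b3.0 = "0" and ?g3.0 = "0"])
         (use 7 in simp_all)
    then show ?thesis by blast
  qed
qed

text \<open>Defined so that \<open>(x - t) (x / (x\<^sup>2 + w) - t / (t\<^sup>2 + w)) = (x - t)\<^sup>2 / w * (1 - kap t x w)\<close>.\<close>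
definition kap :: "real \<Rightarrow> real \<Rightarrow> real \<Rightarrow> real" where
  "kap t x w = ((x\<^sup>2 + x * t + t\<^sup>2) * w + x\<^sup>2 * t\<^sup>2) / ((w + x\<^sup>2) * (w + t\<^sup>2))"

lemma quadratic_form_nonneg:
  fixes x t :: real
  shows "0 \<le> x\<^sup>2 + x * t + t\<^sup>2"
proof -
  have "2 * (x\<^sup>2 + x * t + t\<^sup>2) = (x + t)\<^sup>2 + x\<^sup>2 + t\<^sup>2"
    by (simp add: power2_eq_square algebra_simps)
  then show ?thesis by (smt (verit) zero_le_power2)
qed

lemma kap_nonneg: "0 \<le> w \<Longrightarrow> 0 \<le> kap t x w"
  unfolding kap_def using quadratic_form_nonneg[of x t] by simp

text \<open>Nine times the denominator minus eight times the numerator is a sum of two squares with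
  nonnegative weights. The constant is sharp: equality holds for \<open>x = t\<close>,
  \<open>x * t = 3 * w\<close>.\<close>

lemma kap_le:
  assumes "0 < w" shows "kap t x w \<le> 9/8"
proof -
  have "8 * ((x\<^sup>2 + x * t + t\<^sup>2) * w + x\<^sup>2 * t\<^sup>2) + ((3 * w - x * t)\<^sup>2 + w * (x - t)\<^sup>2)
      = 9 * ((w + x\<^sup>2) * (w + t\<^sup>2))"
    by (simp add: power2_eq_square algebra_simps)
  moreover have "0 \<le> (3 * w - x * t)\<^sup>2 + w * (x - t)\<^sup>2" using assms by simp
  ultimately have "8 * ((x\<^sup>2 + x * t + t\<^sup>2) * w + x\<^sup>2 * t\<^sup>2) \<le> 9 * ((w + x\<^sup>2) * (w + t\<^sup>2))" by linarith
  moreover have "0 < (w + x\<^sup>2) * (w + t\<^sup>2)" using assms by (simp add: add_pos_nonneg)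
  ultimately show ?thesis unfolding kap_def by (simp add: divide_le_eq)
qed

text \<open>The left hand side is the mean of \<open>x^2 + x * t + t^2\<close> and
  \<open>x^2\<close> with weights \<open>w\<close> and \<open>t^2\<close>, hence at most the larger
  of the two; the sign of \<open>t * (x + t)\<close> tells which one that is.\<close>

lemma kap_mult_le:
  assumes w: "0 < w"
  shows "(w + x\<^sup>2) * kap t x w \<le> (if 0 \<le> t * (x + t) then x\<^sup>2 + x * t + t\<^sup>2 else x\<^sup>2)"
proof -
  let ?P = "x\<^sup>2 + x * t + t\<^sup>2"
  have pos: "0 < w + x\<^sup>2" "0 < w + t\<^sup>2" using w by (simp_all add: add_pos_nonneg)
  have e: "(w + x\<^sup>2) * kap t x w = (?P * w + x\<^sup>2 * t\<^sup>2) / (w + t\<^sup>2)"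
    unfolding kap_def using pos by simp
  show ?thesis
  proof (cases "0 \<le> t * (x + t)")
    case True
    then have "x\<^sup>2 \<le> ?P" by (simp add: power2_eq_square algebra_simps)
    then have "x\<^sup>2 * t\<^sup>2 \<le> ?P * t\<^sup>2" by (intro mult_right_mono) auto
    then show ?thesis using True pos unfolding e by (simp add: divide_le_eq algebra_simps)
  next
    case False
    then have "?P \<le> x\<^sup>2" by (simp add: power2_eq_square algebra_simps)
    then have "?P * w \<le> x\<^sup>2 * w" using w by (intro mult_right_mono) auto
    then show ?thesis using False pos unfolding e by (simp add: divide_le_eq algebra_simps)
  qed
qed

text \<open>The difference of the two sides is a quadratic
  \<open>A * t^2 + y * (2 * m - 3 * v) * t + C\<close> in \<open>t\<close>, so a discriminant bound
  is needed. In the application \<open>v\<close> is \<open>y^2 * R / w\<close> with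
  \<open>R = w + (t + y)^2\<close>.\<close>

lemma multipliers_quadratic:
  fixes t y v :: real
  assumes M: "multipliers m z \<rho>" and v: "y\<^sup>2 \<le> v"
  shows "v * (y\<^sup>2 + 3 * y * t + (3 - 9 * \<rho>) * t\<^sup>2) - (3/2 + t\<^sup>2 / 2) * v\<^sup>2
    \<le> m * ((t + y)\<^sup>2 - \<rho> * t\<^sup>2) + z * (1 - t\<^sup>2)"
proof -
  define A where "A = v\<^sup>2 / 2 - (3 - 9 * \<rho>) * v + (m * (1 - \<rho>) - z)"
  define C where "C = 3/2 * v\<^sup>2 - v * y\<^sup>2 + m * y\<^sup>2 + z"
  have v0: "0 \<le> v" using v zero_le_power2[of y] by linarith
  have mz: "0 \<le> m" "0 \<le> z" using M by (auto simp: multipliers_def)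
  have A: "0 \<le> A" using M v0 by (auto simp: multipliers_def A_def)
  have "v * y\<^sup>2 \<le> v * v" using v v0 by (intro mult_left_mono)
  moreover have "0 \<le> v * v" by simp
  ultimately have "0 \<le> 3/2 * v\<^sup>2 - v * y\<^sup>2" unfolding power2_eq_square[of v] by linarith
  then have C: "0 \<le> C" unfolding C_def using mz by (simp add: add_nonneg_nonneg)
  \<comment> \<open>The discriminant condition is affine in \<open>y^2\<close>, so it suffices to
    have it at \<open>y^2 = 0\<close>, where it is trivial, and at \<open>y^2 = v\<close>, where it
    is the second condition of \<open>multipliers\<close>.\<close>
  have "0 \<le> 4 * A * (3/2 * v\<^sup>2 + z) + y\<^sup>2 * (4 * A * (m - v) - (2 * m - 3 * v)\<^sup>2)"
  proof (rule affine_nonneg_between[where a = 0 and b = v])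
    show "0 \<le> 4 * A * (3/2 * v\<^sup>2 + z) + 0 * (4 * A * (m - v) - (2 * m - 3 * v)\<^sup>2)"
      using A mz by simp
    have "v * (2 * m - 3 * v)\<^sup>2 \<le> 4 * A * (v\<^sup>2 / 2 + m * v + z)"
      using M v0 unfolding multipliers_def A_def by blast
    moreover have "4 * A * (3/2 * v\<^sup>2 + z) + v * (4 * A * (m - v) - (2 * m - 3 * v)\<^sup>2)
      = 4 * A * (v\<^sup>2 / 2 + m * v + z) - v * (2 * m - 3 * v)\<^sup>2"
      by (simp add: power2_eq_square field_simps)
    ultimately show "0 \<le> 4 * A * (3/2 * v\<^sup>2 + z) + v * (4 * A * (m - v) - (2 * m - 3 * v)\<^sup>2)"
      by linarith
  qed (use v in auto)
  also have "\<dots> = 4 * A * C - (y * (2 * m - 3 * v))\<^sup>2"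
    by (simp add: C_def power2_eq_square algebra_simps)
  finally have "0 \<le> A * t\<^sup>2 + (y * (2 * m - 3 * v)) * t + C"
    using A C by (intro quadratic_nonneg) auto
  also have "\<dots> = m * ((t + y)\<^sup>2 - \<rho> * t\<^sup>2) + z * (1 - t\<^sup>2)
      - (v * (y\<^sup>2 + 3 * y * t + (3 - 9 * \<rho>) * t\<^sup>2) - (3/2 + t\<^sup>2 / 2) * v\<^sup>2)"
    by (simp add: A_def C_def power2_eq_square field_simps)
  finally show ?thesis by simp
qed

text \<open>The analogue for coordinates whose tilt is capped at 2: there
  \<open>kap \<le> 9/8\<close> leaves the coefficient \<open>9/8 - 2 = - 7/8\<close>. Again the
  discriminant is affine in \<open>y^2\<close>, and at \<open>y^2 = v\<close> it is the third
  condition of \<open>multipliers\<close>.\<close>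

lemma multipliers_capped:
  fixes t y v :: real
  assumes M: "multipliers m z \<rho>" and v: "y\<^sup>2 \<le> v"
  shows "- (7/8 * \<rho> * t\<^sup>2 * v) - (3/2 + t\<^sup>2 / 2) * v\<^sup>2
    \<le> m * ((t + y)\<^sup>2 - \<rho> * t\<^sup>2) + z * (1 - t\<^sup>2)"
proof (cases "0 \<le> v\<^sup>2 / 2 + 7/8 * \<rho> * v + (m * (1 - \<rho>) - z)")
  case A: True
  define A where "A = v\<^sup>2 / 2 + 7/8 * \<rho> * v + (m * (1 - \<rho>) - z)"
  define C where "C = 3/2 * v\<^sup>2 + m * y\<^sup>2 + z"
  have v0: "0 \<le> v" using v zero_le_power2[of y] by linarith
  have mz: "0 \<le> m" "0 \<le> z" using M by (auto simp: multipliers_def)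
  have C: "0 \<le> C" unfolding C_def using mz by simp
  have "0 \<le> A * (3/2 * v\<^sup>2 + z) + y\<^sup>2 * (A * m - m\<^sup>2)"
  proof (rule affine_nonneg_between[where a = 0 and b = v])
    show "0 \<le> A * (3/2 * v\<^sup>2 + z) + 0 * (A * m - m\<^sup>2)"
      using A mz by (simp add: A_def)
    have "m\<^sup>2 * v \<le> A * (3 / 2 * v\<^sup>2 + m * v + z)"
      using M v0 unfolding multipliers_def A_def by blast
    then show "0 \<le> A * (3/2 * v\<^sup>2 + z) + v * (A * m - m\<^sup>2)"
      by (simp add: algebra_simps)
  qed (use v in auto)
  then have "(2 * m * y)\<^sup>2 \<le> 4 * A * C"
    by (simp add: C_def power2_eq_square algebra_simps)
  then have "0 \<le> A * t\<^sup>2 + (2 * m * y) * t + C"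
    using A C by (intro quadratic_nonneg) (auto simp: A_def)
  also have "\<dots> = m * ((t + y)\<^sup>2 - \<rho> * t\<^sup>2) + z * (1 - t\<^sup>2)
      + (7/8 * \<rho> * t\<^sup>2 * v + (3/2 + t\<^sup>2 / 2) * v\<^sup>2)"
    by (simp add: A_def C_def power2_eq_square field_simps)
  finally show ?thesis by simp
next
  \<comment> \<open>A negative leading coefficient would force \<open>\<rho> < 0\<close>; then
    \<open>9 * \<rho> - 3 \<le> 7/8 * \<rho>\<close>, which contradicts the first condition of
    \<open>multipliers\<close>.\<close>
  case False
  have v0: "0 \<le> v" using v zero_le_power2[of y] by linarith
  have "0 \<le> v\<^sup>2 / 2 - (3 - 9 * \<rho>) * v + (m * (1 - \<rho>) - z)" "0 \<le> m * (1 - \<rho>) - z"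
    using M v0 by (auto simp: multipliers_def)
  moreover have "\<not> 0 \<le> \<rho>"
    using False v0 calculation(2) by (auto intro!: add_nonneg_nonneg mult_nonneg_nonneg)
  then have "(- 3 + 9 * \<rho>) * v \<le> 7/8 * \<rho> * v" using v0 by (intro mult_right_mono) auto
  ultimately show ?thesis using False by (simp add: algebra_simps)
qed

text \<open>Multiplication by \<open>R^2\<close> turns the claim into one about
  \<open>v = y^2 * R / w\<close>. The cases are: an uncapped tilt with either branch of
  \<open>kap_mult_le\<close>, and a tilt capped at 2.\<close>

lemma coordinate_bound:
  fixes t y w D :: real
  assumes w: "0 < w" and D: "0 < D" and tD: "t\<^sup>2 \<le> D" and M: "multipliers m z ((w + (t + y)\<^sup>2) / D)"
  shows "y\<^sup>2 / w * (kap t (t + y) w - min 2 (9 * t\<^sup>2 / D)) - (3/2 + t\<^sup>2 / 2) * (y\<^sup>2 / w)\<^sup>2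
    \<le> (m * ((t + y)\<^sup>2 - (w + (t + y)\<^sup>2) / D * t\<^sup>2) + z * (1 - t\<^sup>2)) / (w + (t + y)\<^sup>2)\<^sup>2"
proof -
  define x where "x = t + y"
  define R where "R = w + x\<^sup>2"
  define \<rho> where "\<rho> = R / D"
  define v where "v = y\<^sup>2 / w * R"
  have R: "0 < R" "w \<le> R" using w by (simp_all add: R_def add_pos_nonneg)
  have \<rho>: "0 \<le> \<rho>" "R = \<rho> * D" using R D by (simp_all add: \<rho>_def)
  have M': "multipliers m z \<rho>" using M by (simp add: \<rho>_def R_def x_def)
  have mz: "0 \<le> m" "0 \<le> z" "0 \<le> m * (1 - \<rho>) - z" using M' by (auto simp: multipliers_def)
  have v: "y\<^sup>2 \<le> v"
    using R w mult_left_mono[of w R "y\<^sup>2"] by (simp add: v_def pos_le_divide_eq)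
  have v0: "0 \<le> v" using v zero_le_power2[of y] by linarith
  define rhs where "rhs = m * (x\<^sup>2 - \<rho> * t\<^sup>2) + z * (1 - t\<^sup>2)"
  have "v * (R * (kap t x w - min 2 (9 * t\<^sup>2 / D))) - (3/2 + t\<^sup>2 / 2) * v\<^sup>2 \<le> rhs"
  proof (cases "9 * t\<^sup>2 / D \<le> 2")
    case True
    then have del: "R * min 2 (9 * t\<^sup>2 / D) = 9 * \<rho> * t\<^sup>2" using D by (simp add: \<rho>_def)
    show ?thesis
    proof (cases "0 \<le> t * (x + t)")
      case True
      have "R * kap t x w - R * min 2 (9 * t\<^sup>2 / D) \<le> x\<^sup>2 + x * t + t\<^sup>2 - 9 * \<rho> * t\<^sup>2"
        using kap_mult_le[OF w, of x t] True unfolding del by (simp add: R_def)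
      also have "\<dots> = y\<^sup>2 + 3 * y * t + (3 - 9 * \<rho>) * t\<^sup>2"
        by (simp add: x_def power2_eq_square algebra_simps)
      finally have "v * (R * (kap t x w - min 2 (9 * t\<^sup>2 / D))) \<le> v * (y\<^sup>2 + 3 * y * t + (3 - 9 * \<rho>) * t\<^sup>2)"
        using v0 by (intro mult_left_mono) (simp_all add: right_diff_distrib)
      then show ?thesis using multipliers_quadratic[OF M' v, of t] by (simp add: rhs_def x_def)
    next
      \<comment> \<open>Here \<open>R * kap \<le> x^2 \<le> y^2 \<le> v\<close>, so the first term
        is at most \<open>v^2\<close> and is absorbed by the quadratic one. The multiplier part is
        nonnegative because \<open>t^2 \<le> x^2\<close>.\<close>
      case False
      then have neg: "t * x + t\<^sup>2 < 0" by (simp add: power2_eq_square algebra_simps)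
      have y2: "y\<^sup>2 = x\<^sup>2 - 2 * (t * x) + t\<^sup>2" by (simp add: x_def power2_eq_square algebra_simps)
      then have xy: "x\<^sup>2 \<le> y\<^sup>2" using neg by (smt (verit) zero_le_power2)
      have "x\<^sup>2 - t\<^sup>2 = (x + t)\<^sup>2 - 2 * (t * x + t\<^sup>2)" by (simp add: power2_eq_square algebra_simps)
      then have tx: "t\<^sup>2 \<le> x\<^sup>2" using neg by (smt (verit) zero_le_power2)
      have "0 \<le> R * min 2 (9 * t\<^sup>2 / D)" using R D by simp
      then have "R * (kap t x w - min 2 (9 * t\<^sup>2 / D)) \<le> v"
        using kap_mult_le[OF w, of x t] False xy v unfolding R_def by (simp add: right_diff_distrib)
      then have "v * (R * (kap t x w - min 2 (9 * t\<^sup>2 / D))) \<le> v * v"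
        using v0 by (intro mult_left_mono)
      moreover have "1 * v\<^sup>2 \<le> (3/2 + t\<^sup>2 / 2) * v\<^sup>2"
        by (intro mult_right_mono) (simp_all add: add_increasing2)
      then have "v * v \<le> (3/2 + t\<^sup>2 / 2) * v\<^sup>2" by (simp add: power2_eq_square)
      moreover have "0 \<le> rhs"
      proof -
        have "0 \<le> (m * (1 - \<rho>) - z) * t\<^sup>2 + z + m * (x\<^sup>2 - t\<^sup>2)" using mz tx by simp
        then show ?thesis by (simp add: rhs_def algebra_simps)
      qed
      ultimately show ?thesis by linarith
    qed
  next
    \<comment> \<open>The bound \<open>t^2 \<le> D\<close> enters here, through
      \<open>R = \<rho> * D \<ge> \<rho> * t^2\<close>.\<close>
    case False
    have "R * (kap t x w - min 2 (9 * t\<^sup>2 / D)) \<le> R * (- 7/8)"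
      using kap_le[OF w, of t x] False R by (intro mult_left_mono) auto
    also have "\<dots> \<le> - (7/8 * \<rho> * t\<^sup>2)"
      using \<rho> tD mult_left_mono[OF tD \<rho>(1)] by simp
    finally have "v * (R * (kap t x w - min 2 (9 * t\<^sup>2 / D))) \<le> v * (- (7/8 * \<rho> * t\<^sup>2))"
      using v0 by (intro mult_left_mono)
    then show ?thesis using multipliers_capped[OF M' v, of t] by (simp add: rhs_def x_def algebra_simps)
  qed
  then have "(v * (R * (kap t x w - min 2 (9 * t\<^sup>2 / D))) - (3/2 + t\<^sup>2 / 2) * v\<^sup>2) / R\<^sup>2 \<le> rhs / R\<^sup>2"
    by (intro divide_right_mono) auto
  moreover have "(v * (R * k) - a * v\<^sup>2) / R\<^sup>2 = y\<^sup>2 / w * k - a * (y\<^sup>2 / w)\<^sup>2" for k a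
    using R by (simp add: v_def power2_eq_square diff_divide_distrib)
  ultimately show ?thesis by (simp add: rhs_def \<rho>_def R_def x_def)
qed

section \<open>Rescaling and summation over the coordinates\<close>

lemma kap_scale: "c \<noteq> 0 \<Longrightarrow> kap (t / c) (x / c) (w / c\<^sup>2) = kap t x w"
proof -
  assume c: "c \<noteq> 0"
  have "kap (t / c) (x / c) (w / c\<^sup>2)
      = (((x\<^sup>2 + x * t + t\<^sup>2) * w + x\<^sup>2 * t\<^sup>2) / c ^ 4) / (((w + x\<^sup>2) * (w + t\<^sup>2)) / c ^ 4)"
    unfolding kap_def using c by (intro arg_cong2[where f = "(/)"])
      (simp_all add: field_simps power2_eq_square power4_eq_xxxx)
  then show ?thesis using c by (simp add: kap_def)
qed

lemma sqn_split: "i < d \<Longrightarrow> sqn d x = sqn_not d i x + (x i)\<^sup>2"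
  unfolding sqn_def sqn_not_def by (subst sum.remove[of _ i]) (auto simp: add.commute)

lemma sqn_nonneg [simp]: "0 \<le> sqn d x" and sqn_not_nonneg [simp]: "0 \<le> sqn_not d i x"
  by (simp_all add: sqn_def sqn_not_def sum_nonneg)

lemma component_le_sqn: "i < d \<Longrightarrow> (x i)\<^sup>2 \<le> sqn d x"
  by (simp add: sqn_split)

text \<open>All terms are invariant under a common scaling of \<open>x\<close> and
  \<open>\<theta>\<close>. Division by \<open>c = sqrt (sqn d \<theta> / d)\<close> normalises the
  squared norm of \<open>\<theta>\<close> to \<open>d\<close>, and one pair of multipliers, chosen
  for the given \<open>x\<close>, serves all coordinates.\<close>

lemma sum_kap_le:
  fixes \<theta> x :: rvec
  assumes d: "0 < d" and w: "\<And>i. i < d \<Longrightarrow> 0 < sqn_not d i x"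
  shows "(\<Sum>i<d. (x i - \<theta> i)\<^sup>2 / sqn_not d i x * kap (\<theta> i) (x i) (sqn_not d i x))
    \<le> (\<Sum>i<d. min 2 (9 * (\<theta> i)\<^sup>2 / sqn d \<theta>) * ((x i - \<theta> i)\<^sup>2 / sqn_not d i x)
          + (3/2 + real d * (\<theta> i)\<^sup>2 / (2 * sqn d \<theta>)) * ((x i - \<theta> i)\<^sup>2 / sqn_not d i x)\<^sup>2)"
proof (cases "sqn d \<theta> = 0")
  \<comment> \<open>Scaling is impossible for \<open>\<theta> = 0\<close>. The quotients by
    \<open>sqn d \<theta>\<close> are then 0, so the weights are 0 and \<open>3/2\<close>, and
    \<open>kap 0 x w \<le> x^2 / w\<close> suffices.\<close>
  case True
  have th: "\<theta> i = 0" if "i < d" for i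
    using component_le_sqn[OF that, of \<theta>] True by simp
  show ?thesis
  proof (rule sum_mono)
    fix i assume "i \<in> {..<d}"
    then have i: "i < d" by simp
    let ?w = "sqn_not d i x"
    have "kap 0 (x i) ?w = (x i)\<^sup>2 / (?w + (x i)\<^sup>2)"
      using w[OF i] by (simp add: kap_def)
    also have "\<dots> \<le> (x i)\<^sup>2 / ?w"
      using w[OF i] by (intro divide_left_mono) (auto simp: add_pos_nonneg)
    finally have "(x i)\<^sup>2 / ?w * kap 0 (x i) ?w \<le> ((x i)\<^sup>2 / ?w)\<^sup>2"
      unfolding power2_eq_square[of "(x i)\<^sup>2 / ?w"] using w[OF i] by (intro mult_left_mono) auto
    also have "\<dots> \<le> 3/2 * ((x i)\<^sup>2 / ?w)\<^sup>2" by simp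
    finally show "(x i - \<theta> i)\<^sup>2 / ?w * kap (\<theta> i) (x i) ?w
      \<le> min 2 (9 * (\<theta> i)\<^sup>2 / sqn d \<theta>) * ((x i - \<theta> i)\<^sup>2 / ?w)
          + (3/2 + real d * (\<theta> i)\<^sup>2 / (2 * sqn d \<theta>)) * ((x i - \<theta> i)\<^sup>2 / ?w)\<^sup>2"
      using th[OF i] by simp
  qed
next
  case False
  define L where "L = sqn d \<theta>"
  define R where "R = sqn d x"
  define c where "c = sqrt (L / real d)"
  have L: "0 < L" using False by (simp add: L_def order_less_le)
  then have c: "0 < c" "c\<^sup>2 = L / real d" using d by (simp_all add: c_def)
  define D where "D = real d"
  have D: "0 < D" using d by (simp add: D_def)
  have R: "0 < R" using w[OF d] sqn_split[OF d, of x] by (simp add: R_def add_pos_nonneg)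
  have "0 \<le> (R / c\<^sup>2) / D" using R c(1) D by simp
  then obtain m z where M: "multipliers m z ((R / c\<^sup>2) / D)" using multipliers_exist by blast
  have "(\<Sum>i<d. (x i - \<theta> i)\<^sup>2 / sqn_not d i x * (kap (\<theta> i) (x i) (sqn_not d i x) - min 2 (9 * (\<theta> i)\<^sup>2 / L))
          - (3/2 + D * (\<theta> i)\<^sup>2 / (2 * L)) * ((x i - \<theta> i)\<^sup>2 / sqn_not d i x)\<^sup>2)
      \<le> (\<Sum>i<d. (m * ((x i / c)\<^sup>2 - R / c\<^sup>2 / D * (\<theta> i / c)\<^sup>2) + z * (1 - (\<theta> i / c)\<^sup>2)) / (R / c\<^sup>2)\<^sup>2)"
  proof (rule sum_mono)
    fix i assume "i \<in> {..<d}"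
    then have i: "i < d" by simp
    have x: "\<theta> i / c + (x i - \<theta> i) / c = x i / c" by (simp add: diff_divide_distrib)
    have Rw: "sqn_not d i x / c\<^sup>2 + (x i / c)\<^sup>2 = R / c\<^sup>2"
      by (simp add: R_def sqn_split[OF i] add_divide_distrib power_divide)
    have "(\<theta> i / c)\<^sup>2 \<le> D"
      using component_le_sqn[OF i, of \<theta>] c L D mult_left_mono[OF component_le_sqn[OF i, of \<theta>], of D]
      by (simp add: power_divide L_def D_def field_simps)
    moreover have "0 < sqn_not d i x / c\<^sup>2" using w[OF i] c(1) by simp
    ultimately
    have "((x i - \<theta> i) / c)\<^sup>2 / (sqn_not d i x / c\<^sup>2)
          * (kap (\<theta> i / c) (x i / c) (sqn_not d i x / c\<^sup>2) - min 2 (9 * (\<theta> i / c)\<^sup>2 / D))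
        - (3/2 + (\<theta> i / c)\<^sup>2 / 2) * (((x i - \<theta> i) / c)\<^sup>2 / (sqn_not d i x / c\<^sup>2))\<^sup>2
      \<le> (m * ((x i / c)\<^sup>2 - R / c\<^sup>2 / D * (\<theta> i / c)\<^sup>2) + z * (1 - (\<theta> i / c)\<^sup>2)) / (R / c\<^sup>2)\<^sup>2"
      using coordinate_bound[where t = "\<theta> i / c" and y = "(x i - \<theta> i) / c" and w = "sqn_not d i x / c\<^sup>2",
        unfolded x Rw, OF _ D _ M] by simp
    moreover have "((x i - \<theta> i) / c)\<^sup>2 / (sqn_not d i x / c\<^sup>2) = (x i - \<theta> i)\<^sup>2 / sqn_not d i x"
      using c(1) by (simp add: power_divide)
    moreover have "9 * (\<theta> i / c)\<^sup>2 / D = 9 * (\<theta> i)\<^sup>2 / L"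
      "3/2 + (\<theta> i / c)\<^sup>2 / 2 = 3/2 + D * (\<theta> i)\<^sup>2 / (2 * L)"
      using L D by (simp_all add: power_divide c(2) D_def[symmetric] mult.commute)
    moreover have "kap (\<theta> i / c) (x i / c) (sqn_not d i x / c\<^sup>2) = kap (\<theta> i) (x i) (sqn_not d i x)"
      using c(1) by (simp add: kap_scale)
    ultimately show "(x i - \<theta> i)\<^sup>2 / sqn_not d i x * (kap (\<theta> i) (x i) (sqn_not d i x) - min 2 (9 * (\<theta> i)\<^sup>2 / L))
          - (3/2 + D * (\<theta> i)\<^sup>2 / (2 * L)) * ((x i - \<theta> i)\<^sup>2 / sqn_not d i x)\<^sup>2
      \<le> (m * ((x i / c)\<^sup>2 - R / c\<^sup>2 / D * (\<theta> i / c)\<^sup>2) + z * (1 - (\<theta> i / c)\<^sup>2)) / (R / c\<^sup>2)\<^sup>2"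
      by (simp only:)
  qed
  \<comment> \<open>Since \<open>L / c^2 = D\<close>, both constraint terms cancel in the
    sum.\<close>
  also have "\<dots> = (m * (R / c\<^sup>2 - R / c\<^sup>2 / D * (L / c\<^sup>2)) + z * (D - L / c\<^sup>2)) / (R / c\<^sup>2)\<^sup>2"
    unfolding power_divide[of _ c]
    by (simp add: sum_divide_distrib[symmetric] sum.distrib sum_distrib_left[symmetric] sum_subtractf
        R_def L_def sqn_def D_def)
  also have "\<dots> = 0"
    using c D L d by (simp add: D_def)
  finally show ?thesis
    by (simp add: sum_subtractf sum.distrib right_diff_distrib D_def L_def mult.commute)
qed

lemma sum_weights_le: "0 < d \<Longrightarrow> (\<Sum>i<d. 3/2 + real d * (\<theta> i)\<^sup>2 / (2 * sqn d \<theta>)) \<le> 2 * real d"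
  by (simp add: sum.distrib sum_divide_distrib[symmetric] sum_distrib_left[symmetric] sqn_def[symmetric])

lemma sum_tilts_le: "(\<Sum>i<d. min 2 (9 * (\<theta> i)\<^sup>2 / sqn d \<theta>)) \<le> 9"
proof -
  have "(\<Sum>i<d. min 2 (9 * (\<theta> i)\<^sup>2 / sqn d \<theta>)) \<le> (\<Sum>i<d. 9 * (\<theta> i)\<^sup>2 / sqn d \<theta>)"
    by (rule sum_mono) simp
  also have "\<dots> \<le> 9"
    by (simp add: sum_divide_distrib[symmetric] sum_distrib_left[symmetric] sqn_def[symmetric])
  finally show ?thesis .
qed

subsection \<open>Stein's term of a coordinate\<close>

lemma measurable_Rd_component:
  assumes X: "X \<in> M \<rightarrow>\<^sub>M Rd d" and i: "i < d"
  shows "(\<lambda>\<omega>. X \<omega> i) \<in> borel_measurable M"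
proof -
  have "(\<lambda>x. x i) \<in> borel_measurable (Rd d)"
    unfolding Rd_def by (rule measurable_component_singleton) (use i in simp)
  from measurable_compose[OF X this] show ?thesis .
qed

lemma measurable_sqn [measurable (raw)]:
  "X \<in> M \<rightarrow>\<^sub>M Rd d \<Longrightarrow> (\<lambda>\<omega>. sqn d (X \<omega>)) \<in> borel_measurable M"
  unfolding sqn_def by (intro borel_measurable_sum borel_measurable_power measurable_Rd_component) auto

lemma measurable_sqn_not [measurable (raw)]:
  "X \<in> M \<rightarrow>\<^sub>M Rd d \<Longrightarrow> (\<lambda>\<omega>. sqn_not d i (X \<omega>)) \<in> borel_measurable M"
  unfolding sqn_not_def by (intro borel_measurable_sum borel_measurable_power measurable_Rd_component) auto

lemma measurable_kap [measurable]:
  "(\<lambda>(t, x, w). kap t x w) \<in> borel_measurable (borel \<Otimes>\<^sub>M borel \<Otimes>\<^sub>M borel)"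
  unfolding kap_def by measurable

text \<open>Stated without a sign or nonvanishing condition on \<open>a\<close>: it yields the
  Cauchy-Schwarz inequality for integrals and, with \<open>c = 0\<close>, the vanishing of a linear
  coefficient at a maximum.\<close>

lemma quadratic_discriminant_le:
  fixes a b c :: real
  assumes "\<And>t. 0 \<le> a * t\<^sup>2 + 2 * b * t + c"
  shows "b\<^sup>2 \<le> a * c"
proof (cases "a = 0")
  case True
  have "b = 0"
  proof (rule ccontr)
    assume b: "b \<noteq> 0"
    have "0 \<le> a * (- (c + 1) / (2 * b))\<^sup>2 + 2 * b * (- (c + 1) / (2 * b)) + c" by (rule assms)
    then show False using True b by simp
  qed
  then show ?thesis using True by simp
next
  case False
  have c: "0 \<le> c" using assms[of 0] by simp
  have "0 < a"
  proof (rule ccontr)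
    assume "\<not> 0 < a"
    then have a: "a < 0" using False by simp
    \<comment> \<open>Chosen so that \<open>a * s^2 + c = - 1\<close>; adding the hypothesis at
      \<open>s\<close> and at \<open>- s\<close> removes the linear term and gives a
      contradiction.\<close>
    define s where "s = sqrt ((c + 1) / - a)"
    have "a * s\<^sup>2 = - (c + 1)" using a c by (simp add: s_def divide_nonneg_neg)
    then show False using assms[of s] assms[of "- s"] by simp
  qed
  have "0 \<le> a * (a * (- b / a)\<^sup>2 + 2 * b * (- b / a) + c)"
    using assms[of "- b / a"] \<open>0 < a\<close> by (intro mult_nonneg_nonneg) auto
  also have "\<dots> = a * c - b\<^sup>2"
    using \<open>0 < a\<close> by (simp add: field_simps power2_eq_square)
  finally show ?thesis by simp
qed

lemma cauchy_schwarz_integral: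
  fixes f g :: "'a \<Rightarrow> real"
  assumes [measurable]: "f \<in> borel_measurable M" "g \<in> borel_measurable M"
    and f: "integrable M (\<lambda>x. (f x)\<^sup>2)" and g: "integrable M (\<lambda>x. (g x)\<^sup>2)"
  shows "integrable M (\<lambda>x. f x * g x)"
    and "\<bar>\<integral>x. f x * g x \<partial>M\<bar> \<le> sqrt (\<integral>x. (f x)\<^sup>2 \<partial>M) * sqrt (\<integral>x. (g x)\<^sup>2 \<partial>M)"
proof -
  show fg: "integrable M (\<lambda>x. f x * g x)"
  proof (rule Bochner_Integration.integrable_bound[OF Bochner_Integration.integrable_add[OF f g]])
    have "\<bar>a * b\<bar> \<le> a\<^sup>2 + b\<^sup>2" for a b :: real
    proof -
      have "2 * (\<bar>a\<bar> * \<bar>b\<bar>) \<le> a\<^sup>2 + b\<^sup>2" using sum_squares_bound[of "\<bar>a\<bar>" "\<bar>b\<bar>"] by simp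
      moreover have "0 \<le> \<bar>a\<bar> * \<bar>b\<bar>" by simp
      ultimately show ?thesis unfolding abs_mult by linarith
    qed
    then show "AE x in M. norm (f x * g x) \<le> norm ((f x)\<^sup>2 + (g x)\<^sup>2)" by simp
  qed measurable
  have "0 \<le> (\<integral>x. (f x)\<^sup>2 \<partial>M) * t\<^sup>2 + 2 * (\<integral>x. f x * g x \<partial>M) * t + (\<integral>x. (g x)\<^sup>2 \<partial>M)" for t
  proof -
    have "0 \<le> (\<integral>x. (t * f x + g x)\<^sup>2 \<partial>M)" by simp
    also have "\<dots> = (\<integral>x. t\<^sup>2 * (f x)\<^sup>2 + 2 * t * (f x * g x) + (g x)\<^sup>2 \<partial>M)"
      by (simp add: power2_eq_square algebra_simps)
    also have "\<dots> = t\<^sup>2 * (\<integral>x. (f x)\<^sup>2 \<partial>M) + 2 * t * (\<integral>x. f x * g x \<partial>M) + (\<integral>x. (g x)\<^sup>2 \<partial>M)"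
      using f g fg by simp
    finally show ?thesis by (simp add: mult.commute mult.left_commute)
  qed
  then have "(\<integral>x. f x * g x \<partial>M)\<^sup>2 \<le> (\<integral>x. (f x)\<^sup>2 \<partial>M) * (\<integral>x. (g x)\<^sup>2 \<partial>M)"
    by (rule quadratic_discriminant_le)
  then show "\<bar>\<integral>x. f x * g x \<partial>M\<bar> \<le> sqrt (\<integral>x. (f x)\<^sup>2 \<partial>M) * sqrt (\<integral>x. (g x)\<^sup>2 \<partial>M)"
    unfolding real_sqrt_mult[symmetric] by (rule real_le_rsqrt[of "\<bar>_\<bar>", simplified])
qed

text \<open>The function \<open>(x\<^sub>i - \<theta>\<^sub>i) g\<^sub>i - \<sigma>\<^sup>2 \<partial>\<^sub>i g\<^sub>i\<close> for \<open>g = g\<^sub>0\<close>.\<close>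
definition stein :: "nat \<Rightarrow> rvec \<Rightarrow> real \<Rightarrow> nat \<Rightarrow> rvec \<Rightarrow> real" where
  "stein d \<theta> s2 i x = (x i - \<theta> i) * x i / sqn d x - s2 * ((sqn d x - 2 * (x i)\<^sup>2) / (sqn d x)\<^sup>2)"

text \<open>Equal to \<open>1 / w - (w - x\<^sup>2) / (w + x\<^sup>2)\<^sup>2\<close>, the change of \<open>\<partial>\<^sub>i g\<^sub>i\<close> when \<open>x\<^sub>i\<close> is set to zero.\<close>
definition rad :: "real \<Rightarrow> real \<Rightarrow> real" where
  "rad x w = x\<^sup>2 * (x\<^sup>2 + 3 * w) / (w * (w + x\<^sup>2)\<^sup>2)"

lemma measurable_rad [measurable]:
  "(\<lambda>(x, w). rad x w) \<in> borel_measurable (borel \<Otimes>\<^sub>M borel)"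
  unfolding rad_def by measurable

lemma measurable_stein:
  assumes X [measurable]: "X \<in> M \<rightarrow>\<^sub>M Rd d" and i: "i < d"
  shows "(\<lambda>\<omega>. stein d \<theta> s2 i (X \<omega>)) \<in> borel_measurable M"
proof -
  note [measurable] = measurable_Rd_component[OF X i]
  show ?thesis unfolding stein_def by measurable
qed

text \<open>Two expansions are combined: the derivative of \<open>x / (w + x^2)\<close> around
  \<open>x = 0\<close>, with remainder \<open>rad\<close>, and the function itself around
  \<open>x = t\<close>, with remainder expressed by \<open>kap\<close>. The last summand is linear
  in \<open>x - t\<close> and will have mean zero.\<close>

lemma stein_eq:
  assumes i: "i < d" and w: "0 < sqn_not d i x"
  shows "stein d \<theta> s2 i x = (x i - \<theta> i)\<^sup>2 / sqn_not d i x - s2 * (1 / sqn_not d i x)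
    - (x i - \<theta> i)\<^sup>2 / sqn_not d i x * kap (\<theta> i) (x i) (sqn_not d i x)
    + s2 * rad (x i) (sqn_not d i x) + (x i - \<theta> i) * (\<theta> i / ((\<theta> i)\<^sup>2 + sqn_not d i x))"
proof -
  define y w t where "y = x i" "w = sqn_not d i x" "t = \<theta> i"
  have w0: "0 < w" using w by (simp add: y_w_t_def)
  then have R: "0 < w + y\<^sup>2" "0 < w + t\<^sup>2" by (simp_all add: add_pos_nonneg)
  have "(w + y\<^sup>2 - 2 * y\<^sup>2) * w = (w + y\<^sup>2)\<^sup>2 - y\<^sup>2 * (y\<^sup>2 + 3 * w)"
    by (simp add: power2_eq_square algebra_simps)
  then have "(w + y\<^sup>2 - 2 * y\<^sup>2) * w / (w * (w + y\<^sup>2)\<^sup>2) = ((w + y\<^sup>2)\<^sup>2 - y\<^sup>2 * (y\<^sup>2 + 3 * w)) / (w * (w + y\<^sup>2)\<^sup>2)"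
    by simp
  then have 1: "(w + y\<^sup>2 - 2 * y\<^sup>2) / (w + y\<^sup>2)\<^sup>2 = 1 / w - rad y w"
    using w0 R by (simp add: rad_def diff_divide_distrib)
  have "(y\<^sup>2 + y * t + t\<^sup>2) * w + y\<^sup>2 * t\<^sup>2 = (w + y\<^sup>2) * (w + t\<^sup>2) - w * (w - y * t)"
    by (simp add: power2_eq_square algebra_simps)
  then have "kap t y w = 1 - w * (w - y * t) / ((w + y\<^sup>2) * (w + t\<^sup>2))"
    unfolding kap_def using R by (simp add: diff_divide_distrib)
  then have "(y - t)\<^sup>2 / w * (1 - kap t y w) = (y - t)\<^sup>2 * (w - y * t) / ((w + y\<^sup>2) * (w + t\<^sup>2))"
    using w0 by simp
  also have "\<dots> = (y - t) * (y / (w + y\<^sup>2) - t / (w + t\<^sup>2))"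
    using R by (simp add: field_simps power2_eq_square)
  finally have 2: "(y - t) * y / (w + y\<^sup>2) = (y - t)\<^sup>2 / w * (1 - kap t y w) + (y - t) * (t / (t\<^sup>2 + w))"
    by (simp add: algebra_simps)
  show ?thesis
    unfolding stein_def sqn_split[OF i] y_w_t_def[symmetric] 1 2 by (simp add: algebra_simps diff_divide_distrib)
qed

text \<open>The bound \<open>3 * x^2 / w^2\<close> separates \<open>x\<close> from \<open>w\<close>
  for the moment estimates. In the lower bound the denominator is the full squared norm, the same
  for every coordinate, so the bounds add up to \<open>3 / R\<close>. The bound \<open>2 / w\<close>
  serves integrability.\<close>

lemma rad_bounds:
  assumes w: "0 < w"
  shows "0 \<le> rad x w" "rad x w \<le> 3 * x\<^sup>2 / w\<^sup>2" "3 * x\<^sup>2 / (w + x\<^sup>2)\<^sup>2 \<le> rad x w" "rad x w \<le> 2 / w"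
proof -
  have R: "0 < w + x\<^sup>2" using w by (simp add: add_pos_nonneg)
  show "0 \<le> rad x w" using w by (simp add: rad_def)
  have "3 * (w + x\<^sup>2)\<^sup>2 - (x\<^sup>2 + 3 * w) * w = 3 * x ^ 4 + 5 * x\<^sup>2 * w"
    by (simp add: power2_eq_square power4_eq_xxxx algebra_simps)
  moreover have "0 \<le> 3 * x ^ 4 + 5 * x\<^sup>2 * w" using w by simp
  ultimately have "(x\<^sup>2 + 3 * w) * w \<le> 3 * (w + x\<^sup>2)\<^sup>2" by linarith
  then have "x\<^sup>2 * ((x\<^sup>2 + 3 * w) * w) / (w\<^sup>2 * (w + x\<^sup>2)\<^sup>2) \<le> x\<^sup>2 * (3 * (w + x\<^sup>2)\<^sup>2) / (w\<^sup>2 * (w + x\<^sup>2)\<^sup>2)"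
    by (intro divide_right_mono mult_left_mono) auto
  then show "rad x w \<le> 3 * x\<^sup>2 / w\<^sup>2"
    using w R by (simp add: rad_def power2_eq_square[of w] mult.commute)
  have "3 * x\<^sup>2 * w / (w * (w + x\<^sup>2)\<^sup>2) \<le> x\<^sup>2 * (x\<^sup>2 + 3 * w) / (w * (w + x\<^sup>2)\<^sup>2)"
    using w by (intro divide_right_mono) (auto simp: algebra_simps)
  then show "3 * x\<^sup>2 / (w + x\<^sup>2)\<^sup>2 \<le> rad x w" using w by (simp add: rad_def)
  have "2 * (w + x\<^sup>2)\<^sup>2 - x\<^sup>2 * (x\<^sup>2 + 3 * w) = 2 * w\<^sup>2 + x\<^sup>2 * w + x ^ 4"
    by (simp add: power2_eq_square power4_eq_xxxx algebra_simps)
  moreover have "0 \<le> 2 * w\<^sup>2 + x\<^sup>2 * w + x ^ 4" using w by simp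
  ultimately have "x\<^sup>2 * (x\<^sup>2 + 3 * w) \<le> 2 * (w + x\<^sup>2)\<^sup>2" by linarith
  then have "x\<^sup>2 * (x\<^sup>2 + 3 * w) / (w * (w + x\<^sup>2)\<^sup>2) \<le> 2 * (w + x\<^sup>2)\<^sup>2 / (w * (w + x\<^sup>2)\<^sup>2)"
    using w by (intro divide_right_mono) auto
  then show "rad x w \<le> 2 / w" using w R by (simp add: rad_def)
qed

text \<open>After multiplication by \<open>(x - t)^2 / w\<close> the bound is a polynomial in
  \<open>x\<close> times \<open>1 / w^2\<close>, whose expectation factors under
  independence.\<close>

lemma kap_le_cubic:
  assumes w: "0 < w"
  shows "kap t x w \<le> (x\<^sup>2 + x * t + t\<^sup>2) / w"
proof -
  let ?P = "x\<^sup>2 + x * t + t\<^sup>2"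
  have R: "0 < w + x\<^sup>2" "0 < w + t\<^sup>2" using w by (simp_all add: add_pos_nonneg)
  have "2 * (?P * (x\<^sup>2 + t\<^sup>2) - x\<^sup>2 * t\<^sup>2) = (x\<^sup>2 + t\<^sup>2) * (x + t)\<^sup>2 + x ^ 4 + t ^ 4"
    by (simp add: power2_eq_square power4_eq_xxxx algebra_simps)
  moreover have "0 \<le> (x\<^sup>2 + t\<^sup>2) * (x + t)\<^sup>2 + x ^ 4 + t ^ 4" by simp
  ultimately have "0 \<le> 2 * (?P * (x\<^sup>2 + t\<^sup>2) - x\<^sup>2 * t\<^sup>2)" by (simp only:)
  then have "0 \<le> ?P * (x\<^sup>2 + t\<^sup>2) - x\<^sup>2 * t\<^sup>2" unfolding zero_le_mult_iff by auto
  then have "0 \<le> (?P * (x\<^sup>2 + t\<^sup>2) - x\<^sup>2 * t\<^sup>2) * w + ?P * (x\<^sup>2 * t\<^sup>2)"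
    using w quadratic_form_nonneg[of x t] by (intro add_nonneg_nonneg[OF mult_nonneg_nonneg mult_nonneg_nonneg]) auto
  also have "\<dots> = ?P * ((w + x\<^sup>2) * (w + t\<^sup>2)) - (?P * w + x\<^sup>2 * t\<^sup>2) * w"
    by (simp add: power2_eq_square algebra_simps)
  finally show ?thesis using w R unfolding kap_def by (simp add: divide_le_eq le_divide_eq)
qed

context prob_space
begin

text \<open>The centring \<open>zero\<close> is a hypothesis because it has two sources: the zero
  bias vectors for \<open>X\<close> itself, and independence for the components of a mixture. Once
  the variance is \<open>s2\<close>, the first two terms on the right form a covariance.\<close>

lemma stein_decomposition:
  assumes X [measurable]: "X \<in> M \<rightarrow>\<^sub>M Rd d" and i: "i < d"
    and w: "AE \<omega> in M. sqn_not d i (X \<omega>) \<noteq> 0"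
    and u: "integrable M (\<lambda>\<omega>. 1 / sqn_not d i (X \<omega>))"
    and yu: "integrable M (\<lambda>\<omega>. (X \<omega> i - \<theta> i)\<^sup>2 / sqn_not d i (X \<omega>))"
    and int: "integrable M (\<lambda>\<omega>. (X \<omega> i - \<theta> i) * (\<theta> i / ((\<theta> i)\<^sup>2 + sqn_not d i (X \<omega>))))"
    and zero: "(\<integral>\<omega>. (X \<omega> i - \<theta> i) * (\<theta> i / ((\<theta> i)\<^sup>2 + sqn_not d i (X \<omega>))) \<partial>M) = 0"
  shows "integrable M (\<lambda>\<omega>. stein d \<theta> s2 i (X \<omega>))"
    and "integrable M (\<lambda>\<omega>. (X \<omega> i - \<theta> i)\<^sup>2 / sqn_not d i (X \<omega>) * kap (\<theta> i) (X \<omega> i) (sqn_not d i (X \<omega>)))"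
    and "integrable M (\<lambda>\<omega>. rad (X \<omega> i) (sqn_not d i (X \<omega>)))"
    and "(\<integral>\<omega>. stein d \<theta> s2 i (X \<omega>) \<partial>M)
      = (\<integral>\<omega>. (X \<omega> i - \<theta> i)\<^sup>2 / sqn_not d i (X \<omega>) \<partial>M) - s2 * (\<integral>\<omega>. 1 / sqn_not d i (X \<omega>) \<partial>M)
        - (\<integral>\<omega>. (X \<omega> i - \<theta> i)\<^sup>2 / sqn_not d i (X \<omega>) * kap (\<theta> i) (X \<omega> i) (sqn_not d i (X \<omega>)) \<partial>M)
        + s2 * (\<integral>\<omega>. rad (X \<omega> i) (sqn_not d i (X \<omega>)) \<partial>M)"
proof -
  note [measurable] = measurable_Rd_component[OF X i] measurable_stein[OF X i]
  have pos: "AE \<omega> in M. 0 < sqn_not d i (X \<omega>)"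
    using w by eventually_elim (simp add: order_less_le)
  show k: "integrable M (\<lambda>\<omega>. (X \<omega> i - \<theta> i)\<^sup>2 / sqn_not d i (X \<omega>) * kap (\<theta> i) (X \<omega> i) (sqn_not d i (X \<omega>)))"
  proof (rule Bochner_Integration.integrable_bound[OF integrable_mult_right[OF yu, of "9/8"]])
    show "AE \<omega> in M. norm ((X \<omega> i - \<theta> i)\<^sup>2 / sqn_not d i (X \<omega>) * kap (\<theta> i) (X \<omega> i) (sqn_not d i (X \<omega>)))
        \<le> norm (9/8 * ((X \<omega> i - \<theta> i)\<^sup>2 / sqn_not d i (X \<omega>)))"
      using pos
    proof eventually_elim
      case (elim \<omega>)
      have "(X \<omega> i - \<theta> i)\<^sup>2 / sqn_not d i (X \<omega>) * kap (\<theta> i) (X \<omega> i) (sqn_not d i (X \<omega>))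
          \<le> (X \<omega> i - \<theta> i)\<^sup>2 / sqn_not d i (X \<omega>) * (9/8)"
        using elim by (intro mult_left_mono kap_le) auto
      then show ?case using elim kap_nonneg[of "sqn_not d i (X \<omega>)" "\<theta> i" "X \<omega> i"]
        by (simp add: abs_mult)
    qed
  qed measurable
  show r: "integrable M (\<lambda>\<omega>. rad (X \<omega> i) (sqn_not d i (X \<omega>)))"
  proof (rule Bochner_Integration.integrable_bound[OF integrable_mult_right[OF u, of 2]])
    show "AE \<omega> in M. norm (rad (X \<omega> i) (sqn_not d i (X \<omega>))) \<le> norm (2 * (1 / sqn_not d i (X \<omega>)))"
      using pos by eventually_elim (simp add: rad_bounds abs_of_nonneg)
  qed measurable
  have eq: "AE \<omega> in M. stein d \<theta> s2 i (X \<omega>) = (X \<omega> i - \<theta> i)\<^sup>2 / sqn_not d i (X \<omega>) - s2 * (1 / sqn_not d i (X \<omega>))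
    - (X \<omega> i - \<theta> i)\<^sup>2 / sqn_not d i (X \<omega>) * kap (\<theta> i) (X \<omega> i) (sqn_not d i (X \<omega>))
    + s2 * rad (X \<omega> i) (sqn_not d i (X \<omega>)) + (X \<omega> i - \<theta> i) * (\<theta> i / ((\<theta> i)\<^sup>2 + sqn_not d i (X \<omega>)))"
    using pos by eventually_elim (rule stein_eq[OF i])
  show "integrable M (\<lambda>\<omega>. stein d \<theta> s2 i (X \<omega>))"
    by (subst integrable_cong_AE[OF _ _ eq])
      (measurable, intro Bochner_Integration.integrable_add Bochner_Integration.integrable_diff
        integrable_mult_right u yu k r int)
  have "(\<integral>\<omega>. stein d \<theta> s2 i (X \<omega>) \<partial>M) = (\<integral>\<omega>. (X \<omega> i - \<theta> i)\<^sup>2 / sqn_not d i (X \<omega>) - s2 * (1 / sqn_not d i (X \<omega>))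
    - (X \<omega> i - \<theta> i)\<^sup>2 / sqn_not d i (X \<omega>) * kap (\<theta> i) (X \<omega> i) (sqn_not d i (X \<omega>))
    + s2 * rad (X \<omega> i) (sqn_not d i (X \<omega>)) + (X \<omega> i - \<theta> i) * (\<theta> i / ((\<theta> i)\<^sup>2 + sqn_not d i (X \<omega>))) \<partial>M)"
    by (rule integral_cong_AE[OF _ _ eq]) measurable
  also have "\<dots> = (\<integral>\<omega>. (X \<omega> i - \<theta> i)\<^sup>2 / sqn_not d i (X \<omega>) \<partial>M) - s2 * (\<integral>\<omega>. 1 / sqn_not d i (X \<omega>) \<partial>M)
        - (\<integral>\<omega>. (X \<omega> i - \<theta> i)\<^sup>2 / sqn_not d i (X \<omega>) * kap (\<theta> i) (X \<omega> i) (sqn_not d i (X \<omega>)) \<partial>M)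
        + s2 * (\<integral>\<omega>. rad (X \<omega> i) (sqn_not d i (X \<omega>)) \<partial>M)"
  proof -
    have "(\<integral>\<omega>. f1 \<omega> - s2 * f2 \<omega> - f3 \<omega> + s2 * f4 \<omega> + f5 \<omega> \<partial>M)
      = (\<integral>\<omega>. f1 \<omega> \<partial>M) - s2 * (\<integral>\<omega>. f2 \<omega> \<partial>M) - (\<integral>\<omega>. f3 \<omega> \<partial>M) + s2 * (\<integral>\<omega>. f4 \<omega> \<partial>M) + (\<integral>\<omega>. f5 \<omega> \<partial>M)"
      if "integrable M f1" "integrable M f2" "integrable M f3" "integrable M f4" "integrable M f5"
      for f1 f2 f3 f4 f5 :: "'a \<Rightarrow> real"
      using that by simp
    from this[OF yu u k r int] show ?thesis unfolding zero by simp
  qed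
  finally show "(\<integral>\<omega>. stein d \<theta> s2 i (X \<omega>) \<partial>M)
      = (\<integral>\<omega>. (X \<omega> i - \<theta> i)\<^sup>2 / sqn_not d i (X \<omega>) \<partial>M) - s2 * (\<integral>\<omega>. 1 / sqn_not d i (X \<omega>) \<partial>M)
        - (\<integral>\<omega>. (X \<omega> i - \<theta> i)\<^sup>2 / sqn_not d i (X \<omega>) * kap (\<theta> i) (X \<omega> i) (sqn_not d i (X \<omega>)) \<partial>M)
        + s2 * (\<integral>\<omega>. rad (X \<omega> i) (sqn_not d i (X \<omega>)) \<partial>M)" .
qed

end

section \<open>Moment inequalities and the bound without independence\<close>

lemma square_square: "((x::real)\<^sup>2)\<^sup>2 = x ^ 4" and square_power4: "((x::real) ^ 4)\<^sup>2 = x ^ 8"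
  using power_mult[of x 2 2, symmetric] power_mult[of x 4 2, symmetric] by simp_all

context prob_space
begin

lemma integrable_power_mono:
  fixes f :: "'a \<Rightarrow> real"
  assumes [measurable]: "f \<in> borel_measurable M" and n: "integrable M (\<lambda>x. f x ^ n)" and k: "k \<le> n"
  shows "integrable M (\<lambda>x. f x ^ k)"
proof (rule Bochner_Integration.integrable_bound[OF Bochner_Integration.integrable_add[OF integrable_const[of 1] integrable_abs[OF n]]])
  have "\<bar>a ^ k\<bar> \<le> 1 + \<bar>a ^ n\<bar>" for a :: real
  proof (cases "\<bar>a\<bar> \<le> 1")
    case True
    then have "\<bar>a\<bar> ^ k \<le> 1" by (intro power_le_one) auto
    then show ?thesis by (simp add: power_abs add_increasing2)
  next
    case False
    then have "\<bar>a\<bar> ^ k \<le> \<bar>a\<bar> ^ n" using k by (intro power_increasing) auto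
    then show ?thesis by (simp add: power_abs)
  qed
  then show "AE x in M. norm (f x ^ k) \<le> norm (1 + \<bar>f x ^ n\<bar>)"
    by (intro AE_I2) (simp add: abs_of_nonneg add_nonneg_nonneg)
qed measurable

lemma expectation_square_le_sqrt:
  fixes f :: "'a \<Rightarrow> real"
  assumes [measurable]: "f \<in> borel_measurable M" and f: "integrable M (\<lambda>x. f x ^ 4)" and C: "(\<integral>x. f x ^ 4 \<partial>M) \<le> C"
  shows "(\<integral>x. (f x)\<^sup>2 \<partial>M) \<le> sqrt C"
proof -
  have "(\<integral>x. 1 * (f x)\<^sup>2 \<partial>M) \<le> sqrt (\<integral>x. (1::real)\<^sup>2 \<partial>M) * sqrt (\<integral>x. ((f x)\<^sup>2)\<^sup>2 \<partial>M)"
    by (rule order_trans[OF abs_ge_self cauchy_schwarz_integral(2)]) (use f in \<open>simp_all add: square_square\<close>)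
  also have "\<dots> \<le> sqrt C" using C by (simp add: prob_space square_square square_power4)
  finally show ?thesis by simp
qed

lemma expectation_mult_le_sqrt:
  fixes f g :: "'a \<Rightarrow> real"
  assumes [measurable]: "f \<in> borel_measurable M" "g \<in> borel_measurable M"
    and f: "integrable M (\<lambda>x. (f x)\<^sup>2)" "(\<integral>x. (f x)\<^sup>2 \<partial>M) \<le> F"
    and g: "integrable M (\<lambda>x. (g x)\<^sup>2)" "(\<integral>x. (g x)\<^sup>2 \<partial>M) \<le> G\<^sup>2" and G: "0 \<le> G"
  shows "(\<integral>x. f x * g x \<partial>M) \<le> sqrt F * G"
proof -
  have "(\<integral>x. f x * g x \<partial>M) \<le> sqrt (\<integral>x. (f x)\<^sup>2 \<partial>M) * sqrt (\<integral>x. (g x)\<^sup>2 \<partial>M)"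
    by (rule order_trans[OF abs_ge_self cauchy_schwarz_integral(2)]) (use f g in auto)
  also have "\<dots> \<le> sqrt F * sqrt (G\<^sup>2)"
    using f g by (intro mult_mono real_sqrt_le_mono) (auto intro!: order_trans[OF _ f(2)])
  finally show ?thesis using G by simp
qed

text \<open>\<open>Q\<close> has the scale of \<open>E[1 / w^2]\<close>. From above only the
  \<open>rad\<close> terms matter, as the \<open>kap\<close> terms enter with a minus sign. From
  below the \<open>kap\<close> terms are bounded jointly by \<open>sum_kap_le\<close>, and part of
  the resulting loss is recovered from the \<open>rad\<close> terms.\<close>

lemma stein_sum_bound:
  assumes X [measurable]: "X \<in> M \<rightarrow>\<^sub>M Rd d" and d: "0 < d" and s2: "0 < s2" and Q: "0 \<le> Q"
    and w: "\<And>i. i < d \<Longrightarrow> AE \<omega> in M. sqn_not d i (X \<omega>) \<noteq> 0"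
    and u4: "\<And>i. i < d \<Longrightarrow> integrable M (\<lambda>\<omega>. (1 / sqn_not d i (X \<omega>)) ^ 4)"
      "\<And>i. i < d \<Longrightarrow> (\<integral>\<omega>. (1 / sqn_not d i (X \<omega>)) ^ 4 \<partial>M) \<le> Q\<^sup>2"
    and y8: "\<And>i. i < d \<Longrightarrow> integrable M (\<lambda>\<omega>. (X \<omega> i - \<theta> i) ^ 8)"
      "\<And>i. i < d \<Longrightarrow> (\<integral>\<omega>. (X \<omega> i - \<theta> i) ^ 8 \<partial>M) \<le> C8"
    and y4: "\<And>i. i < d \<Longrightarrow> (\<integral>\<omega>. (X \<omega> i - \<theta> i) ^ 4 \<partial>M) \<le> C4"
    and y2: "\<And>i. i < d \<Longrightarrow> (\<integral>\<omega>. (X \<omega> i - \<theta> i)\<^sup>2 \<partial>M) = s2"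
    and y1: "\<And>i. i < d \<Longrightarrow> (\<integral>\<omega>. X \<omega> i - \<theta> i \<partial>M) = 0"
    and zero: "\<And>i. i < d \<Longrightarrow> (\<integral>\<omega>. (X \<omega> i - \<theta> i) * (\<theta> i / ((\<theta> i)\<^sup>2 + sqn_not d i (X \<omega>))) \<partial>M) = 0"
  shows "\<bar>\<Sum>i<d. \<integral>\<omega>. stein d \<theta> s2 i (X \<omega>) \<partial>M\<bar>
    \<le> (\<Sum>i<d. \<bar>(\<integral>\<omega>. (X \<omega> i - \<theta> i)\<^sup>2 / sqn_not d i (X \<omega>) \<partial>M) - s2 * (\<integral>\<omega>. 1 / sqn_not d i (X \<omega>) \<partial>M)\<bar>)
      + Q * (6 * real d * s2 * sqrt C4 + 2 * real d * sqrt C8 + 6 * sqn d \<theta> * s2)"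
proof -
  define y where "y i \<omega> = X \<omega> i - \<theta> i" for i \<omega>
  define u where "u i \<omega> = 1 / sqn_not d i (X \<omega>)" for i \<omega>
  define k where "k i \<omega> = kap (\<theta> i) (X \<omega> i) (sqn_not d i (X \<omega>))" for i \<omega>
  define r where "r i \<omega> = rad (X \<omega> i) (sqn_not d i (X \<omega>))" for i \<omega>
  define cv where "cv i = (\<integral>\<omega>. (y i \<omega>)\<^sup>2 * u i \<omega> \<partial>M) - s2 * (\<integral>\<omega>. u i \<omega> \<partial>M)" for i
  define L where "L = sqn d \<theta>"
  have yu: "(X \<omega> i - \<theta> i)\<^sup>2 / sqn_not d i (X \<omega>) = (y i \<omega>)\<^sup>2 * u i \<omega>" for i \<omega> by (simp add: y_def u_def)
  have "AE \<omega> in M. \<forall>i\<in>{..<d}. 0 < sqn_not d i (X \<omega>)"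
  proof (rule AE_finite_allI)
    fix i assume "i \<in> {..<d}"
    then have "AE \<omega> in M. sqn_not d i (X \<omega>) \<noteq> 0" using w by simp
    then show "AE \<omega> in M. 0 < sqn_not d i (X \<omega>)"
      by eventually_elim (simp add: order_less_le)
  qed simp
  then have pos: "AE \<omega> in M. \<forall>i<d. 0 < sqn_not d i (X \<omega>)" by eventually_elim simp
  have ym [measurable]: "y i \<in> borel_measurable M" if "i < d" for i
    unfolding y_def using measurable_Rd_component[OF X that] by measurable
  have um [measurable]: "u i \<in> borel_measurable M" for i unfolding u_def by measurable
  have u0: "0 \<le> u i \<omega>" for i \<omega> by (simp add: u_def)
  have ui: "integrable M (\<lambda>\<omega>. u i \<omega> ^ n)" if "i < d" "n \<le> 4" for i n
    using integrable_power_mono[OF um _ that(2), of i] u4(1)[OF that(1)] by (simp add: u_def)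
  have yi: "integrable M (\<lambda>\<omega>. y i \<omega> ^ n)" if "i < d" "n \<le> 8" for i n
    using integrable_power_mono[OF ym[OF that(1)] _ that(2)] y8(1)[OF that(1)] by (simp add: y_def)
  have Eu4: "(\<integral>\<omega>. u i \<omega> ^ 4 \<partial>M) \<le> Q\<^sup>2" if "i < d" for i using u4(2)[OF that] by (simp add: u_def)
  have Eu2: "(\<integral>\<omega>. (u i \<omega>)\<^sup>2 \<partial>M) \<le> Q" if "i < d" for i
    using expectation_square_le_sqrt[OF um ui[OF that] Eu4[OF that]] Q by simp
  have Eu1: "(\<integral>\<omega>. u i \<omega> \<partial>M) \<le> sqrt Q" if "i < d" for i
    using expectation_mult_le_sqrt[of "\<lambda>_. 1" "u i" 1 "sqrt Q"] ui[OF that, of 2] Eu2[OF that] Q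
    by (simp add: prob_space)
  have yui: "integrable M (\<lambda>\<omega>. (y i \<omega>)\<^sup>2 * u i \<omega>)" if "i < d" for i
    using ym[OF that] yi[OF that, of 4] ui[OF that, of 2]
    by (intro cauchy_schwarz_integral(1)) (simp_all add: square_square square_power4)
  have y2u2i: "integrable M (\<lambda>\<omega>. (y i \<omega>)\<^sup>2 * (u i \<omega>)\<^sup>2)" if "i < d" for i
    using ym[OF that] yi[OF that, of 4] ui[OF that, of 4]
    by (intro cauchy_schwarz_integral(1)) (simp_all add: square_square square_power4)
  have y4u2i: "integrable M (\<lambda>\<omega>. y i \<omega> ^ 4 * (u i \<omega>)\<^sup>2)" if "i < d" for i
    using ym[OF that] yi[OF that, of 8] ui[OF that, of 4]
    by (intro cauchy_schwarz_integral(1)) (simp_all add: square_square square_power4)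
  have Ey2u2: "(\<integral>\<omega>. (y i \<omega>)\<^sup>2 * (u i \<omega>)\<^sup>2 \<partial>M) \<le> sqrt C4 * Q" if "i < d" for i
    using ym[OF that] yi[OF that, of 4] ui[OF that, of 4] y4[OF that, folded y_def] Eu4[OF that] Q
    by (intro expectation_mult_le_sqrt) (simp_all add: square_square square_power4)
  have Ey4u2: "(\<integral>\<omega>. y i \<omega> ^ 4 * (u i \<omega>)\<^sup>2 \<partial>M) \<le> sqrt C8 * Q" if "i < d" for i
    using ym[OF that] yi[OF that, of 8] ui[OF that, of 4] y8(2)[OF that, folded y_def] Eu4[OF that] Q
    by (intro expectation_mult_le_sqrt) (simp_all add: square_square square_power4)
  have sC4: "s2 \<le> sqrt C4"
    using expectation_square_le_sqrt[OF ym[OF d] yi[OF d], of C4] y4[OF d] y2[OF d] by (simp add: y_def)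
  have zi: "integrable M (\<lambda>\<omega>. y i \<omega> * (\<theta> i / ((\<theta> i)\<^sup>2 + sqn_not d i (X \<omega>))))" if i: "i < d" for i
  proof (rule Bochner_Integration.integrable_bound[OF integrable_mult_right[OF integrable_abs[OF yi[OF i, of 1]], of "1 / \<bar>\<theta> i\<bar>"]])
    have "\<bar>\<theta> i / ((\<theta> i)\<^sup>2 + sqn_not d i (X \<omega>))\<bar> \<le> 1 / \<bar>\<theta> i\<bar>" for \<omega>
    proof (cases "\<theta> i = 0")
      case False
      have "\<bar>\<theta> i / ((\<theta> i)\<^sup>2 + sqn_not d i (X \<omega>))\<bar> = \<bar>\<theta> i\<bar> / ((\<theta> i)\<^sup>2 + sqn_not d i (X \<omega>))" by simp
      also have "\<dots> \<le> \<bar>\<theta> i\<bar> / (\<theta> i)\<^sup>2"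
      proof -
        have "0 < (\<theta> i)\<^sup>2" using False by simp
        then show ?thesis by (intro divide_left_mono mult_pos_pos) (simp_all add: add_pos_nonneg)
      qed
      also have "\<bar>\<theta> i\<bar> / (\<theta> i)\<^sup>2 = 1 / \<bar>\<theta> i\<bar>"
        using False by (cases "0 < \<theta> i") (simp_all add: power2_eq_square)
      finally show ?thesis .
    qed simp
    then have "\<bar>y i \<omega>\<bar> * \<bar>\<theta> i / ((\<theta> i)\<^sup>2 + sqn_not d i (X \<omega>))\<bar> \<le> \<bar>y i \<omega>\<bar> * (1 / \<bar>\<theta> i\<bar>)" for \<omega>
      by (rule mult_left_mono) simp
    then show "AE \<omega> in M. norm (y i \<omega> * (\<theta> i / ((\<theta> i)\<^sup>2 + sqn_not d i (X \<omega>)))) \<le> norm (1 / \<bar>\<theta> i\<bar> * \<bar>y i \<omega> ^ 1\<bar>)"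
      by (intro AE_I2) (simp add: abs_mult)
  qed (use ym[OF i] in measurable)
  have dec: "integrable M (\<lambda>\<omega>. (y i \<omega>)\<^sup>2 * u i \<omega> * k i \<omega>)" "integrable M (r i)"
    "(\<integral>\<omega>. stein d \<theta> s2 i (X \<omega>) \<partial>M) = cv i - (\<integral>\<omega>. (y i \<omega>)\<^sup>2 * u i \<omega> * k i \<omega> \<partial>M) + s2 * (\<integral>\<omega>. r i \<omega> \<partial>M)"
    if i: "i < d" for i
  proof -
    have h1: "integrable M (\<lambda>\<omega>. 1 / sqn_not d i (X \<omega>))" using ui[OF i, of 1] by (simp add: u_def)
    have h2: "integrable M (\<lambda>\<omega>. (X \<omega> i - \<theta> i)\<^sup>2 / sqn_not d i (X \<omega>))" unfolding yu by (rule yui[OF i])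
    have h3: "integrable M (\<lambda>\<omega>. (X \<omega> i - \<theta> i) * (\<theta> i / ((\<theta> i)\<^sup>2 + sqn_not d i (X \<omega>))))"
      using zi[OF i] by (simp add: y_def)
    note D = stein_decomposition[where X = X and d = d and i = i and \<theta> = \<theta>,
        OF X i w[OF i] h1 h2 h3 zero[OF i]]
    show "integrable M (\<lambda>\<omega>. (y i \<omega>)\<^sup>2 * u i \<omega> * k i \<omega>)" "integrable M (r i)"
      "(\<integral>\<omega>. stein d \<theta> s2 i (X \<omega>) \<partial>M) = cv i - (\<integral>\<omega>. (y i \<omega>)\<^sup>2 * u i \<omega> * k i \<omega> \<partial>M) + s2 * (\<integral>\<omega>. r i \<omega> \<partial>M)"
      using D(2,3) D(4)[of s2] unfolding yu k_def[symmetric] r_def[symmetric] u_def[symmetric] cv_def by simp_all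
  qed
  have Xy: "(X \<omega> i)\<^sup>2 = (y i \<omega>)\<^sup>2 + 2 * \<theta> i * y i \<omega> + (\<theta> i)\<^sup>2" for i \<omega>
    by (simp add: y_def power2_eq_square algebra_simps)
  have Xi: "integrable M (\<lambda>\<omega>. (X \<omega> i)\<^sup>2)" "(\<integral>\<omega>. (X \<omega> i)\<^sup>2 \<partial>M) = s2 + (\<theta> i)\<^sup>2" if i: "i < d" for i
    unfolding Xy using yi[OF i, of 1] yi[OF i, of 2] y1[OF i] y2[OF i]
    by (simp_all add: y_def[symmetric] prob_space)
  \<comment> \<open>This is \<open>E[sqn d (X \<omega>)]\<close>.\<close>
  define c where "c = L + real d * s2"
  have c: "0 < c" unfolding c_def L_def using d s2 by (simp add: add_nonneg_pos)
  have Ri: "integrable M (\<lambda>\<omega>. sqn d (X \<omega>))" "(\<integral>\<omega>. sqn d (X \<omega>) \<partial>M) = c"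
    using Xi by (auto simp: sqn_def c_def L_def sum.distrib intro!: Bochner_Integration.integrable_sum)
  have Ru: "AE \<omega> in M. 0 < sqn d (X \<omega>) \<and> 1 / sqn d (X \<omega>) \<le> u 0 \<omega>"
    using pos
  proof eventually_elim
    case (elim \<omega>)
    then have "0 < sqn_not d 0 (X \<omega>)" "sqn_not d 0 (X \<omega>) \<le> sqn d (X \<omega>)" using d by (simp_all add: sqn_split[OF d])
    then show ?case by (auto simp: u_def intro!: divide_left_mono)
  qed
  have iR: "integrable M (\<lambda>\<omega>. 1 / sqn d (X \<omega>))"
  proof (rule Bochner_Integration.integrable_bound[OF ui[OF d, of 1]])
    show "AE \<omega> in M. norm (1 / sqn d (X \<omega>)) \<le> norm (u 0 \<omega> ^ 1)"
      using Ru by eventually_elim (simp add: u0)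
  qed (simp, measurable)
  \<comment> \<open>Jensen's inequality for \<open>1 / r\<close>, obtained by integrating its
    tangent line at \<open>r = c\<close>.\<close>
  have "(\<integral>\<omega>. 2 / c - sqn d (X \<omega>) / c\<^sup>2 \<partial>M) \<le> (\<integral>\<omega>. 1 / sqn d (X \<omega>) \<partial>M)"
  proof (rule integral_mono_AE)
    show "AE \<omega> in M. 2 / c - sqn d (X \<omega>) / c\<^sup>2 \<le> 1 / sqn d (X \<omega>)"
      using Ru
    proof eventually_elim
      case (elim \<omega>)
      have "0 \<le> (sqn d (X \<omega>) - c)\<^sup>2 / (sqn d (X \<omega>) * c\<^sup>2)" using elim by simp
      also have "\<dots> = 1 / sqn d (X \<omega>) - (2 / c - sqn d (X \<omega>) / c\<^sup>2)"
        using elim c by (simp add: field_simps power2_eq_square)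
      finally show ?case by simp
    qed
  qed (use Ri iR in auto)
  also have "(\<integral>\<omega>. 2 / c - sqn d (X \<omega>) / c\<^sup>2 \<partial>M) = 1 / c"
    using Ri c by (simp add: prob_space power2_eq_square)
  finally have ER: "1 / c \<le> (\<integral>\<omega>. 1 / sqn d (X \<omega>) \<partial>M)" .
  also have "\<dots> \<le> (\<integral>\<omega>. u 0 \<omega> \<partial>M)"
    using Ru iR ui[OF d, of 1] by (intro integral_mono_AE) auto
  also have "\<dots> \<le> sqrt Q" by (rule Eu1[OF d])
  finally have ec: "1 \<le> sqrt Q * c" using c by (simp add: divide_le_eq)

  \<comment> \<open>The factor 6 is the 3 of \<open>rad_bounds\<close> times the 2 of
    \<open>(y + \<theta>)^2 \<le> 2 * y^2 + 2 * \<theta>^2\<close>.\<close>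
  have B_upper: "(\<integral>\<omega>. r i \<omega> \<partial>M) \<le> 6 * Q * (sqrt C4 + (\<theta> i)\<^sup>2)" if i: "i < d" for i
  proof -
    have "(\<integral>\<omega>. r i \<omega> \<partial>M) \<le> (\<integral>\<omega>. 6 * ((y i \<omega>)\<^sup>2 * (u i \<omega>)\<^sup>2) + 6 * (\<theta> i)\<^sup>2 * (u i \<omega>)\<^sup>2 \<partial>M)"
    proof (rule integral_mono_AE)
      show "AE \<omega> in M. r i \<omega> \<le> 6 * ((y i \<omega>)\<^sup>2 * (u i \<omega>)\<^sup>2) + 6 * (\<theta> i)\<^sup>2 * (u i \<omega>)\<^sup>2"
        using pos
      proof eventually_elim
        case (elim \<omega>)
        have "r i \<omega> \<le> 3 * (X \<omega> i)\<^sup>2 * (u i \<omega>)\<^sup>2"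
          using rad_bounds(2)[of "sqn_not d i (X \<omega>)" "X \<omega> i"] elim i by (simp add: r_def u_def power_divide)
        also have "\<dots> \<le> 3 * (2 * (y i \<omega>)\<^sup>2 + 2 * (\<theta> i)\<^sup>2) * (u i \<omega>)\<^sup>2"
          using sum_squares_bound[of "y i \<omega>" "\<theta> i"] unfolding Xy
          by (intro mult_right_mono mult_left_mono) (auto simp: algebra_simps)
        finally show ?case by (simp add: algebra_simps)
      qed
    qed (use dec(2)[OF i] y2u2i[OF i] ui[OF i, of 2] in auto)
    also have "\<dots> = 6 * (\<integral>\<omega>. (y i \<omega>)\<^sup>2 * (u i \<omega>)\<^sup>2 \<partial>M) + 6 * (\<theta> i)\<^sup>2 * (\<integral>\<omega>. (u i \<omega>)\<^sup>2 \<partial>M)"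
      using y2u2i[OF i] ui[OF i, of 2] by simp
    also have "\<dots> \<le> 6 * (sqrt C4 * Q) + 6 * (\<theta> i)\<^sup>2 * Q"
      using Ey2u2[OF i] Eu2[OF i] by (intro add_mono mult_left_mono) auto
    finally show ?thesis by (simp add: algebra_simps)
  qed
  \<comment> \<open>The lower bound of \<open>rad_bounds\<close> sums to \<open>3 / R\<close>, since
    the coordinates satisfy \<open>(\<Sum>i<d. (X \<omega> i)^2) = R\<close>.\<close>
  have B_lower: "3 / c \<le> (\<Sum>i<d. \<integral>\<omega>. r i \<omega> \<partial>M)"
  proof -
    have "3 * (\<integral>\<omega>. 1 / sqn d (X \<omega>) \<partial>M) = (\<integral>\<omega>. 3 * (1 / sqn d (X \<omega>)) \<partial>M)"
      by (rule integral_mult_right_zero[symmetric])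
    also have "\<dots> \<le> (\<integral>\<omega>. (\<Sum>i<d. r i \<omega>) \<partial>M)"
    proof (rule integral_mono_AE)
      show "AE \<omega> in M. 3 * (1 / sqn d (X \<omega>)) \<le> (\<Sum>i<d. r i \<omega>)"
        using pos Ru
      proof eventually_elim
        case (elim \<omega>)
        have "(\<Sum>i<d. 3 * (X \<omega> i)\<^sup>2 / (sqn d (X \<omega>))\<^sup>2) = 3 * sqn d (X \<omega>) / (sqn d (X \<omega>))\<^sup>2"
          by (simp only: sum_divide_distrib[symmetric] sum_distrib_left[symmetric] sqn_def[symmetric])
        also have "\<dots> = 3 * (1 / sqn d (X \<omega>))" using elim by (simp add: power2_eq_square)
        finally have "3 * (1 / sqn d (X \<omega>)) = (\<Sum>i<d. 3 * (X \<omega> i)\<^sup>2 / (sqn d (X \<omega>))\<^sup>2)" ..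
        also have "\<dots> \<le> (\<Sum>i<d. r i \<omega>)"
          using rad_bounds(3) elim(1) by (intro sum_mono) (auto simp: r_def sqn_split)
        finally show ?case .
      qed
    qed (rule integrable_mult_right[OF iR], rule Bochner_Integration.integrable_sum, use dec(2) in simp)
    also have "\<dots> = (\<Sum>i<d. \<integral>\<omega>. r i \<omega> \<partial>M)" using dec(2) by simp
    finally show ?thesis using ER by simp
  qed
  have A_nonneg: "0 \<le> (\<integral>\<omega>. (y i \<omega>)\<^sup>2 * u i \<omega> * k i \<omega> \<partial>M)" for i
    using u0 by (intro Bochner_Integration.integral_nonneg) (simp add: k_def kap_nonneg)
  define \<delta> where "\<delta> i = min 2 (9 * (\<theta> i)\<^sup>2 / L)" for i
  define a where "a i = 3/2 + real d * (\<theta> i)\<^sup>2 / (2 * L)" for i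
  have \<delta>: "0 \<le> \<delta> i" "\<delta> i \<le> 2" for i by (auto simp: \<delta>_def L_def)
  have a: "0 \<le> a i" for i by (simp add: a_def L_def)
  have "(\<Sum>i<d. \<integral>\<omega>. (y i \<omega>)\<^sup>2 * u i \<omega> * k i \<omega> \<partial>M) = (\<integral>\<omega>. (\<Sum>i<d. (y i \<omega>)\<^sup>2 * u i \<omega> * k i \<omega>) \<partial>M)"
    using dec(1) by simp
  also have "\<dots> \<le> (\<integral>\<omega>. (\<Sum>i<d. \<delta> i * ((y i \<omega>)\<^sup>2 * u i \<omega>) + a i * (y i \<omega> ^ 4 * (u i \<omega>)\<^sup>2)) \<partial>M)"
  proof (rule integral_mono_AE)
    show "AE \<omega> in M. (\<Sum>i<d. (y i \<omega>)\<^sup>2 * u i \<omega> * k i \<omega>)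
        \<le> (\<Sum>i<d. \<delta> i * ((y i \<omega>)\<^sup>2 * u i \<omega>) + a i * (y i \<omega> ^ 4 * (u i \<omega>)\<^sup>2))"
      using pos
    proof eventually_elim
      case (elim \<omega>)
      have "((y i \<omega>)\<^sup>2 * u i \<omega>)\<^sup>2 = y i \<omega> ^ 4 * (u i \<omega>)\<^sup>2" for i
        by (simp add: power_mult_distrib square_square square_power4)
      then show ?case
        using sum_kap_le[OF d, of "X \<omega>" \<theta>] elim unfolding yu k_def \<delta>_def a_def L_def by simp
    qed
  qed (use dec(1) yui y4u2i in \<open>auto intro!: Bochner_Integration.integrable_sum\<close>)
  also have "\<dots> = (\<Sum>i<d. \<delta> i * (\<integral>\<omega>. (y i \<omega>)\<^sup>2 * u i \<omega> \<partial>M) + a i * (\<integral>\<omega>. y i \<omega> ^ 4 * (u i \<omega>)\<^sup>2 \<partial>M))"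
    using yui y4u2i by simp
  \<comment> \<open>The mixed moment is traded for the covariance:
    \<open>E[y^2 * u] = cv + s2 * E[u]\<close>, and \<open>E[u] \<le> sqrt Q\<close>.\<close>
  also have "\<dots> \<le> (\<Sum>i<d. \<delta> i * cv i + \<delta> i * (s2 * sqrt Q) + a i * (sqrt C8 * Q))"
  proof (rule sum_mono)
    fix i assume "i \<in> {..<d}"
    then have i: "i < d" by simp
    have "s2 * (\<integral>\<omega>. u i \<omega> \<partial>M) \<le> s2 * sqrt Q" using Eu1[OF i] s2 by (intro mult_left_mono) auto
    then have "\<delta> i * (\<integral>\<omega>. (y i \<omega>)\<^sup>2 * u i \<omega> \<partial>M) \<le> \<delta> i * (cv i + s2 * sqrt Q)"
      using \<delta> by (intro mult_left_mono) (auto simp: cv_def)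
    moreover have "a i * (\<integral>\<omega>. y i \<omega> ^ 4 * (u i \<omega>)\<^sup>2 \<partial>M) \<le> a i * (sqrt C8 * Q)"
      using a Ey4u2[OF i] by (intro mult_left_mono)
    ultimately show "\<delta> i * (\<integral>\<omega>. (y i \<omega>)\<^sup>2 * u i \<omega> \<partial>M) + a i * (\<integral>\<omega>. y i \<omega> ^ 4 * (u i \<omega>)\<^sup>2 \<partial>M)
      \<le> \<delta> i * cv i + \<delta> i * (s2 * sqrt Q) + a i * (sqrt C8 * Q)"
      by (simp add: algebra_simps)
  qed
  also have "\<dots> = (\<Sum>i<d. \<delta> i * cv i) + (\<Sum>i<d. \<delta> i) * (s2 * sqrt Q) + (\<Sum>i<d. a i) * (sqrt C8 * Q)"
    by (simp add: sum.distrib sum_distrib_right)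
  also have "\<dots> \<le> (\<Sum>i<d. \<delta> i * cv i) + 9 * (s2 * sqrt Q) + (2 * real d) * (sqrt C8 * Q)"
  proof -
    have "0 \<le> sqrt C8 * Q"
      using order_trans[OF _ Ey4u2[OF d]] by (simp add: Bochner_Integration.integral_nonneg)
    then show ?thesis
      using sum_tilts_le[where d = d and \<theta> = \<theta>] sum_weights_le[OF d, of \<theta>] s2 Q
      unfolding \<delta>_def a_def L_def by (intro add_mono mult_right_mono order_refl) auto
  qed
  finally have A_upper: "(\<Sum>i<d. \<integral>\<omega>. (y i \<omega>)\<^sup>2 * u i \<omega> * k i \<omega> \<partial>M)
    \<le> (\<Sum>i<d. \<delta> i * cv i) + 9 * (s2 * sqrt Q) + (2 * real d) * (sqrt C8 * Q)" .

  have T: "(\<Sum>i<d. \<integral>\<omega>. stein d \<theta> s2 i (X \<omega>) \<partial>M)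
      = (\<Sum>i<d. cv i) - (\<Sum>i<d. \<integral>\<omega>. (y i \<omega>)\<^sup>2 * u i \<omega> * k i \<omega> \<partial>M) + s2 * (\<Sum>i<d. \<integral>\<omega>. r i \<omega> \<partial>M)"
    using dec(3) by (simp add: sum.distrib sum_subtractf sum_distrib_left)
  have C8: "0 \<le> sqrt C8 * Q" using order_trans[OF _ Ey4u2[OF d]] by (simp add: Bochner_Integration.integral_nonneg)
  have "(\<Sum>i<d. \<integral>\<omega>. stein d \<theta> s2 i (X \<omega>) \<partial>M) \<le> (\<Sum>i<d. \<bar>cv i\<bar>) + s2 * (\<Sum>i<d. 6 * Q * (sqrt C4 + (\<theta> i)\<^sup>2))"
  proof -
    have "(\<Sum>i<d. cv i) \<le> (\<Sum>i<d. \<bar>cv i\<bar>)" by (intro sum_mono) simp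
    moreover have "0 \<le> (\<Sum>i<d. \<integral>\<omega>. (y i \<omega>)\<^sup>2 * u i \<omega> * k i \<omega> \<partial>M)" by (intro sum_nonneg A_nonneg)
    moreover have "s2 * (\<Sum>i<d. \<integral>\<omega>. r i \<omega> \<partial>M) \<le> s2 * (\<Sum>i<d. 6 * Q * (sqrt C4 + (\<theta> i)\<^sup>2))"
      using s2 B_upper by (intro mult_left_mono sum_mono) auto
    ultimately show ?thesis unfolding T by linarith
  qed
  also have "\<dots> = (\<Sum>i<d. \<bar>cv i\<bar>) + Q * (6 * real d * s2 * sqrt C4 + 6 * L * s2)"
    by (simp add: L_def sqn_def sum.distrib sum_distrib_left[symmetric] algebra_simps)
  finally have upper: "(\<Sum>i<d. \<integral>\<omega>. stein d \<theta> s2 i (X \<omega>) \<partial>M)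
    \<le> (\<Sum>i<d. \<bar>cv i\<bar>) + Q * (6 * real d * s2 * sqrt C4 + 6 * L * s2)" .
  \<comment> \<open>The cap at 2 is used here: the covariances occur with the weights
    \<open>\<delta> i - 1\<close>, which lie between -1 and 1.\<close>
  have "(\<Sum>i<d. \<delta> i * cv i) - (\<Sum>i<d. cv i) = (\<Sum>i<d. (\<delta> i - 1) * cv i)"
    by (simp add: sum_subtractf[symmetric] left_diff_distrib)
  also have "\<dots> \<le> (\<Sum>i<d. \<bar>cv i\<bar>)"
  proof (rule sum_mono)
    fix i
    have "(\<delta> i - 1) * cv i \<le> \<bar>\<delta> i - 1\<bar> * \<bar>cv i\<bar>" by (metis abs_ge_self abs_mult)
    also have "\<dots> \<le> 1 * \<bar>cv i\<bar>" using \<delta>[of i] by (intro mult_right_mono) auto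
    finally show "(\<delta> i - 1) * cv i \<le> \<bar>cv i\<bar>" by simp
  qed
  finally have cv: "(\<Sum>i<d. \<delta> i * cv i) - (\<Sum>i<d. cv i) \<le> (\<Sum>i<d. \<bar>cv i\<bar>)" .
  \<comment> \<open>With \<open>p = sqrt Q * c \<ge> 1\<close> this is
    \<open>6 * p^2 - 9 * p + 3 \<ge> 0\<close> divided by \<open>c\<close>: the tilt costs
    \<open>9 * sqrt Q\<close>, and \<open>3 / c\<close> of it is returned by
    \<open>B_lower\<close>.\<close>
  have "0 \<le> 3 * (2 * (sqrt Q * c) - 1) * (sqrt Q * c - 1) / c"
    using ec c by (intro divide_nonneg_pos mult_nonneg_nonneg) auto
  also have "\<dots> = 6 * (sqrt Q * sqrt Q) * c - 9 * sqrt Q + 3 / c"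
    using c by (simp add: field_simps)
  also have "sqrt Q * sqrt Q = Q" using Q by simp
  finally have "9 * sqrt Q - 3 / c \<le> 6 * Q * c" by simp
  then have "s2 * (9 * sqrt Q - 3 / c) \<le> s2 * (6 * Q * c)" using s2 by (intro mult_left_mono) auto
  also have "\<dots> = Q * (6 * real d * s2 * s2 + 6 * L * s2)" by (simp add: c_def algebra_simps)
  also have "\<dots> \<le> Q * (6 * real d * s2 * sqrt C4 + 6 * L * s2)"
    using sC4 s2 Q by (intro mult_left_mono add_right_mono) auto
  finally have e: "s2 * (9 * sqrt Q - 3 / c) \<le> Q * (6 * real d * s2 * sqrt C4 + 6 * L * s2)" .
  have "s2 * (3 / c) \<le> s2 * (\<Sum>i<d. \<integral>\<omega>. r i \<omega> \<partial>M)" using B_lower s2 by (intro mult_left_mono) auto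
  then have "- (\<Sum>i<d. \<integral>\<omega>. stein d \<theta> s2 i (X \<omega>) \<partial>M)
    \<le> (\<Sum>i<d. \<bar>cv i\<bar>) + Q * (6 * real d * s2 * sqrt C4 + 6 * L * s2) + 2 * real d * (sqrt C8 * Q)"
    unfolding T using A_upper cv e by (simp add: right_diff_distrib)
  with upper C8 have "\<bar>\<Sum>i<d. \<integral>\<omega>. stein d \<theta> s2 i (X \<omega>) \<partial>M\<bar>
    \<le> (\<Sum>i<d. \<bar>cv i\<bar>) + Q * (6 * real d * s2 * sqrt C4 + 6 * L * s2) + 2 * real d * (sqrt C8 * Q)"
    by (simp add: abs_le_iff add_increasing2)
  then show ?thesis
    unfolding cv_def yu L_def u_def[symmetric] by (simp add: algebra_simps)
qed

end

subsection \<open>Zero bias vectors\<close>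

lemma two_abs_mult_le: "2 * (\<bar>a\<bar> * \<bar>b\<bar>) \<le> a\<^sup>2 + b\<^sup>2" for a b :: real
  using sum_squares_bound[of "\<bar>a\<bar>" "\<bar>b\<bar>"] by simp

lemma abs_mult_le:
  fixes a b c :: real
  assumes "b\<^sup>2 \<le> c"
  shows "\<bar>a * b\<bar> \<le> a\<^sup>2 + c"
proof -
  have "0 \<le> \<bar>a\<bar> * \<bar>b\<bar>" by simp
  then show ?thesis using two_abs_mult_le[of a b] assms unfolding abs_mult by linarith
qed

lemma curvature_eq: "1 / r - 2 * x * x / r\<^sup>2 = (r - 2 * x\<^sup>2) / r\<^sup>2" for r x :: real
  by (simp add: diff_divide_distrib power2_eq_square)

lemma sqn_zvec [simp]: "sqn d (zvec d) = 0"
  by (simp add: sqn_def zvec_def)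

lemma sqn_eq_0_iff:
  assumes "x \<in> space (Rd d)"
  shows "sqn d x = 0 \<longleftrightarrow> x = zvec d"
proof
  assume "sqn d x = 0"
  then have "x i = 0" if "i < d" for i using component_le_sqn[OF that, of x] by simp
  moreover have "x i = undefined" if "\<not> i < d" for i
    using assms that by (auto simp: Rd_def space_PiM PiE_def extensional_def)
  ultimately show "x = zvec d" by (auto simp: zvec_def fun_eq_iff restrict_def)
qed simp

lemma sqn_upd: "j < d \<Longrightarrow> sqn d (x(j := x j + t)) = sqn d x + 2 * x j * t + t\<^sup>2"
proof -
  assume j: "j < d"
  have "sqn_not d j (x(j := x j + t)) = sqn_not d j x"
    unfolding sqn_not_def by (intro sum.cong) auto
  then show ?thesis
    by (simp add: sqn_split[OF j] power2_eq_square algebra_simps)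
qed

lemma pd_fl:
  assumes x: "sqn d x \<noteq> 0" and i: "i < d" and j: "j < d"
  shows "pd (fl d lam) i j x = - lam * ((if i = j then 1 else 0) / sqn d x - 2 * x i * x j / (sqn d x)\<^sup>2)"
proof -
  have e: "(\<lambda>t. fl d lam (x(j := x j + t)) i)
      = (\<lambda>t. - lam * ((x i + (if i = j then 1 else 0) * t) / (sqn d x + 2 * x j * t + t\<^sup>2)))"
    using i j by (auto simp: fl_def sqn_upd fun_eq_iff)
  have "((\<lambda>t. - lam * ((x i + (if i = j then 1 else 0) * t) / (sqn d x + 2 * x j * t + t\<^sup>2)))
      has_real_derivative - lam * ((if i = j then 1 else 0) / sqn d x - 2 * x i * x j / (sqn d x)\<^sup>2)) (at 0)"
    using x by (auto intro!: derivative_eq_intros simp: field_simps power2_eq_square)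
  then show ?thesis unfolding pd_def e by (rule DERIV_imp_deriv)
qed

lemma g0_eq_fl: "g0 d = fl d (-1)"
  by (auto simp: g0_def fl_def fun_eq_iff restrict_def)

text \<open>At the origin \<open>deriv\<close> returns some fixed unspecified number; as
  \<open>zvec d\<close> is the only element of \<open>Rd d\<close> with norm zero, a case
  distinction on \<open>sqn\<close> gives a measurable expression.\<close>

lemma measurable_pd_fl:
  assumes X [measurable]: "X \<in> M \<rightarrow>\<^sub>M Rd d" and i: "i < d" and j: "j < d"
  shows "(\<lambda>\<omega>. pd (fl d lam) i j (X \<omega>)) \<in> borel_measurable M"
proof -
  note [measurable] = measurable_Rd_component[OF X i] measurable_Rd_component[OF X j]
  have "(\<lambda>\<omega>. if sqn d (X \<omega>) = 0 then pd (fl d lam) i j (zvec d)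
      else - lam * ((if i = j then 1 else 0) / sqn d (X \<omega>) - 2 * X \<omega> i * X \<omega> j / (sqn d (X \<omega>))\<^sup>2))
      \<in> borel_measurable M" by measurable
  moreover have "pd (fl d lam) i j (X \<omega>) = (if sqn d (X \<omega>) = 0 then pd (fl d lam) i j (zvec d)
      else - lam * ((if i = j then 1 else 0) / sqn d (X \<omega>) - 2 * X \<omega> i * X \<omega> j / (sqn d (X \<omega>))\<^sup>2))"
    if "\<omega> \<in> space M" for \<omega>
    using sqn_eq_0_iff[OF measurable_space[OF X that]] pd_fl[OF _ i j, of "X \<omega>" lam] by auto
  ultimately show ?thesis by (subst measurable_cong) auto
qed

lemma integral_pd_fl:
  assumes X [measurable]: "X \<in> M \<rightarrow>\<^sub>M Rd d" and i: "i < d" and j: "j < d" and "AE \<omega> in M. X \<omega> \<noteq> zvec d"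
  shows "(\<integral>\<omega>. pd (fl d lam) i j (X \<omega>) \<partial>M)
    = - lam * (\<integral>\<omega>. (if i = j then 1 else 0) / sqn d (X \<omega>) - 2 * X \<omega> i * X \<omega> j / (sqn d (X \<omega>))\<^sup>2 \<partial>M)"
proof -
  note [measurable] = measurable_Rd_component[OF X i] measurable_Rd_component[OF X j]
  have "AE \<omega> in M. pd (fl d lam) i j (X \<omega>)
      = - lam * ((if i = j then 1 else 0) / sqn d (X \<omega>) - 2 * X \<omega> i * X \<omega> j / (sqn d (X \<omega>))\<^sup>2)"
    using assms(4)
  proof (rule AE_mp, intro AE_I2 impI)
    fix \<omega> assume "\<omega> \<in> space M" "X \<omega> \<noteq> zvec d"
    then show "pd (fl d lam) i j (X \<omega>)
      = - lam * ((if i = j then 1 else 0) / sqn d (X \<omega>) - 2 * X \<omega> i * X \<omega> j / (sqn d (X \<omega>))\<^sup>2)"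
      using sqn_eq_0_iff[OF measurable_space[OF X]] by (intro pd_fl i j) auto
  qed
  then have "(\<integral>\<omega>. pd (fl d lam) i j (X \<omega>) \<partial>M)
      = (\<integral>\<omega>. - lam * ((if i = j then 1 else 0) / sqn d (X \<omega>) - 2 * X \<omega> i * X \<omega> j / (sqn d (X \<omega>))\<^sup>2) \<partial>M)"
    by (rule integral_cong_AE[OF measurable_pd_fl[OF X i j], rotated]) measurable
  then show ?thesis by simp
qed

text \<open>Only the \<open>k\<close>-th component is nonzero and it does not depend on \<open>x\<^sub>k\<close>, so for diagonal \<open>\<Sigma>\<close> the right
  hand side of the zero bias identity vanishes.\<close>
definition shrink_field :: "nat \<Rightarrow> real \<Rightarrow> nat \<Rightarrow> rvec \<Rightarrow> rvec" where
  "shrink_field d c k x = (\<lambda>i\<in>{..<d}. if i = k then c / (c\<^sup>2 + sqn_not d k x) else 0)"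

text \<open>For \<open>c = 0\<close> both sides are 0, because division by zero gives 0; so the
  bound needs no condition on the coordinate of \<open>\<theta>\<close>.\<close>

lemma shrink_field_bound: "\<bar>c / (c\<^sup>2 + sqn_not d k x)\<bar> \<le> 1 / \<bar>c\<bar>"
proof (cases "c = 0")
  case False
  then have "0 < c\<^sup>2" by simp
  then have "\<bar>c\<bar> / (c\<^sup>2 + sqn_not d k x) \<le> \<bar>c\<bar> / c\<^sup>2"
    by (intro divide_left_mono mult_pos_pos) (simp_all add: add_pos_nonneg)
  also have "\<dots> = 1 / \<bar>c\<bar>" using False by (cases "0 < c") (simp_all add: power2_eq_square)
  finally show ?thesis by simp
qed simp

lemma pd_shrink_field:
  assumes c: "c \<noteq> 0" and i: "i < d" and j: "j < d" and k: "k < d"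
  defines "D \<equiv> (\<lambda>x. if i = k \<and> j \<noteq> k then - c * (2 * x j) / (c\<^sup>2 + sqn_not d k x)\<^sup>2 else 0)"
  shows "((\<lambda>t. shrink_field d c k (x(j := x j + t)) i) has_real_derivative D x) (at 0)"
    and "pd (shrink_field d c k) i j x = D x"
proof -
  have c2: "0 < c\<^sup>2 + sqn_not d k x" using c by (simp add: add_pos_nonneg)
  have w: "sqn_not d k (x(j := x j + t)) = sqn_not d k x + (if j = k then 0 else 2 * x j * t + t\<^sup>2)" for t
  proof (cases "j = k")
    case True
    then have "sqn_not d k (x(j := x j + t)) = sqn_not d k x"
      unfolding sqn_not_def by (intro sum.cong) auto
    then show ?thesis using True by simp
  next
    case False
    have "sqn d (x(j := x j + t)) = sqn_not d k (x(j := x j + t)) + (x k)\<^sup>2"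
      using False by (simp add: sqn_split[OF k])
    then show ?thesis using False sqn_upd[OF j, of x t] sqn_split[OF k, of x] by simp
  qed
  have e: "(\<lambda>t. shrink_field d c k (x(j := x j + t)) i)
    = (\<lambda>t. if i = k then c / (c\<^sup>2 + sqn_not d k x + (if j = k then 0 else 2 * x j * t + t\<^sup>2)) else 0)"
    using i by (auto simp: shrink_field_def w fun_eq_iff add.assoc)
  show d: "((\<lambda>t. shrink_field d c k (x(j := x j + t)) i) has_real_derivative D x) (at 0)"
    unfolding e D_def using c2
    by (cases "i = k"; cases "j = k")
       (auto intro!: derivative_eq_intros simp: power2_eq_square)
  show "pd (shrink_field d c k) i j x = D x"
    unfolding pd_def by (rule DERIV_imp_deriv[OF d])
qed

lemma continuous_on_component: "continuous_on A (\<lambda>x::rvec. x i)"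
  by (rule continuous_on_product_coordinates[THEN continuous_on_subset]) simp

lemma continuous_on_sqn_not: "continuous_on A (sqn_not d k)"
  unfolding sqn_not_def[abs_def] by (intro continuous_intros continuous_on_component)

lemma Xof_component: "i < d \<Longrightarrow> Xof d Y \<theta> \<omega> i = Y \<omega> i + \<theta> i"
  by (simp add: Xof_def vplus_def)

lemma measurable_Xof:
  assumes Y: "Y \<in> M \<rightarrow>\<^sub>M Rd d"
  shows "Xof d Y \<theta> \<in> M \<rightarrow>\<^sub>M Rd d"
  unfolding Xof_def vplus_def Rd_def
  using measurable_Rd_component[OF Y] by (intro measurable_restrict borel_measurable_add) auto

section \<open>Integrability and the zero bias identity for a single problem\<close>

locale zero_bias_setting =
  fixes M :: "'a measure" and d Y \<theta> S Xz
  assumes setting: "setting M d Y \<theta> S Xz"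
begin

abbreviation X where "X \<equiv> Xof d Y \<theta>"

sublocale prob_space M
  using setting by (simp add: setting_def mean_zero_cov_def)

lemma X [measurable]: "X \<in> M \<rightarrow>\<^sub>M Rd d"
  using setting by (intro measurable_Xof) (simp add: setting_def mean_zero_cov_def)

lemma Xi [measurable]: "i < d \<Longrightarrow> (\<lambda>\<omega>. X \<omega> i) \<in> borel_measurable M"
  by (rule measurable_Rd_component[OF X])

lemma X_nonzero: "AE \<omega> in M. X \<omega> \<noteq> zvec d"
  using setting by (simp add: setting_def)

lemma sqn_X_pos: "AE \<omega> in M. 0 < sqn d (X \<omega>)"
proof (rule AE_mp[OF X_nonzero], intro AE_I2 impI)
  fix \<omega> assume "\<omega> \<in> space M" "X \<omega> \<noteq> zvec d"
  then show "0 < sqn d (X \<omega>)"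
    using sqn_eq_0_iff[OF measurable_space[OF X]] sqn_nonneg[of d "X \<omega>"] by (auto simp: less_le)
qed

lemma d_pos: "0 < d"
proof (rule ccontr)
  assume "\<not> 0 < d"
  then have "AE \<omega> in M. False" using sqn_X_pos by (simp add: sqn_def)
  then show False by simp
qed

lemma Xz: "i < d \<Longrightarrow> j < d \<Longrightarrow> S i j \<noteq> 0 \<Longrightarrow> Xz i j \<in> M \<rightarrow>\<^sub>M Rd d"
  and Xz_nonzero: "i < d \<Longrightarrow> j < d \<Longrightarrow> S i j \<noteq> 0 \<Longrightarrow> AE \<omega> in M. Xz i j \<omega> \<noteq> zvec d"
  using setting by (auto simp: setting_def zero_bias_vectors_def)

lemma centered_square_integrable: "i < d \<Longrightarrow> integrable M (\<lambda>\<omega>. (X \<omega> i - \<theta> i)\<^sup>2)"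
  and centered_expectation: "i < d \<Longrightarrow> (\<integral>\<omega>. X \<omega> i - \<theta> i \<partial>M) = 0"
  and covariance: "i < d \<Longrightarrow> j < d \<Longrightarrow> S i j = (\<integral>\<omega>. (X \<omega> i - \<theta> i) * (X \<omega> j - \<theta> j) \<partial>M)"
  using setting by (simp_all add: setting_def mean_zero_cov_def Xof_component)

text \<open>The squared norm of \<open>g0 d x\<close> is \<open>1 / sqn d x\<close>, so this is the
  square integrability contained in \<open>Wz\<close> for \<open>g0\<close>.\<close>

lemma inverse_sqn_integrable: "integrable M (\<lambda>\<omega>. 1 / sqn d (X \<omega>))"
proof -
  have "sqn d (g0 d x) = 1 / sqn d x" for x
  proof -
    have "sqn d (g0 d x) = sqn d x / (sqn d x)\<^sup>2"
      by (simp add: sqn_def g0_def power_divide sum_divide_distrib)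
    then show ?thesis by (simp add: power2_eq_square)
  qed
  then show ?thesis using setting by (simp add: setting_def Wz_def)
qed

lemma zero_bias:
  assumes "Wz M d S X Xz f"
  shows "(\<integral>\<omega>. (\<Sum>i<d. (X \<omega> i - \<theta> i) * f (X \<omega>) i) \<partial>M) = (\<Sum>i<d. \<Sum>j<d. S i j * (\<integral>\<omega>. pd f i j (Xz i j \<omega>) \<partial>M))"
  using setting assms by (simp add: setting_def zero_bias_vectors_def)

lemma score_integrable:
  assumes i: "i < d"
  shows "integrable M (\<lambda>\<omega>. (X \<omega> i - \<theta> i) * X \<omega> i / sqn d (X \<omega>))"
proof (rule Bochner_Integration.integrable_bound[OF
    Bochner_Integration.integrable_add[OF centered_square_integrable[OF i] inverse_sqn_integrable]])
  show "AE \<omega> in M. norm ((X \<omega> i - \<theta> i) * X \<omega> i / sqn d (X \<omega>)) \<le> norm ((X \<omega> i - \<theta> i)\<^sup>2 + 1 / sqn d (X \<omega>))"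
    using sqn_X_pos
  proof eventually_elim
    case (elim \<omega>)
    let ?a = "X \<omega> i - \<theta> i" and ?b = "X \<omega> i / sqn d (X \<omega>)"
    have "?b\<^sup>2 \<le> sqn d (X \<omega>) / (sqn d (X \<omega>))\<^sup>2"
      unfolding power_divide using component_le_sqn[OF i, of "X \<omega>"] by (intro divide_right_mono) simp_all
    also have "\<dots> = 1 / sqn d (X \<omega>)" by (simp add: power2_eq_square)
    finally have b: "?b\<^sup>2 \<le> 1 / sqn d (X \<omega>)" .
    have "\<bar>?a * ?b\<bar> \<le> ?a\<^sup>2 + 1 / sqn d (X \<omega>)" using b by (rule abs_mult_le)
    then show ?case by simp
  qed
qed (use Xi[OF i] in measurable)

lemma hessian_integrable:
  assumes i: "i < d" and j: "j < d"
  shows "integrable M (\<lambda>\<omega>. X \<omega> i * X \<omega> j / (sqn d (X \<omega>))\<^sup>2)"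
proof (rule Bochner_Integration.integrable_bound[OF inverse_sqn_integrable])
  show "AE \<omega> in M. norm (X \<omega> i * X \<omega> j / (sqn d (X \<omega>))\<^sup>2) \<le> norm (1 / sqn d (X \<omega>))"
    using sqn_X_pos
  proof eventually_elim
    case (elim \<omega>)
    have "2 * (\<bar>X \<omega> i\<bar> * \<bar>X \<omega> j\<bar>) \<le> (X \<omega> i)\<^sup>2 + (X \<omega> j)\<^sup>2" by (rule two_abs_mult_le)
    also have "\<dots> \<le> 2 * sqn d (X \<omega>)"
      using component_le_sqn[OF i, of "X \<omega>"] component_le_sqn[OF j, of "X \<omega>"] by simp
    finally have "\<bar>X \<omega> i\<bar> * \<bar>X \<omega> j\<bar> / (sqn d (X \<omega>))\<^sup>2 \<le> sqn d (X \<omega>) / (sqn d (X \<omega>))\<^sup>2"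
      by (intro divide_right_mono) auto
    then show ?case using elim by (simp add: abs_mult power2_eq_square)
  qed
qed (use Xi[OF i] Xi[OF j] in measurable)

lemma zero_bias_score:
  "(\<Sum>i<d. \<Sum>j<d. S i j * (\<integral>\<omega>. pd (fl d lam) i j (Xz i j \<omega>) \<partial>M))
    = - lam * (\<Sum>i<d. \<integral>\<omega>. (X \<omega> i - \<theta> i) * X \<omega> i / sqn d (X \<omega>) \<partial>M)"
proof -
  have "S i j * (\<integral>\<omega>. pd (fl d lam) i j (Xz i j \<omega>) \<partial>M)
      = - lam * (S i j * (\<integral>\<omega>. pd (g0 d) i j (Xz i j \<omega>) \<partial>M))" if "i < d" "j < d" for i j
  \<comment> \<open>Where \<open>S i j = 0\<close> nothing is known about \<open>Xz i j\<close>, and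
    the factor removes the term. Elsewhere both integrals equal the same expression up to the
    factor.\<close>
  proof (cases "S i j = 0")
    case False
    note integral_pd_fl[OF Xz[OF that False] that Xz_nonzero[OF that False]]
    from this[of lam] this[of "-1"] show ?thesis by (simp add: g0_eq_fl)
  qed simp
  then have "(\<Sum>i<d. \<Sum>j<d. S i j * (\<integral>\<omega>. pd (fl d lam) i j (Xz i j \<omega>) \<partial>M))
    = - lam * (\<Sum>i<d. \<Sum>j<d. S i j * (\<integral>\<omega>. pd (g0 d) i j (Xz i j \<omega>) \<partial>M))"
    by (simp add: sum_distrib_left)
  also have "\<dots> = - lam * (\<integral>\<omega>. (\<Sum>i<d. (X \<omega> i - \<theta> i) * g0 d (X \<omega>) i) \<partial>M)"
    using setting by (subst zero_bias) (simp_all add: setting_def)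
  also have "(\<integral>\<omega>. (\<Sum>i<d. (X \<omega> i - \<theta> i) * g0 d (X \<omega>) i) \<partial>M)
      = (\<integral>\<omega>. (\<Sum>i<d. (X \<omega> i - \<theta> i) * X \<omega> i / sqn d (X \<omega>)) \<partial>M)"
    by (simp add: g0_def)
  also have "\<dots> = (\<Sum>i<d. \<integral>\<omega>. (X \<omega> i - \<theta> i) * X \<omega> i / sqn d (X \<omega>) \<partial>M)"
    using score_integrable by (intro Bochner_Integration.integral_sum) simp
  finally show ?thesis .
qed

text \<open>Eliminates the zero bias vectors: the right hand side depends on the law of
  \<open>X\<close> only, so the estimates require no coupling.\<close>

lemma Bstar_eq:
  "Bstar M d S X Xz lam = \<bar>- lam * (\<Sum>i<d. \<integral>\<omega>. (X \<omega> i - \<theta> i) * X \<omega> i / sqn d (X \<omega>) \<partial>M)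
    - (\<Sum>i<d. \<Sum>j<d. S i j * (\<integral>\<omega>. pd (fl d lam) i j (X \<omega>) \<partial>M))\<bar>"
  unfolding Bstar_def zero_bias_score[symmetric] by (simp add: sum_subtractf right_diff_distrib)

end

section \<open>Isotropic covariance\<close>

locale isotropic_setting = zero_bias_setting M d Y \<theta> S Xz
  for M :: "'a measure" and d Y \<theta> S Xz +
  fixes s2 :: real
  assumes isotropic: "isotropic d S s2"
begin

lemma s2_pos: "0 < s2" and S_eq: "i < d \<Longrightarrow> j < d \<Longrightarrow> S i j = (if i = j then s2 else 0)"
  using isotropic by (auto simp: isotropic_def)

lemma variance: "i < d \<Longrightarrow> (\<integral>\<omega>. (X \<omega> i - \<theta> i)\<^sup>2 \<partial>M) = s2"
  by (frule covariance[of i i]; simp add: S_eq power2_eq_square)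

lemma sum_S: "(\<Sum>i<d. \<Sum>j<d. S i j * f i j) = s2 * (\<Sum>i<d. f i i)"
proof -
  have "(\<Sum>j<d. S i j * f i j) = s2 * f i i" if "i < d" for i
  proof -
    have "(\<Sum>j<d. S i j * f i j) = (\<Sum>j<d. if j = i then s2 * f i i else 0)"
      using that by (intro sum.cong) (auto simp: S_eq)
    also have "\<dots> = s2 * f i i" using that by (subst sum.delta) auto
    finally show ?thesis .
  qed
  then show ?thesis by (simp add: sum_distrib_left)
qed

lemma curvature_integrable:
  assumes i: "i < d"
  shows "integrable M (\<lambda>\<omega>. (sqn d (X \<omega>) - 2 * (X \<omega> i)\<^sup>2) / (sqn d (X \<omega>))\<^sup>2)"
proof -
  have "integrable M (\<lambda>\<omega>. 1 / sqn d (X \<omega>) - 2 * (X \<omega> i * X \<omega> i / (sqn d (X \<omega>))\<^sup>2))"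
    using inverse_sqn_integrable hessian_integrable[OF i i]
    by (intro Bochner_Integration.integrable_diff integrable_mult_right)
  then show ?thesis by (simp add: curvature_eq[symmetric] mult.assoc)
qed

lemma stein_integrable: "i < d \<Longrightarrow> integrable M (\<lambda>\<omega>. stein d \<theta> s2 i (X \<omega>))"
  unfolding stein_def using score_integrable curvature_integrable
  by (intro Bochner_Integration.integrable_diff integrable_mult_right)

lemma Bstar_stein: "Bstar M d S X Xz lam = \<bar>lam\<bar> * \<bar>\<Sum>i<d. \<integral>\<omega>. stein d \<theta> s2 i (X \<omega>) \<partial>M\<bar>"
proof -
  have "(\<integral>\<omega>. pd (fl d lam) i i (X \<omega>) \<partial>M)
      = - lam * (\<integral>\<omega>. (sqn d (X \<omega>) - 2 * (X \<omega> i)\<^sup>2) / (sqn d (X \<omega>))\<^sup>2 \<partial>M)" if i: "i < d" for i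
    using integral_pd_fl[OF X i i X_nonzero, of lam] by (simp only: curvature_eq if_True simp_thms)
  then have "(\<Sum>i<d. \<Sum>j<d. S i j * (\<integral>\<omega>. pd (fl d lam) i j (X \<omega>) \<partial>M))
      = - lam * (\<Sum>i<d. s2 * (\<integral>\<omega>. (sqn d (X \<omega>) - 2 * (X \<omega> i)\<^sup>2) / (sqn d (X \<omega>))\<^sup>2 \<partial>M))"
    unfolding sum_S by (simp add: sum_distrib_left sum_negf mult.left_commute)
  moreover have "(\<integral>\<omega>. stein d \<theta> s2 i (X \<omega>) \<partial>M) = (\<integral>\<omega>. (X \<omega> i - \<theta> i) * X \<omega> i / sqn d (X \<omega>) \<partial>M)
      - s2 * (\<integral>\<omega>. (sqn d (X \<omega>) - 2 * (X \<omega> i)\<^sup>2) / (sqn d (X \<omega>))\<^sup>2 \<partial>M)" if "i < d" for i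
  proof -
    have "(\<integral>\<omega>. stein d \<theta> s2 i (X \<omega>) \<partial>M) = (\<integral>\<omega>. (X \<omega> i - \<theta> i) * X \<omega> i / sqn d (X \<omega>) \<partial>M)
      - (\<integral>\<omega>. s2 * ((sqn d (X \<omega>) - 2 * (X \<omega> i)\<^sup>2) / (sqn d (X \<omega>))\<^sup>2) \<partial>M)"
      unfolding stein_def
      by (rule Bochner_Integration.integral_diff[OF score_integrable[OF that] integrable_mult_right[OF curvature_integrable[OF that]]])
    also have "(\<integral>\<omega>. s2 * ((sqn d (X \<omega>) - 2 * (X \<omega> i)\<^sup>2) / (sqn d (X \<omega>))\<^sup>2) \<partial>M)
      = s2 * (\<integral>\<omega>. (sqn d (X \<omega>) - 2 * (X \<omega> i)\<^sup>2) / (sqn d (X \<omega>))\<^sup>2 \<partial>M)"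
      by (rule integral_mult_right_zero)
    finally show ?thesis .
  qed
  then have "(\<Sum>i<d. \<integral>\<omega>. stein d \<theta> s2 i (X \<omega>) \<partial>M)
      = (\<Sum>i<d. \<integral>\<omega>. (X \<omega> i - \<theta> i) * X \<omega> i / sqn d (X \<omega>) \<partial>M)
      - (\<Sum>i<d. s2 * (\<integral>\<omega>. (sqn d (X \<omega>) - 2 * (X \<omega> i)\<^sup>2) / (sqn d (X \<omega>))\<^sup>2 \<partial>M))"
    unfolding sum_subtractf[symmetric] by (intro sum.cong) auto
  moreover have "\<bar>- lam * a - - lam * b\<bar> = \<bar>lam\<bar> * \<bar>a - b\<bar>" for a b
    by (simp add: abs_mult[symmetric] right_diff_distrib abs_minus_commute)
  ultimately show ?thesis unfolding Bstar_eq by simp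
qed

lemma Bstar_formula:
  "Bstar M d S X Xz lam = \<bar>lam\<bar> * s2 * \<bar>\<Sum>i<d.
      (\<integral>\<omega>. (sqn d (Xz i i \<omega>) - 2 * (Xz i i \<omega> i)\<^sup>2) / (sqn d (Xz i i \<omega>))\<^sup>2 \<partial>M)
    - (\<integral>\<omega>. (sqn d (X \<omega>) - 2 * (X \<omega> i)\<^sup>2) / (sqn d (X \<omega>))\<^sup>2 \<partial>M)\<bar>"
proof -
  have pd: "(\<integral>\<omega>. pd (fl d lam) i i (W \<omega>) \<partial>M)
      = - lam * (\<integral>\<omega>. (sqn d (W \<omega>) - 2 * (W \<omega> i)\<^sup>2) / (sqn d (W \<omega>))\<^sup>2 \<partial>M)"
    if i: "i < d" and W: "W \<in> M \<rightarrow>\<^sub>M Rd d" "AE \<omega> in M. W \<omega> \<noteq> zvec d" for i W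
    using integral_pd_fl[OF W(1) i i W(2), of lam] by (simp only: curvature_eq if_True simp_thms)
  have "Bstar M d S X Xz lam = \<bar>s2 * (\<Sum>i<d. (\<integral>\<omega>. pd (fl d lam) i i (Xz i i \<omega>) \<partial>M) - (\<integral>\<omega>. pd (fl d lam) i i (X \<omega>) \<partial>M))\<bar>"
    unfolding Bstar_def sum_S ..
  also have "(\<Sum>i<d. (\<integral>\<omega>. pd (fl d lam) i i (Xz i i \<omega>) \<partial>M) - (\<integral>\<omega>. pd (fl d lam) i i (X \<omega>) \<partial>M))
     = - lam * (\<Sum>i<d. (\<integral>\<omega>. (sqn d (Xz i i \<omega>) - 2 * (Xz i i \<omega> i)\<^sup>2) / (sqn d (Xz i i \<omega>))\<^sup>2 \<partial>M)
    - (\<integral>\<omega>. (sqn d (X \<omega>) - 2 * (X \<omega> i)\<^sup>2) / (sqn d (X \<omega>))\<^sup>2 \<partial>M))"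
    unfolding sum_distrib_left
  proof (rule sum.cong[OF refl])
    fix i assume "i \<in> {..<d}"
    then have i: "i < d" by simp
    then have nz: "S i i \<noteq> 0" using S_eq[of i i] s2_pos by simp
    show "(\<integral>\<omega>. pd (fl d lam) i i (Xz i i \<omega>) \<partial>M) - (\<integral>\<omega>. pd (fl d lam) i i (X \<omega>) \<partial>M)
     = - lam * ((\<integral>\<omega>. (sqn d (Xz i i \<omega>) - 2 * (Xz i i \<omega> i)\<^sup>2) / (sqn d (Xz i i \<omega>))\<^sup>2 \<partial>M)
    - (\<integral>\<omega>. (sqn d (X \<omega>) - 2 * (X \<omega> i)\<^sup>2) / (sqn d (X \<omega>))\<^sup>2 \<partial>M))"
      unfolding pd[OF i Xz[OF i i nz] Xz_nonzero[OF i i nz]] pd[OF i X X_nonzero] by (simp add: algebra_simps)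
  qed
  finally show ?thesis using s2_pos by (simp add: abs_mult mult.commute mult.left_commute)
qed

text \<open>Without independence, centring against functions of the other coordinates has to come
  from the zero bias identity, applied to a field other than \<open>g0\<close>. The work lies in
  checking membership in \<open>Wz\<close>; the diagonal partial derivatives vanish, so the
  integrability demanded at the zero bias vectors is trivial.\<close>

lemma shrink_field_centered:
  assumes k: "k < d"
  shows "(\<integral>\<omega>. (X \<omega> k - \<theta> k) * (\<theta> k / ((\<theta> k)\<^sup>2 + sqn_not d k (X \<omega>))) \<partial>M) = 0"
proof (cases "\<theta> k = 0")
  case False
  let ?f = "shrink_field d (\<theta> k) k"
  note [measurable] = Xi[OF k]
  have "continuous_on (space (Rd d) - {zvec d}) (pd ?f i j)" if "i < d" "j < d" for i j
  proof -
    have "0 < (\<theta> k)\<^sup>2 + sqn_not d k x" for x using False by (simp add: add_pos_nonneg)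
    then have "continuous_on (space (Rd d) - {zvec d})
      (\<lambda>x. if i = k \<and> j \<noteq> k then - \<theta> k * (2 * x j) / ((\<theta> k)\<^sup>2 + sqn_not d k x)\<^sup>2 else 0)"
      by (cases "i = k \<and> j \<noteq> k")
         (auto intro!: continuous_intros continuous_on_component continuous_on_sqn_not simp: less_imp_neq[symmetric])
    then show ?thesis
      by (rule continuous_on_eq) (simp add: pd_shrink_field(2)[OF False that k])
  qed
  moreover have "integrable M (\<lambda>\<omega>. sqn d (?f (X \<omega>)))"
  proof -
    have e: "sqn d (?f x) = (\<theta> k / ((\<theta> k)\<^sup>2 + sqn_not d k x))\<^sup>2" for x
    proof -
      have "sqn d (?f x) = (\<Sum>i<d. if i = k then (\<theta> k / ((\<theta> k)\<^sup>2 + sqn_not d k x))\<^sup>2 else 0)"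
        unfolding sqn_def by (intro sum.cong) (auto simp: shrink_field_def)
      then show ?thesis using k by simp
    qed
    have "(\<theta> k / ((\<theta> k)\<^sup>2 + sqn_not d k x))\<^sup>2 \<le> (1 / \<bar>\<theta> k\<bar>)\<^sup>2" for x
      using power_mono[OF shrink_field_bound, of "\<theta> k" d k x 2] by (simp only: power2_abs abs_ge_zero)
    then show ?thesis unfolding e
      by (intro integrable_const_bound[where B = "(1 / \<bar>\<theta> k\<bar>)\<^sup>2"]) auto
  qed
  moreover have "(\<lambda>t. ?f (x(j := x j + t)) i) differentiable at 0" if "i < d" "j < d" for x i j
    using pd_shrink_field(1)[OF False that k] real_differentiable_def by blast
  moreover have "(\<lambda>\<omega>. ?f (X \<omega>) i) \<in> borel_measurable M" if "i < d" for i
    using that by (cases "i = k") (simp_all add: shrink_field_def)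
  moreover have pd0: "pd ?f i i x = 0" if "i < d" for i x
    using pd_shrink_field(2)[OF False that that k] by auto
  moreover have diag: "i = j" if "S i j \<noteq> 0" "i < d" "j < d" for i j
    using that S_eq[of i j] by (auto split: if_splits)
  ultimately have "Wz M d S X Xz ?f" unfolding Wz_def by (auto simp: pd0 dest!: diag)
  from zero_bias[OF this]
  have "(\<integral>\<omega>. (\<Sum>i<d. (X \<omega> i - \<theta> i) * ?f (X \<omega>) i) \<partial>M) = 0"
    unfolding sum_S by (simp add: pd0)
  moreover have "(\<Sum>i<d. (X \<omega> i - \<theta> i) * ?f (X \<omega>) i)
      = (X \<omega> k - \<theta> k) * (\<theta> k / ((\<theta> k)\<^sup>2 + sqn_not d k (X \<omega>)))" for \<omega>
  proof -
    have "(\<Sum>i<d. (X \<omega> i - \<theta> i) * ?f (X \<omega>) i)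
      = (\<Sum>i<d. if i = k then (X \<omega> k - \<theta> k) * (\<theta> k / ((\<theta> k)\<^sup>2 + sqn_not d k (X \<omega>))) else 0)"
      by (intro sum.cong) (auto simp: shrink_field_def)
    then show ?thesis using k by simp
  qed
  ultimately show ?thesis by simp
qed simp

end

section \<open>From bounds on nonnegative integrals to the covariance bound\<close>

lemma nn_integral_le_ennrealD:
  fixes f :: "'a \<Rightarrow> real"
  assumes [measurable]: "f \<in> borel_measurable M" and nonneg: "\<And>x. 0 \<le> f x"
    and le: "(\<integral>\<^sup>+x. ennreal (f x) \<partial>M) \<le> ennreal C" and nz: "\<not> (AE x in M. f x = 0)"
  shows "integrable M f" "(\<integral>x. f x \<partial>M) \<le> C" "0 \<le> C"
proof -
  show f: "integrable M f"
  proof (rule integrableI_bounded)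
    have "(\<integral>\<^sup>+x. ennreal (norm (f x)) \<partial>M) = (\<integral>\<^sup>+x. ennreal (f x) \<partial>M)" by (simp add: nonneg)
    also have "\<dots> < \<infinity>" using le by (rule order_le_less_trans) simp
    finally show "(\<integral>\<^sup>+x. ennreal (norm (f x)) \<partial>M) < \<infinity>" .
  qed measurable
  have "ennreal (\<integral>x. f x \<partial>M) \<le> ennreal C"
    using le nn_integral_eq_integral[OF f] nonneg by simp
  moreover have "0 < (\<integral>x. f x \<partial>M)"
    using nz integral_nonneg_eq_0_iff_AE[OF f] nonneg by (simp add: less_le)
  \<comment> \<open>A negative \<open>C\<close> is read as 0 by \<open>ennreal\<close>; it is ruled
    out because the integral of \<open>f\<close> is positive, \<open>f\<close> not being almost
    everywhere zero.\<close>
  ultimately have "(\<integral>x. f x \<partial>M) \<le> C \<and> 0 \<le> C"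
    by (cases "0 \<le> C") (auto simp: ennreal_neg ennreal_eq_0_iff)
  then show "(\<integral>x. f x \<partial>M) \<le> C" "0 \<le> C" by auto
qed

context isotropic_setting
begin

text \<open>Sharper than the stated bound in that \<open>C4\<close> does not multiply the squared
  norm of \<open>\<theta>\<close>. The signs of the constants are part of the conclusion since they
  are not assumed; they follow from the positive variance and the almost surely nonzero reduced
  norms.\<close>

lemma part1_bound:
  assumes P: "part1_moments M d Y \<theta> Cm4 C4 C8" and lam: "0 \<le> lam"
  shows "Bstar M d S X Xz lam \<le> lam * cov_sum M d Y \<theta>
    + lam * (sqrt Cm4 / (real d)\<^sup>2) * (6 * real d * s2 * sqrt C4 + 2 * real d * sqrt C8 + 6 * sqn d \<theta> * s2)"
    and "0 \<le> Cm4" "0 \<le> C4" "0 \<le> C8"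
proof -
  have w: "AE \<omega> in M. sqn_not d i (X \<omega>) \<noteq> 0"
    and Pu: "(\<integral>\<^sup>+\<omega>. ennreal ((real d / sqn_not d i (X \<omega>)) ^ 4) \<partial>M) \<le> ennreal Cm4"
    and P4: "(\<integral>\<^sup>+\<omega>. ennreal ((X \<omega> i - \<theta> i) ^ 4) \<partial>M) \<le> ennreal C4"
    and P8: "(\<integral>\<^sup>+\<omega>. ennreal ((X \<omega> i - \<theta> i) ^ 8) \<partial>M) \<le> ennreal C8" if "i < d" for i
    using P that unfolding part1_moments_def by blast+
  have ynz: "\<not> (AE \<omega> in M. (X \<omega> i - \<theta> i) ^ n = 0)" if i: "i < d" for i n
  proof
    assume "AE \<omega> in M. (X \<omega> i - \<theta> i) ^ n = 0"
    then have "AE \<omega> in M. (X \<omega> i - \<theta> i)\<^sup>2 = 0" by eventually_elim simp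
    then have "(\<integral>\<omega>. (X \<omega> i - \<theta> i)\<^sup>2 \<partial>M) = 0"
      using centered_square_integrable[OF i] by (simp add: integral_nonneg_eq_0_iff_AE)
    then show False using variance[OF i] s2_pos by simp
  qed
  have ym: "(\<lambda>\<omega>. (X \<omega> i - \<theta> i) ^ n) \<in> borel_measurable M" if "i < d" for i n
    using Xi[OF that] by measurable
  have y4: "integrable M (\<lambda>\<omega>. (X \<omega> i - \<theta> i) ^ 4)" "(\<integral>\<omega>. (X \<omega> i - \<theta> i) ^ 4 \<partial>M) \<le> C4" "0 \<le> C4"
    if "i < d" for i
    using nn_integral_le_ennrealD[OF ym[OF that] _ P4[OF that] ynz[OF that]] by simp_all
  have y8: "integrable M (\<lambda>\<omega>. (X \<omega> i - \<theta> i) ^ 8)" "(\<integral>\<omega>. (X \<omega> i - \<theta> i) ^ 8 \<partial>M) \<le> C8" "0 \<le> C8"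
    if "i < d" for i
    using nn_integral_le_ennrealD[OF ym[OF that] _ P8[OF that] ynz[OF that]] by simp_all
  show C4: "0 \<le> C4" by (rule y4(3)[OF d_pos])
  show "0 \<le> C8" by (rule y8(3)[OF d_pos])
  define f where "f i \<omega> = (real d / sqn_not d i (X \<omega>)) ^ 4" for i \<omega>
  have f: "f i \<omega> = real d ^ 4 * (1 / sqn_not d i (X \<omega>)) ^ 4" for i \<omega>
    by (simp add: f_def power_divide)
  have fD: "integrable M (f i)" "(\<integral>\<omega>. f i \<omega> \<partial>M) \<le> Cm4" "0 \<le> Cm4" if i: "i < d" for i
  proof -
    have "\<not> (AE \<omega> in M. f i \<omega> = 0)"
    proof
      assume "AE \<omega> in M. f i \<omega> = 0"
      then have "AE \<omega> in M. False" using w[OF i] by eventually_elim (use d_pos in \<open>simp add: f_def\<close>)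
      then show False by simp
    qed
    moreover have "f i \<in> borel_measurable M" unfolding f_def by measurable
    moreover have "0 \<le> f i \<omega>" for \<omega> by (simp add: f_def)
    moreover have "(\<integral>\<^sup>+\<omega>. ennreal (f i \<omega>) \<partial>M) \<le> ennreal Cm4" using Pu[OF i] by (simp only: f_def)
    ultimately show "integrable M (f i)" "(\<integral>\<omega>. f i \<omega> \<partial>M) \<le> Cm4" "0 \<le> Cm4"
      by (auto intro: nn_integral_le_ennrealD[of "f i" M Cm4])
  qed
  show Cm4: "0 \<le> Cm4" by (rule fD(3)[OF d_pos])
  \<comment> \<open>Chosen so that \<open>?Q^2 = Cm4 / d^4\<close> bounds the fourth moment of the
    inverse reduced norm.\<close>
  let ?Q = "sqrt Cm4 / (real d)\<^sup>2"
  have u4: "integrable M (\<lambda>\<omega>. (1 / sqn_not d i (X \<omega>)) ^ 4)" "(\<integral>\<omega>. (1 / sqn_not d i (X \<omega>)) ^ 4 \<partial>M) \<le> ?Q\<^sup>2"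
    if i: "i < d" for i
  proof -
    have e: "(1 / sqn_not d i (X \<omega>)) ^ 4 = f i \<omega> / real d ^ 4" for \<omega> using d_pos by (simp add: f)
    show "integrable M (\<lambda>\<omega>. (1 / sqn_not d i (X \<omega>)) ^ 4)"
      unfolding e using fD(1)[OF i] by simp
    have "(\<integral>\<omega>. (1 / sqn_not d i (X \<omega>)) ^ 4 \<partial>M) \<le> Cm4 / real d ^ 4"
      unfolding e using fD(2)[OF i] by (simp add: divide_right_mono)
    also have "\<dots> = ?Q\<^sup>2" using Cm4 by (simp add: power_divide square_square)
    finally show "(\<integral>\<omega>. (1 / sqn_not d i (X \<omega>)) ^ 4 \<partial>M) \<le> ?Q\<^sup>2" .
  qed
  have "\<bar>\<Sum>i<d. \<integral>\<omega>. stein d \<theta> s2 i (X \<omega>) \<partial>M\<bar>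
    \<le> (\<Sum>i<d. \<bar>(\<integral>\<omega>. (X \<omega> i - \<theta> i)\<^sup>2 / sqn_not d i (X \<omega>) \<partial>M) - s2 * (\<integral>\<omega>. 1 / sqn_not d i (X \<omega>) \<partial>M)\<bar>)
      + ?Q * (6 * real d * s2 * sqrt C4 + 2 * real d * sqrt C8 + 6 * sqn d \<theta> * s2)"
    using Cm4 by (intro stein_sum_bound X d_pos s2_pos w u4 y8(1,2) y4(2) variance centered_expectation
      shrink_field_centered) simp_all
  also have "(\<Sum>i<d. \<bar>(\<integral>\<omega>. (X \<omega> i - \<theta> i)\<^sup>2 / sqn_not d i (X \<omega>) \<partial>M) - s2 * (\<integral>\<omega>. 1 / sqn_not d i (X \<omega>) \<partial>M)\<bar>)
      = cov_sum M d Y \<theta>"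
    unfolding cov_sum_def cov_def by (intro sum.cong) (simp_all add: variance)
  finally have "\<bar>\<Sum>i<d. \<integral>\<omega>. stein d \<theta> s2 i (X \<omega>) \<partial>M\<bar> \<le> cov_sum M d Y \<theta>
      + ?Q * (6 * real d * s2 * sqrt C4 + 2 * real d * sqrt C8 + 6 * sqn d \<theta> * s2)" .
  then have "lam * \<bar>\<Sum>i<d. \<integral>\<omega>. stein d \<theta> s2 i (X \<omega>) \<partial>M\<bar> \<le> lam * (cov_sum M d Y \<theta>
      + ?Q * (6 * real d * s2 * sqrt C4 + 2 * real d * sqrt C8 + 6 * sqn d \<theta> * s2))"
    using lam by (rule mult_left_mono)
  then show "Bstar M d S X Xz lam \<le> lam * cov_sum M d Y \<theta>
    + lam * (sqrt Cm4 / (real d)\<^sup>2) * (6 * real d * s2 * sqrt C4 + 2 * real d * sqrt C8 + 6 * sqn d \<theta> * s2)"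
    unfolding Bstar_stein using lam by (simp add: distrib_left mult.assoc)
qed

lemma part1_bound_paper:
  assumes P: "part1_moments M d Y \<theta> Cm4 C4 C8" and lam: "0 \<le> lam"
  shows "Bstar M d S X Xz lam \<le> lam * cov_sum M d Y \<theta>
    + 6 * lam * sqrt Cm4 / (real d)\<^sup>2 * (real d * (s2 * sqrt C4 + sqrt C8 / 3) + sqn d \<theta> * (s2 + C4))"
proof -
  have "lam * (sqrt Cm4 / (real d)\<^sup>2) * (6 * real d * s2 * sqrt C4 + 2 * real d * sqrt C8 + 6 * sqn d \<theta> * s2)
      \<le> lam * (sqrt Cm4 / (real d)\<^sup>2) * (6 * (real d * (s2 * sqrt C4 + sqrt C8 / 3) + sqn d \<theta> * (s2 + C4)))"
    using part1_bound(2,3)[OF P lam] lam by (intro mult_left_mono) (simp_all add: algebra_simps)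
  also have "\<dots> = 6 * lam * sqrt Cm4 / (real d)\<^sup>2 * (real d * (s2 * sqrt C4 + sqrt C8 / 3) + sqn d \<theta> * (s2 + C4))"
    by simp
  finally show ?thesis using part1_bound(1)[OF P lam] by linarith
qed

end

subsection \<open>The largest eigenvalue as a Rayleigh quotient\<close>

text \<open>Elements of \<open>Rd d\<close> are functions on all of \<open>nat\<close>, constantly
  \<open>undefined\<close> from \<open>d\<close> on. The sphere is thus a closed subset of a product
  of intervals and one-point sets, which is compact by Tychonoff's theorem.\<close>

lemma compact_unit_sphere: "compact {x \<in> space (Rd d). sqn d x = 1}"
proof -
  define B :: "nat \<Rightarrow> real set" where "B i = (if i < d then {-1..1} else {undefined})" for i
  have "compact (PiE UNIV B)"
    using compactin_PiE[of "\<lambda>_::nat. euclideanreal" UNIV B]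
    by (simp add: B_def euclidean_product_topology compactin_euclidean_iff)
  moreover have "closed {x::rvec. sqn d x = 1}"
    unfolding sqn_def by (intro closed_Collect_eq continuous_intros continuous_on_component)
  ultimately have "compact (PiE UNIV B \<inter> {x. sqn d x = 1})" by (rule compact_Int_closed)
  also have "PiE UNIV B \<inter> {x. sqn d x = 1} = {x \<in> space (Rd d). sqn d x = 1}"
  proof -
    have "x i \<in> {-1..1}" if "sqn d x = 1" "i < d" for x :: rvec and i
      using component_le_sqn[OF that(2), of x] that(1) by (auto simp: abs_square_le_1 abs_le_iff)
    then show ?thesis
      by (auto simp: B_def Rd_def space_PiM PiE_def Pi_def extensional_def split: if_splits)
  qed
  finally show ?thesis .
qed

lemma quadratic_form_upd:
  fixes S :: "nat \<Rightarrow> nat \<Rightarrow> real"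
  assumes sym: "\<And>i j. i < d \<Longrightarrow> j < d \<Longrightarrow> S i j = S j i" and k: "k < d"
  shows "(\<Sum>i<d. \<Sum>j<d. (x(k := x k + t)) i * S i j * (x(k := x k + t)) j)
    = (\<Sum>i<d. \<Sum>j<d. x i * S i j * x j) + 2 * t * (\<Sum>j<d. S k j * x j) + t\<^sup>2 * S k k"
proof -
  define e where "e i = (if i = k then t else 0)" for i
  have x: "(x(k := x k + t)) i = x i + e i" for i by (simp add: e_def)
  have "(\<Sum>i<d. \<Sum>j<d. (x i + e i) * S i j * (x j + e j))
      = (\<Sum>i<d. \<Sum>j<d. x i * S i j * x j) + (\<Sum>i<d. \<Sum>j<d. x i * S i j * e j)
        + (\<Sum>i<d. \<Sum>j<d. e i * S i j * x j) + (\<Sum>i<d. \<Sum>j<d. e i * S i j * e j)"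
    by (simp add: sum.distrib[symmetric] algebra_simps)
  moreover have "(\<Sum>j<d. f j * e j) = t * f k" for f
    using k by (simp add: e_def if_distrib[of "\<lambda>a. _ * a"] mult.commute cong: if_cong)
  note e1 = this
  have "(\<Sum>i<d. \<Sum>j<d. x i * S i j * e j) = t * (\<Sum>j<d. S k j * x j)"
    unfolding e1 sum_distrib_left using sym k by (intro sum.cong) (auto simp: mult.commute)
  moreover have e2: "(\<Sum>i<d. \<Sum>j<d. e i * S i j * f j) = t * (\<Sum>j<d. S k j * f j)" for f
  proof -
    have "(\<Sum>i<d. \<Sum>j<d. e i * S i j * f j) = (\<Sum>i<d. (\<Sum>j<d. S i j * f j) * e i)"
      by (simp add: sum_distrib_left sum_distrib_right mult_ac)
    then show ?thesis unfolding e1 .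
  qed
  moreover have "(\<Sum>i<d. \<Sum>j<d. e i * S i j * e j) = t\<^sup>2 * S k k"
    by (simp only: e2[of e] e1[of "S k"]) (simp add: power2_eq_square)
  ultimately show ?thesis unfolding x by simp
qed

text \<open>A maximiser of the form on the compact sphere is an eigenvector, with the maximum as its
  eigenvalue. By homogeneity its maximality extends to all vectors, which makes variations of a
  single coordinate admissible without a constraint.\<close>

lemma rayleigh_le_largest_eigenvalue:
  fixes S :: "nat \<Rightarrow> nat \<Rightarrow> real"
  assumes sym: "\<And>i j. i < d \<Longrightarrow> j < d \<Longrightarrow> S i j = S j i" and d: "0 < d" and \<kappa>: "largest_eigenvalue d S \<kappa>"
  shows "(\<Sum>i<d. \<Sum>j<d. x i * S i j * x j) \<le> \<kappa> * sqn d x"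
proof -
  define q where "q x = (\<Sum>i<d. \<Sum>j<d. x i * S i j * x j)" for x :: rvec
  let ?U = "{x \<in> space (Rd d). sqn d x = 1}"
  have "(\<lambda>i\<in>{..<d}. if i = 0 then 1 else 0) \<in> ?U"
    using d by (simp add: Rd_def space_PiM sqn_def if_distrib[of "\<lambda>a. a\<^sup>2"] cong: if_cong)
  moreover have "continuous_on ?U q"
    unfolding q_def by (intro continuous_intros continuous_on_component)
  ultimately obtain u where u: "u \<in> ?U" "\<And>v. v \<in> ?U \<Longrightarrow> q v \<le> q u"
    using continuous_attains_sup[OF compact_unit_sphere, of d q] by blast
  have q_le: "q v \<le> q u * sqn d v" for v
  proof (cases "sqn d v = 0")
    case True
    then have "v i = 0" if "i < d" for i using component_le_sqn[OF that, of v] by simp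
    then show ?thesis using True by (simp add: q_def)
  next
    case False
    then have s: "0 < sqn d v" by (simp add: less_le)
    define v' where "v' = (\<lambda>i\<in>{..<d}. v i / sqrt (sqn d v))"
    have "sqn d v' = sqn d v / sqn d v"
    proof -
      have "sqn d v' = (\<Sum>i<d. (v i)\<^sup>2 / sqn d v)"
        unfolding sqn_def[of d v'] using s by (intro sum.cong) (simp_all add: v'_def power_divide)
      then show ?thesis by (simp add: sum_divide_distrib[symmetric] sqn_def[symmetric])
    qed
    then have "v' \<in> ?U" using s by (simp add: v'_def Rd_def space_PiM)
    then have "q v' \<le> q u" by (rule u(2))
    moreover have "q v' = q v / sqn d v"
    proof -
      have "q v' = (\<Sum>i<d. \<Sum>j<d. v i * S i j * v j / sqn d v)"
        unfolding q_def v'_def using s by (intro sum.cong refl) simp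
      then show ?thesis by (simp add: q_def sum_divide_distrib)
    qed
    ultimately show ?thesis using s by (simp add: divide_le_eq)
  qed
  have "(\<Sum>j<d. S k j * u j) = q u * u k" if k: "k < d" for k
  proof -
    \<comment> \<open>A quadratic in \<open>t\<close> that is nonnegative and vanishes at
      \<open>t = 0\<close> has no linear term; this is the \<open>k\<close>-th eigenvector
      equation.\<close>
    have "0 \<le> (q u - S k k) * t\<^sup>2 + 2 * (q u * u k - (\<Sum>j<d. S k j * u j)) * t + 0" for t
    proof -
      have "q (u(k := u k + t)) = q u + 2 * t * (\<Sum>j<d. S k j * u j) + t\<^sup>2 * S k k"
        unfolding q_def by (rule quadratic_form_upd[OF sym k])
      moreover have "q (u(k := u k + t)) \<le> q u * sqn d (u(k := u k + t))" by (rule q_le)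
      ultimately show ?thesis using u(1) unfolding sqn_upd[OF k] by (simp add: algebra_simps)
    qed
    then have "(q u * u k - (\<Sum>j<d. S k j * u j))\<^sup>2 \<le> (q u - S k k) * 0" by (rule quadratic_discriminant_le)
    then show ?thesis by simp
  qed
  then have "is_eigenvalue d S (q u)"
    unfolding is_eigenvalue_def using u(1) by (intro bexI[of _ u]) auto
  then have "q u \<le> \<kappa>" using \<kappa> by (simp add: largest_eigenvalue_def)
  then have "q u * sqn d x \<le> \<kappa> * sqn d x" by (intro mult_right_mono) auto
  then show ?thesis using q_le[of x] by (simp add: q_def)
qed

section \<open>The general risk bound\<close>

lemma sqdist_Slam:
  "sqdist d (Slam d lam x) \<theta>
    = sqdist d x \<theta> - 2 * lam * (\<Sum>i<d. (x i - \<theta> i) * x i / sqn d x) + lam\<^sup>2 * (1 / sqn d x)"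
proof -
  have "sqdist d (Slam d lam x) \<theta> = (\<Sum>i<d. (x i - \<theta> i)\<^sup>2 - 2 * lam * ((x i - \<theta> i) * x i / sqn d x)
      + lam\<^sup>2 * ((x i)\<^sup>2 / (sqn d x)\<^sup>2))"
  proof -
    have "(x i * (1 - lam / r) - \<theta> i)\<^sup>2 = (x i - \<theta> i)\<^sup>2 - 2 * lam * ((x i - \<theta> i) * x i / r) + lam\<^sup>2 * ((x i)\<^sup>2 / r\<^sup>2)" for i r
      \<comment> \<open>The expansion also holds at the origin, where all quotients are 0 and the
        estimator does not move the point.\<close>
      by (cases "r = 0") (simp_all add: field_simps power2_eq_square)
    then show ?thesis unfolding sqdist_def by (intro sum.cong) (simp_all add: Slam_def)
  qed
  also have "\<dots> = sqdist d x \<theta> - 2 * lam * (\<Sum>i<d. (x i - \<theta> i) * x i / sqn d x) + lam\<^sup>2 * (sqn d x / (sqn d x)\<^sup>2)"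
    unfolding sqdist_def sum.distrib sum_subtractf sum_distrib_left[symmetric] sum_divide_distrib[symmetric]
    by (simp add: sqn_def)
  finally show ?thesis by (simp add: power2_eq_square)
qed

context zero_bias_setting
begin

lemma risk_eq:
  "risk M d \<theta> X lam = (\<integral>\<omega>. sqdist d (X \<omega>) \<theta> \<partial>M)
    - 2 * lam * (\<Sum>i<d. \<integral>\<omega>. (X \<omega> i - \<theta> i) * X \<omega> i / sqn d (X \<omega>) \<partial>M) + lam\<^sup>2 * (\<integral>\<omega>. 1 / sqn d (X \<omega>) \<partial>M)"
proof -
  have D: "integrable M (\<lambda>\<omega>. sqdist d (X \<omega>) \<theta>)"
    unfolding sqdist_def using centered_square_integrable by (intro Bochner_Integration.integrable_sum) simp
  have "integrable M (\<lambda>\<omega>. \<Sum>i<d. (X \<omega> i - \<theta> i) * X \<omega> i / sqn d (X \<omega>))"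
    using score_integrable by (intro Bochner_Integration.integrable_sum) simp
  then have "risk M d \<theta> X lam = (\<integral>\<omega>. sqdist d (X \<omega>) \<theta> \<partial>M)
    - 2 * lam * (\<integral>\<omega>. (\<Sum>i<d. (X \<omega> i - \<theta> i) * X \<omega> i / sqn d (X \<omega>)) \<partial>M) + lam\<^sup>2 * (\<integral>\<omega>. 1 / sqn d (X \<omega>) \<partial>M)"
    unfolding risk_def sqdist_Slam
    using D inverse_sqn_integrable
    by (simp only: Bochner_Integration.integral_add Bochner_Integration.integral_diff integral_mult_right_zero
        integrable_mult_right Bochner_Integration.integrable_diff)
  then show ?thesis using score_integrable by (simp add: Bochner_Integration.integral_sum)
qed

text \<open>Pointwise the weighted divergence of \<open>f\<close> is \<open>- lam / R\<close> times
  \<open>trace d S - 2 * (x^T S x) / R\<close>, and the Rayleigh quotient is at most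
  \<open>\<kappa>\<close>.\<close>

lemma hessian_term_le:
  assumes \<kappa>: "largest_eigenvalue d S \<kappa>" and lam: "0 \<le> lam"
  shows "(\<Sum>i<d. \<Sum>j<d. S i j * (\<integral>\<omega>. pd (fl d lam) i j (X \<omega>) \<partial>M))
    \<le> - lam * (trace d S - 2 * \<kappa>) * (\<integral>\<omega>. 1 / sqn d (X \<omega>) \<partial>M)"
proof -
  let ?E = "\<integral>\<omega>. 1 / sqn d (X \<omega>) \<partial>M"
  define h where "h i j = (\<integral>\<omega>. X \<omega> i * X \<omega> j / (sqn d (X \<omega>))\<^sup>2 \<partial>M)" for i j
  have pd: "(\<integral>\<omega>. pd (fl d lam) i j (X \<omega>) \<partial>M) = - lam * ((if i = j then 1 else 0) * ?E - 2 * h i j)"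
    if "i < d" "j < d" for i j
  proof -
    have "(\<integral>\<omega>. (if i = j then 1 else 0) * (1 / sqn d (X \<omega>)) - 2 * (X \<omega> i * X \<omega> j / (sqn d (X \<omega>))\<^sup>2) \<partial>M)
        = (if i = j then 1 else 0) * ?E - 2 * h i j"
      unfolding h_def
      using Bochner_Integration.integral_diff[OF integrable_mult_right[OF inverse_sqn_integrable]
          integrable_mult_right[OF hessian_integrable[OF that]]]
      by (simp only: integral_mult_right_zero)
    then show ?thesis
      using integral_pd_fl[OF X that X_nonzero, of lam] by (simp add: mult.assoc)
  qed
  have sym: "S i j = S j i" if "i < d" "j < d" for i j
    using covariance[OF that] covariance[OF that(2,1)] by (simp add: mult.commute)
  have "(\<Sum>i<d. \<Sum>j<d. S i j * h i j) \<le> \<kappa> * ?E"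
  proof -
    have "(\<Sum>i<d. \<Sum>j<d. S i j * h i j) = (\<integral>\<omega>. (\<Sum>i<d. \<Sum>j<d. S i j * (X \<omega> i * X \<omega> j / (sqn d (X \<omega>))\<^sup>2)) \<partial>M)"
      using hessian_integrable unfolding h_def
      by (subst Bochner_Integration.integral_sum, intro Bochner_Integration.integrable_sum integrable_mult_right, simp,
          intro sum.cong refl, subst Bochner_Integration.integral_sum, intro integrable_mult_right, simp,
          simp only: integral_mult_right_zero)
    also have "\<dots> \<le> (\<integral>\<omega>. \<kappa> * (1 / sqn d (X \<omega>)) \<partial>M)"
    proof (rule integral_mono_AE)
      show "integrable M (\<lambda>\<omega>. \<Sum>i<d. \<Sum>j<d. S i j * (X \<omega> i * X \<omega> j / (sqn d (X \<omega>))\<^sup>2))"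
        using hessian_integrable by (intro Bochner_Integration.integrable_sum integrable_mult_right) simp
      show "integrable M (\<lambda>\<omega>. \<kappa> * (1 / sqn d (X \<omega>)))" by (rule integrable_mult_right[OF inverse_sqn_integrable])
      show "AE \<omega> in M. (\<Sum>i<d. \<Sum>j<d. S i j * (X \<omega> i * X \<omega> j / (sqn d (X \<omega>))\<^sup>2)) \<le> \<kappa> * (1 / sqn d (X \<omega>))"
      proof (rule AE_I2)
        fix \<omega>
        have "(\<Sum>i<d. \<Sum>j<d. S i j * (X \<omega> i * X \<omega> j / (sqn d (X \<omega>))\<^sup>2))
            = (\<Sum>i<d. \<Sum>j<d. X \<omega> i * S i j * X \<omega> j) / (sqn d (X \<omega>))\<^sup>2"
          by (simp add: sum_divide_distrib mult_ac)
        also have "\<dots> \<le> \<kappa> * sqn d (X \<omega>) / (sqn d (X \<omega>))\<^sup>2"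
          by (intro divide_right_mono rayleigh_le_largest_eigenvalue sym d_pos \<kappa>) simp_all
        also have "\<dots> = \<kappa> * (1 / sqn d (X \<omega>))" by (simp add: power2_eq_square)
        finally show "(\<Sum>i<d. \<Sum>j<d. S i j * (X \<omega> i * X \<omega> j / (sqn d (X \<omega>))\<^sup>2)) \<le> \<kappa> * (1 / sqn d (X \<omega>))" .
      qed
    qed
    finally show ?thesis by (simp only: integral_mult_right_zero)
  qed
  moreover have "(\<Sum>i<d. \<Sum>j<d. S i j * (\<integral>\<omega>. pd (fl d lam) i j (X \<omega>) \<partial>M))
      = - lam * (trace d S * ?E - 2 * (\<Sum>i<d. \<Sum>j<d. S i j * h i j))"
  proof -
    have "(\<Sum>i<d. \<Sum>j<d. S i j * (\<integral>\<omega>. pd (fl d lam) i j (X \<omega>) \<partial>M))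
      = (\<Sum>i<d. \<Sum>j<d. - lam * ((if j = i then S i i else 0) * ?E - 2 * (S i j * h i j)))"
      by (intro sum.cong refl) (auto simp: pd algebra_simps)
    also have "\<dots> = - lam * ((\<Sum>i<d. \<Sum>j<d. if j = i then S i i else 0) * ?E - 2 * (\<Sum>i<d. \<Sum>j<d. S i j * h i j))"
      by (simp only: sum_distrib_left[symmetric] sum_subtractf sum_distrib_right[symmetric])
    also have "(\<Sum>i<d. \<Sum>j<d. if j = i then S i i else 0) = trace d S" by (simp add: trace_def)
    finally show ?thesis .
  qed
  ultimately show ?thesis
    using mult_left_mono[of "\<Sum>i<d. \<Sum>j<d. S i j * h i j" "\<kappa> * ?E" "2 * lam"] lam by (simp add: algebra_simps)
qed

lemma risk_le:
  assumes \<kappa>: "largest_eigenvalue d S \<kappa>" and lam: "0 \<le> lam"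
  shows "risk M d \<theta> X lam \<le> (\<integral>\<omega>. sqdist d (X \<omega>) \<theta> \<partial>M)
    + (\<integral>\<omega>. lam / sqn d (X \<omega>) * (lam - 2 * (trace d S - 2 * \<kappa>)) \<partial>M) + 2 * Bstar M d S X Xz lam"
proof -
  let ?E = "\<integral>\<omega>. 1 / sqn d (X \<omega>) \<partial>M"
  have "(\<integral>\<omega>. lam / sqn d (X \<omega>) * (lam - 2 * (trace d S - 2 * \<kappa>)) \<partial>M)
      = (\<integral>\<omega>. (lam * (lam - 2 * (trace d S - 2 * \<kappa>))) * (1 / sqn d (X \<omega>)) \<partial>M)"
    by (simp add: mult.commute)
  also have "\<dots> = lam * (lam - 2 * (trace d S - 2 * \<kappa>)) * ?E" by (rule integral_mult_right_zero)
  finally have e: "(\<integral>\<omega>. lam / sqn d (X \<omega>) * (lam - 2 * (trace d S - 2 * \<kappa>)) \<partial>M)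
      = lam * (lam - 2 * (trace d S - 2 * \<kappa>)) * ?E" .
  show ?thesis
    unfolding risk_eq e Bstar_eq
    using hessian_term_le[OF \<kappa> lam]
      abs_ge_self[of "- lam * (\<Sum>i<d. \<integral>\<omega>. (X \<omega> i - \<theta> i) * X \<omega> i / sqn d (X \<omega>) \<partial>M)
        - (\<Sum>i<d. \<Sum>j<d. S i j * (\<integral>\<omega>. pd (fl d lam) i j (X \<omega>) \<partial>M))"]
    by (simp add: algebra_simps power2_eq_square)
qed

end

subsection \<open>Independent components\<close>

lemma (in prob_space) indep_coordinate:
  assumes Y: "Y \<in> M \<rightarrow>\<^sub>M Rd d" and ind: "indep_vars (\<lambda>_. borel) (\<lambda>i \<omega>. Y \<omega> i) {..<d}" and i: "i < d"
  shows "indep_var borel (\<lambda>\<omega>. sqn_not d i (Xof d Y \<theta> \<omega>)) borel (\<lambda>\<omega>. Xof d Y \<theta> \<omega> i)"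
proof -
  let ?J = "{..<d} - {i}"
  have "indep_var (PiM ?J (\<lambda>_. borel)) (\<lambda>\<omega>. restrict (\<lambda>j. Y \<omega> j) ?J) (PiM {i} (\<lambda>_. borel)) (\<lambda>\<omega>. restrict (\<lambda>j. Y \<omega> j) {i})"
    using i by (intro indep_var_restrict[OF ind]) auto
  moreover have "(\<lambda>z. \<Sum>j\<in>?J. (z j + \<theta> j)\<^sup>2) \<in> borel_measurable (PiM ?J (\<lambda>_. borel :: real measure))"
    by (intro borel_measurable_sum borel_measurable_power borel_measurable_add measurable_component_singleton) auto
  moreover have "(\<lambda>z. z i + \<theta> i) \<in> borel_measurable (PiM {i} (\<lambda>_. borel :: real measure))"
    by (intro borel_measurable_add measurable_component_singleton) auto
  ultimately have "indep_var borel ((\<lambda>z. \<Sum>j\<in>?J. (z j + \<theta> j)\<^sup>2) \<circ> (\<lambda>\<omega>. restrict (\<lambda>j. Y \<omega> j) ?J))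
      borel ((\<lambda>z. z i + \<theta> i) \<circ> (\<lambda>\<omega>. restrict (\<lambda>j. Y \<omega> j) {i}))"
    by (rule indep_var_compose)
  moreover have "(\<lambda>z. \<Sum>j\<in>?J. (z j + \<theta> j)\<^sup>2) \<circ> (\<lambda>\<omega>. restrict (\<lambda>j. Y \<omega> j) ?J) = (\<lambda>\<omega>. sqn_not d i (Xof d Y \<theta> \<omega>))"
    by (auto simp: sqn_not_def Xof_component fun_eq_iff intro!: sum.cong)
  moreover have "(\<lambda>z. z i + \<theta> i) \<circ> (\<lambda>\<omega>. restrict (\<lambda>j. Y \<omega> j) {i}) = (\<lambda>\<omega>. Xof d Y \<theta> \<omega> i)"
    using i by (auto simp: Xof_component fun_eq_iff)
  ultimately show ?thesis by simp
qed

text \<open>Freezes \<open>U\<close> while \<open>V\<close> is integrated, so that a one-dimensional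
  identity for \<open>V\<close> can be applied at each fixed value of \<open>U\<close>.\<close>

lemma (in prob_space) indep_var_fubini:
  fixes F :: "real \<times> real \<Rightarrow> real"
  assumes ind: "indep_var borel U borel V" and [measurable]: "F \<in> borel_measurable (borel \<Otimes>\<^sub>M borel)"
    and F: "integrable M (\<lambda>\<omega>. F (U \<omega>, V \<omega>))"
  shows "integrable M (\<lambda>\<omega>. \<integral>\<omega>'. F (U \<omega>, V \<omega>') \<partial>M)"
    and "(\<integral>\<omega>. F (U \<omega>, V \<omega>) \<partial>M) = (\<integral>\<omega>. (\<integral>\<omega>'. F (U \<omega>, V \<omega>') \<partial>M) \<partial>M)"
proof -
  have [measurable]: "U \<in> borel_measurable M" "V \<in> borel_measurable M"
    using ind by (auto dest: indep_var_rv1 indep_var_rv2)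
  let ?U = "distr M borel U" and ?V = "distr M borel V"
  interpret U: prob_space ?U by (rule prob_space_distr) measurable
  interpret V: prob_space ?V by (rule prob_space_distr) measurable
  interpret pair_sigma_finite ?U ?V ..
  have eq: "?U \<Otimes>\<^sub>M ?V = distr M (borel \<Otimes>\<^sub>M borel) (\<lambda>\<omega>. (U \<omega>, V \<omega>))"
    using ind unfolding indep_var_distribution_eq by simp
  have int: "integrable (?U \<Otimes>\<^sub>M ?V) F" unfolding eq using F by (subst integrable_distr_eq) auto
  have inner: "(\<integral>v. F (a, v) \<partial>?V) = (\<integral>\<omega>'. F (a, V \<omega>') \<partial>M)" for a
    by (rule integral_distr) measurable
  have "integrable ?U (\<lambda>a. \<integral>v. F (a, v) \<partial>?V)" using int by (rule integrable_fst')
  then show "integrable M (\<lambda>\<omega>. \<integral>\<omega>'. F (U \<omega>, V \<omega>') \<partial>M)"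
    unfolding inner by (subst (asm) integrable_distr_eq) auto
  have "(\<integral>\<omega>. F (U \<omega>, V \<omega>) \<partial>M) = integral\<^sup>L (?U \<Otimes>\<^sub>M ?V) F"
    unfolding eq by (subst integral_distr) auto
  also have "\<dots> = (\<integral>a. (\<integral>v. F (a, v) \<partial>?V) \<partial>?U)" using int by (rule integral_fst'[symmetric])
  also have "\<dots> = (\<integral>\<omega>. (\<integral>\<omega>'. F (U \<omega>, V \<omega>') \<partial>M) \<partial>M)"
    unfolding inner by (subst integral_distr) auto
  finally show "(\<integral>\<omega>. F (U \<omega>, V \<omega>) \<partial>M) = (\<integral>\<omega>. (\<integral>\<omega>'. F (U \<omega>, V \<omega>') \<partial>M) \<partial>M)" .
qed

section \<open>Regularity of the function x / (w + x^2)\<close>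

lemma abs_cont_on_lipschitz:
  fixes f :: "real \<Rightarrow> real"
  assumes K: "\<And>x y. \<bar>f y - f x\<bar> \<le> K * \<bar>y - x\<bar>"
  shows "abs_cont_on a b f"
  unfolding abs_cont_on_def
proof (intro allI impI)
  fix \<epsilon> :: real assume \<epsilon>: "0 < \<epsilon>"
  have K0: "0 \<le> K" using K[of 1 0] by simp
  show "\<exists>\<delta>>0. \<forall>(n::nat) (u::nat \<Rightarrow> real) v. (\<forall>k<n. a \<le> u k \<and> u k \<le> v k \<and> v k \<le> b) \<and>
      (\<forall>k<n. \<forall>l<n. k < l \<longrightarrow> v k \<le> u l) \<and> (\<Sum>k<n. v k - u k) < \<delta> \<longrightarrow> (\<Sum>k<n. \<bar>f (v k) - f (u k)\<bar>) < \<epsilon>"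
  \<comment> \<open>The denominator \<open>K + 1\<close> also covers \<open>K = 0\<close>.\<close>
  proof (intro exI[of _ "\<epsilon> / (K + 1)"] conjI allI impI)
    show "0 < \<epsilon> / (K + 1)" using \<epsilon> K0 by simp
    fix n :: nat and u v :: "nat \<Rightarrow> real"
    assume *: "(\<forall>k<n. a \<le> u k \<and> u k \<le> v k \<and> v k \<le> b) \<and>
      (\<forall>k<n. \<forall>l<n. k < l \<longrightarrow> v k \<le> u l) \<and> (\<Sum>k<n. v k - u k) < \<epsilon> / (K + 1)"
    have "(\<Sum>k<n. \<bar>f (v k) - f (u k)\<bar>) \<le> (\<Sum>k<n. K * (v k - u k))"
    proof (rule sum_mono)
      fix k assume "k \<in> {..<n}"
      then have "u k \<le> v k" using * by simp
      then show "\<bar>f (v k) - f (u k)\<bar> \<le> K * (v k - u k)" using K[of "v k" "u k"] by simp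
    qed
    also have "\<dots> = K * (\<Sum>k<n. v k - u k)" by (simp add: sum_distrib_left)
    also have "\<dots> \<le> K * (\<epsilon> / (K + 1))" using * K0 by (intro mult_left_mono) auto
    also have "\<dots> < \<epsilon>" using \<epsilon> K0 by (simp add: field_simps)
    finally show "(\<Sum>k<n. \<bar>f (v k) - f (u k)\<bar>) < \<epsilon>" .
  qed
qed

lemma curvature_bound:
  fixes w x :: real
  assumes w: "0 < w"
  shows "\<bar>(w - x\<^sup>2) / (w + x\<^sup>2)\<^sup>2\<bar> \<le> 1 / w"
proof -
  have R: "0 < w + x\<^sup>2" using w by (simp add: add_pos_nonneg)
  have "\<bar>(w - x\<^sup>2) / (w + x\<^sup>2)\<^sup>2\<bar> = \<bar>w - x\<^sup>2\<bar> / (w + x\<^sup>2)\<^sup>2" by (simp add: abs_divide)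
  also have "\<dots> \<le> (w + x\<^sup>2) / (w + x\<^sup>2)\<^sup>2"
    using w by (intro divide_right_mono) (auto simp: abs_le_iff)
  also have "\<dots> = 1 / (w + x\<^sup>2)" using R by (simp add: power2_eq_square)
  also have "\<dots> \<le> 1 / w" using w R by (intro divide_left_mono) auto
  finally show ?thesis .
qed

text \<open>\<open>p\<close> and \<open>q\<close> stand for squares of arguments. The constant
  \<open>3 / w^2\<close> is the absolute derivative of \<open>(w - p) / (w + p)^2\<close> at
  \<open>p = 0\<close>. In the proof \<open>?c\<close> is \<open>(w + p) * (w + q)\<close>, which
  dominates both \<open>w^2\<close> and a third of the numerator.\<close>

lemma curvature_difference:
  fixes w p q :: real
  assumes w: "0 < w" and p: "0 \<le> p" and q: "0 \<le> q"
  shows "\<bar>(w - p) / (w + p)\<^sup>2 - (w - q) / (w + q)\<^sup>2\<bar> \<le> 3 / w\<^sup>2 * \<bar>p - q\<bar>"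
proof -
  let ?P = "(w + p)\<^sup>2 * (w + q)\<^sup>2" and ?c = "w\<^sup>2 + w * (p + q) + p * q"
  have pos: "0 < w + p" "0 < w + q" using w p q by auto
  then have P: "0 < ?P" by simp
  have c: "?P = ?c\<^sup>2" by (simp add: power2_eq_square algebra_simps)
  have cw: "w\<^sup>2 \<le> ?c" using w p q by simp
  have "\<bar>3 * w\<^sup>2 + w * (p + q) - p * q\<bar> * w\<^sup>2 \<le> 3 * ?c * ?c"
  proof (rule mult_mono[OF _ cw])
    show "\<bar>3 * w\<^sup>2 + w * (p + q) - p * q\<bar> \<le> 3 * ?c"
      using w p q by (simp add: abs_le_iff add_nonneg_nonneg)
  qed (use w p q in auto)
  then have "\<bar>3 * w\<^sup>2 + w * (p + q) - p * q\<bar> * w\<^sup>2 \<le> 3 * ?P"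
    unfolding c power2_eq_square[of ?c] mult.assoc .
  then have "\<bar>3 * w\<^sup>2 + w * (p + q) - p * q\<bar> / ?P \<le> 3 / w\<^sup>2"
    using P w by (simp add: divide_simps mult.commute)
  then have "\<bar>q - p\<bar> * (\<bar>3 * w\<^sup>2 + w * (p + q) - p * q\<bar> / ?P) \<le> \<bar>q - p\<bar> * (3 / w\<^sup>2)"
    by (intro mult_left_mono) auto
  moreover have "(w - p) / (w + p)\<^sup>2 - (w - q) / (w + q)\<^sup>2 = (q - p) * (3 * w\<^sup>2 + w * (p + q) - p * q) / ?P"
  proof -
    have "(w - p) / (w + p)\<^sup>2 - (w - q) / (w + q)\<^sup>2 = ((w - p) * (w + q)\<^sup>2 - (w - q) * (w + p)\<^sup>2) / ?P"
      using pos by (subst diff_frac_eq) auto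
    also have "(w - p) * (w + q)\<^sup>2 - (w - q) * (w + p)\<^sup>2 = (q - p) * (3 * w\<^sup>2 + w * (p + q) - p * q)"
      by (simp add: power2_eq_square algebra_simps)
    finally show ?thesis .
  qed
  ultimately show ?thesis by (simp add: abs_mult abs_minus_commute mult.commute)
qed

lemma shrink_deriv:
  fixes w x :: real
  assumes w: "0 < w"
  shows "((\<lambda>x. x / (w + x\<^sup>2)) has_real_derivative (w - x\<^sup>2) / (w + x\<^sup>2)\<^sup>2) (at x)"
proof -
  have "0 < w + x\<^sup>2" using w by (simp add: add_pos_nonneg)
  then show ?thesis by (auto intro!: derivative_eq_intros simp: power2_eq_square)
qed

lemma shrink_lipschitz:
  fixes w x y :: real
  assumes w: "0 < w"
  shows "\<bar>y / (w + y\<^sup>2) - x / (w + x\<^sup>2)\<bar> \<le> 1 / w * \<bar>y - x\<bar>"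
  using field_differentiable_bound[of UNIV "\<lambda>x. x / (w + x\<^sup>2)" "\<lambda>x. (w - x\<^sup>2) / (w + x\<^sup>2)\<^sup>2" "1 / w" y x]
    shrink_deriv[OF w] curvature_bound[OF w] by simp

section \<open>Stein's term for independent components\<close>

locale indep_setting = prob_space N for N :: "'b measure" +
  fixes d :: nat and Y :: "'b \<Rightarrow> rvec" and \<theta> :: rvec and s2 Cm2 :: real
  assumes Y [measurable]: "Y \<in> N \<rightarrow>\<^sub>M Rd d" and iso: "iso_indep N d Y s2" and s2: "0 < s2"
    and w: "\<And>i. i < d \<Longrightarrow> AE \<omega> in N. sqn_not d i (Xof d Y \<theta> \<omega>) \<noteq> 0"
    and nn: "\<And>i. i < d \<Longrightarrow> (\<integral>\<^sup>+\<omega>. ennreal ((real d / sqn_not d i (Xof d Y \<theta> \<omega>))\<^sup>2) \<partial>N) \<le> ennreal Cm2"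
begin

abbreviation W where "W \<equiv> Xof d Y \<theta>"

lemma W [measurable]: "W \<in> N \<rightarrow>\<^sub>M Rd d" by (rule measurable_Xof[OF Y])

lemma Wi: "i < d \<Longrightarrow> (\<lambda>\<omega>. W \<omega> i) \<in> borel_measurable N" by (rule measurable_Rd_component[OF W])

lemma Yi: "i < d \<Longrightarrow> (\<lambda>\<omega>. Y \<omega> i) \<in> borel_measurable N" by (rule measurable_Rd_component[OF Y])

lemma centered: "i < d \<Longrightarrow> W \<omega> i - \<theta> i = Y \<omega> i" by (simp add: Xof_component)

lemma Y2: "i < d \<Longrightarrow> integrable N (\<lambda>\<omega>. (Y \<omega> i)\<^sup>2)" "i < d \<Longrightarrow> (\<integral>\<omega>. (Y \<omega> i)\<^sup>2 \<partial>N) = s2"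
  and Y1: "i < d \<Longrightarrow> integrable N (\<lambda>\<omega>. Y \<omega> i)" "i < d \<Longrightarrow> (\<integral>\<omega>. Y \<omega> i \<partial>N) = 0"
proof -
  assume i: "i < d"
  show y2: "integrable N (\<lambda>\<omega>. (Y \<omega> i)\<^sup>2)" and "(\<integral>\<omega>. Y \<omega> i \<partial>N) = 0"
    using iso i by (auto simp: iso_indep_def)
  show "(\<integral>\<omega>. (Y \<omega> i)\<^sup>2 \<partial>N) = s2"
    using iso i by (auto simp: iso_indep_def power2_eq_square)
  show "integrable N (\<lambda>\<omega>. Y \<omega> i)"
    using integrable_power_mono[OF Yi[OF i] y2, of 1] by simp
qed

lemma wpos: "i < d \<Longrightarrow> AE \<omega> in N. 0 < sqn_not d i (W \<omega>)"
  using w[of i] by (auto elim!: eventually_mono simp: less_le)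

lemma u2:
  assumes i: "i < d"
  shows "integrable N (\<lambda>\<omega>. (1 / sqn_not d i (W \<omega>))\<^sup>2)" "(\<integral>\<omega>. (1 / sqn_not d i (W \<omega>))\<^sup>2 \<partial>N) \<le> Cm2 / (real d)\<^sup>2"
    "0 \<le> Cm2"
proof -
  have d: "0 < real d" using i by simp
  have e: "(1 / sqn_not d i (W \<omega>))\<^sup>2 = (real d / sqn_not d i (W \<omega>))\<^sup>2 / (real d)\<^sup>2" for \<omega>
    using d by (simp add: power_divide)
  have "\<not> (AE \<omega> in N. (real d / sqn_not d i (W \<omega>))\<^sup>2 = 0)"
  proof
    assume "AE \<omega> in N. (real d / sqn_not d i (W \<omega>))\<^sup>2 = 0"
    then have "AE \<omega> in N. False" using w[OF i] by eventually_elim (use d in simp)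
    then show False by simp
  qed
  note D = nn_integral_le_ennrealD[OF _ _ nn[OF i] this]
  have "integrable N (\<lambda>\<omega>. (real d / sqn_not d i (W \<omega>))\<^sup>2)" "(\<integral>\<omega>. (real d / sqn_not d i (W \<omega>))\<^sup>2 \<partial>N) \<le> Cm2"
    by (rule D; simp)+
  then show "integrable N (\<lambda>\<omega>. (1 / sqn_not d i (W \<omega>))\<^sup>2)" "(\<integral>\<omega>. (1 / sqn_not d i (W \<omega>))\<^sup>2 \<partial>N) \<le> Cm2 / (real d)\<^sup>2"
    unfolding e by (simp_all add: divide_right_mono)
  show "0 \<le> Cm2" by (rule D; simp)
qed

lemma u1: "i < d \<Longrightarrow> integrable N (\<lambda>\<omega>. 1 / sqn_not d i (W \<omega>))"
  using integrable_power_mono[of "\<lambda>\<omega>. 1 / sqn_not d i (W \<omega>)" 2 1] u2(1)[of i] by simp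

lemma indep: "i < d \<Longrightarrow> indep_var borel (\<lambda>\<omega>. sqn_not d i (W \<omega>)) borel (\<lambda>\<omega>. W \<omega> i)"
  using iso by (intro indep_coordinate Y) (auto simp: iso_indep_def)

lemma indep_product:
  fixes F G :: "real \<Rightarrow> real"
  assumes i: "i < d" and m: "F \<in> borel_measurable borel" "G \<in> borel_measurable borel"
    and int: "integrable N (\<lambda>\<omega>. F (W \<omega> i))" "integrable N (\<lambda>\<omega>. G (sqn_not d i (W \<omega>)))"
  shows "integrable N (\<lambda>\<omega>. F (W \<omega> i) * G (sqn_not d i (W \<omega>)))"
    "(\<integral>\<omega>. F (W \<omega> i) * G (sqn_not d i (W \<omega>)) \<partial>N) = (\<integral>\<omega>. F (W \<omega> i) \<partial>N) * (\<integral>\<omega>. G (sqn_not d i (W \<omega>)) \<partial>N)"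
proof -
  have iv: "indep_var borel (\<lambda>\<omega>. G (sqn_not d i (W \<omega>))) borel (\<lambda>\<omega>. F (W \<omega> i))"
    using indep_var_compose[OF indep[OF i] m(2,1)] by (simp add: comp_def)
  show "integrable N (\<lambda>\<omega>. F (W \<omega> i) * G (sqn_not d i (W \<omega>)))"
    using indep_var_integrable[OF iv int(2,1)] by (simp add: mult.commute)
  show "(\<integral>\<omega>. F (W \<omega> i) * G (sqn_not d i (W \<omega>)) \<partial>N) = (\<integral>\<omega>. F (W \<omega> i) \<partial>N) * (\<integral>\<omega>. G (sqn_not d i (W \<omega>)) \<partial>N)"
    using indep_var_lebesgue_integral[OF iv int(2,1)] by (simp add: mult.commute)
qed

text \<open>Both the covariance and the linear term reduce to products of expectations; the centring
  here comes from independence instead of zero bias vectors.\<close>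

lemma stein_indep:
  assumes i: "i < d"
  shows "integrable N (\<lambda>\<omega>. stein d \<theta> s2 i (W \<omega>))"
    "integrable N (\<lambda>\<omega>. (W \<omega> i - \<theta> i)\<^sup>2 / sqn_not d i (W \<omega>) * kap (\<theta> i) (W \<omega> i) (sqn_not d i (W \<omega>)))"
    "integrable N (\<lambda>\<omega>. rad (W \<omega> i) (sqn_not d i (W \<omega>)))"
    "(\<integral>\<omega>. stein d \<theta> s2 i (W \<omega>) \<partial>N)
      = s2 * (\<integral>\<omega>. rad (W \<omega> i) (sqn_not d i (W \<omega>)) \<partial>N)
        - (\<integral>\<omega>. (W \<omega> i - \<theta> i)\<^sup>2 / sqn_not d i (W \<omega>) * kap (\<theta> i) (W \<omega> i) (sqn_not d i (W \<omega>)) \<partial>N)"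
proof -
  have i2: "integrable N (\<lambda>\<omega>. (W \<omega> i - \<theta> i)\<^sup>2)" "(\<integral>\<omega>. (W \<omega> i - \<theta> i)\<^sup>2 \<partial>N) = s2"
    and i1: "integrable N (\<lambda>\<omega>. W \<omega> i - \<theta> i)" "(\<integral>\<omega>. W \<omega> i - \<theta> i \<partial>N) = 0"
    using Y2[OF i] Y1[OF i] by (simp_all add: centered[OF i])
  have b: "integrable N (\<lambda>\<omega>. \<theta> i / ((\<theta> i)\<^sup>2 + sqn_not d i (W \<omega>)))"
    by (rule integrable_const_bound[where B = "1 / \<bar>\<theta> i\<bar>"]) (use shrink_field_bound in auto)
  have yu: "integrable N (\<lambda>\<omega>. (W \<omega> i - \<theta> i)\<^sup>2 / sqn_not d i (W \<omega>))"
    "(\<integral>\<omega>. (W \<omega> i - \<theta> i)\<^sup>2 / sqn_not d i (W \<omega>) \<partial>N) = s2 * (\<integral>\<omega>. 1 / sqn_not d i (W \<omega>) \<partial>N)"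
    using indep_product[OF i, of "\<lambda>x. (x - \<theta> i)\<^sup>2" "\<lambda>w. 1 / w"] i2 u1[OF i] by simp_all
  have c: "integrable N (\<lambda>\<omega>. (W \<omega> i - \<theta> i) * (\<theta> i / ((\<theta> i)\<^sup>2 + sqn_not d i (W \<omega>))))"
    "(\<integral>\<omega>. (W \<omega> i - \<theta> i) * (\<theta> i / ((\<theta> i)\<^sup>2 + sqn_not d i (W \<omega>))) \<partial>N) = 0"
    using indep_product[OF i, of "\<lambda>x. x - \<theta> i" "\<lambda>w. \<theta> i / ((\<theta> i)\<^sup>2 + w)"] i1 b by simp_all
  note D = stein_decomposition[where X = W and d = d and i = i and \<theta> = \<theta>, OF W i w[OF i] u1[OF i] yu(1) c]
  show "integrable N (\<lambda>\<omega>. stein d \<theta> s2 i (W \<omega>))" by (rule D(1))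
  show "integrable N (\<lambda>\<omega>. (W \<omega> i - \<theta> i)\<^sup>2 / sqn_not d i (W \<omega>) * kap (\<theta> i) (W \<omega> i) (sqn_not d i (W \<omega>)))" by (rule D(2))
  show "integrable N (\<lambda>\<omega>. rad (W \<omega> i) (sqn_not d i (W \<omega>)))" by (rule D(3))
  show "(\<integral>\<omega>. stein d \<theta> s2 i (W \<omega>) \<partial>N)
      = s2 * (\<integral>\<omega>. rad (W \<omega> i) (sqn_not d i (W \<omega>)) \<partial>N)
        - (\<integral>\<omega>. (W \<omega> i - \<theta> i)\<^sup>2 / sqn_not d i (W \<omega>) * kap (\<theta> i) (W \<omega> i) (sqn_not d i (W \<omega>)) \<partial>N)"
    unfolding D(4)[of s2] yu(2) by simp
qed

text \<open>The \<open>kap\<close> and \<open>rad\<close> expectations are nonnegative and enter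
  with opposite signs, so the absolute value is at most the larger of the two bounds.\<close>

lemma stein_fourth_moment:
  assumes i: "i < d" and C: "(\<integral>\<^sup>+\<omega>. ennreal ((Y \<omega> i) ^ 4) \<partial>N) \<le> ennreal C4"
  shows "\<bar>\<integral>\<omega>. stein d \<theta> s2 i (W \<omega>) \<partial>N\<bar>
    \<le> 3 * (Cm2 / (real d)\<^sup>2) * (C4 / 3 + C4 powr (3/4) * \<bar>\<theta> i\<bar> + 2 * s2 * (\<theta> i)\<^sup>2 + s2\<^sup>2)"
    and "0 < C4"
proof -
  let ?u2 = "\<integral>\<omega>. (1 / sqn_not d i (W \<omega>))\<^sup>2 \<partial>N" and ?q = "Cm2 / (real d)\<^sup>2"
  have q: "0 \<le> ?q" using u2(3)[OF i] by simp
  have "\<not> (AE \<omega> in N. (Y \<omega> i) ^ 4 = 0)"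
  proof
    assume "AE \<omega> in N. (Y \<omega> i) ^ 4 = 0"
    then have "AE \<omega> in N. (Y \<omega> i)\<^sup>2 = 0" by eventually_elim simp
    then have "(\<integral>\<omega>. (Y \<omega> i)\<^sup>2 \<partial>N) = 0" using Y2(1)[OF i] by (simp add: integral_nonneg_eq_0_iff_AE)
    then show False using Y2(2)[OF i] s2 by simp
  qed
  note D = nn_integral_le_ennrealD[OF _ _ C this]
  have Y4: "integrable N (\<lambda>\<omega>. (Y \<omega> i) ^ 4)" "(\<integral>\<omega>. (Y \<omega> i) ^ 4 \<partial>N) \<le> C4"
    by (rule D; use Yi[OF i] in simp)+
  have "s2 \<le> sqrt C4" using expectation_square_le_sqrt[OF Yi[OF i] Y4] Y2(2)[OF i] by simp
  then have "0 < sqrt C4" using s2 by linarith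
  then show C4: "0 < C4" by simp
  have Y3: "integrable N (\<lambda>\<omega>. (Y \<omega> i) ^ 3)" by (rule integrable_power_mono[OF Yi[OF i] Y4(1)]) simp
  \<comment> \<open>Young's inequality with parameter \<open>a\<close>, the fourth root of
    \<open>C4\<close>, gives \<open>E[\<bar>Y i\<bar>^3] \<le> C4 powr (3/4)\<close>, since both
    terms on its right then have this order.\<close>
  define a where "a = C4 powr (1/4)"
  have a: "0 < a" using C4 by (simp add: a_def)
  have "C4 / a = C4 powr (1 - 1/4)" unfolding powr_diff a_def using C4 by simp
  then have a1: "C4 / a = C4 powr (3/4)" by simp
  have "a ^ 3 = a powr 3" using a by simp
  also have "\<dots> = C4 powr (3/4)" unfolding a_def powr_powr by simp
  finally have a3: "a ^ 3 = C4 powr (3/4)" .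
  have young: "t ^ 3 \<le> 3 / (4 * a) * t ^ 4 + a ^ 3 / 4" if t: "0 \<le> t" for t :: real
  proof -
    have "0 \<le> (t - a)\<^sup>2 * (3 * t\<^sup>2 + 2 * t * a + a\<^sup>2)" using a t by simp
    also have "\<dots> = 3 * t ^ 4 + a ^ 4 - 4 * a * t ^ 3"
      by (simp add: power2_eq_square power3_eq_cube power4_eq_xxxx algebra_simps)
    finally have "4 * a * t ^ 3 / (4 * a) \<le> (3 * t ^ 4 + a ^ 4) / (4 * a)" using a by (intro divide_right_mono) auto
    also have "\<dots> = 3 / (4 * a) * t ^ 4 + a ^ 3 / 4"
      using a by (simp add: add_divide_distrib power4_eq_xxxx power3_eq_cube)
    finally show ?thesis using a by simp
  qed
  have "(\<integral>\<omega>. \<bar>Y \<omega> i\<bar> ^ 3 \<partial>N) \<le> (\<integral>\<omega>. 3 / (4 * a) * (Y \<omega> i) ^ 4 + a ^ 3 / 4 \<partial>N)"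
  proof (rule integral_mono)
    show "integrable N (\<lambda>\<omega>. \<bar>Y \<omega> i\<bar> ^ 3)" using integrable_abs[OF Y3] by (simp add: power_abs)
    show "\<bar>Y \<omega> i\<bar> ^ 3 \<le> 3 / (4 * a) * (Y \<omega> i) ^ 4 + a ^ 3 / 4" for \<omega>
      using young[of "\<bar>Y \<omega> i\<bar>"] by simp
  qed (use Y4 in simp)
  also have "\<dots> = 3 / (4 * a) * (\<integral>\<omega>. (Y \<omega> i) ^ 4 \<partial>N) + a ^ 3 / 4" using Y4 by (simp add: prob_space)
  also have "\<dots> \<le> 3 / (4 * a) * C4 + a ^ 3 / 4" using a Y4 by (intro add_right_mono mult_left_mono) auto
  also have "\<dots> = 3 / 4 * (C4 / a) + a ^ 3 / 4" by simp
  also have "\<dots> = C4 powr (3/4)" unfolding a1 a3 by simp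
  finally have "\<bar>\<integral>\<omega>. (Y \<omega> i) ^ 3 \<partial>N\<bar> \<le> C4 powr (3/4)"
    using integral_abs_bound[of N "\<lambda>\<omega>. (Y \<omega> i) ^ 3"] by (simp add: power_abs)
  then have t3: "\<theta> i * (\<integral>\<omega>. (Y \<omega> i) ^ 3 \<partial>N) \<le> \<bar>\<theta> i\<bar> * C4 powr (3/4)"
    by (intro order_trans[OF abs_ge_self[of "\<theta> i * _"]]) (simp add: abs_mult mult_left_mono)

  have FY: "(W \<omega> i - \<theta> i)\<^sup>2 * ((W \<omega> i)\<^sup>2 + W \<omega> i * \<theta> i + (\<theta> i)\<^sup>2)
      = (Y \<omega> i) ^ 4 + 3 * \<theta> i * (Y \<omega> i) ^ 3 + 3 * (\<theta> i)\<^sup>2 * (Y \<omega> i)\<^sup>2" for \<omega>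
    using i by (simp add: Xof_component power2_eq_square power3_eq_cube power4_eq_xxxx algebra_simps)
  have F: "integrable N (\<lambda>\<omega>. (W \<omega> i - \<theta> i)\<^sup>2 * ((W \<omega> i)\<^sup>2 + W \<omega> i * \<theta> i + (\<theta> i)\<^sup>2))"
    "(\<integral>\<omega>. (W \<omega> i - \<theta> i)\<^sup>2 * ((W \<omega> i)\<^sup>2 + W \<omega> i * \<theta> i + (\<theta> i)\<^sup>2) \<partial>N) \<le> C4 + 3 * (\<bar>\<theta> i\<bar> * C4 powr (3/4)) + 3 * (\<theta> i)\<^sup>2 * s2"
    unfolding FY using Y4 Y3 Y2[OF i] t3 by simp_all
  have A: "(\<integral>\<omega>. (W \<omega> i - \<theta> i)\<^sup>2 / sqn_not d i (W \<omega>) * kap (\<theta> i) (W \<omega> i) (sqn_not d i (W \<omega>)) \<partial>N)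
    \<le> (C4 + 3 * (\<bar>\<theta> i\<bar> * C4 powr (3/4)) + 3 * (\<theta> i)\<^sup>2 * s2) * ?q"
  proof -
    note IP = indep_product[OF i, of "\<lambda>x. (x - \<theta> i)\<^sup>2 * (x\<^sup>2 + x * \<theta> i + (\<theta> i)\<^sup>2)" "\<lambda>w. (1 / w)\<^sup>2", OF _ _ F(1) u2(1)[OF i]]
    have "(\<integral>\<omega>. (W \<omega> i - \<theta> i)\<^sup>2 / sqn_not d i (W \<omega>) * kap (\<theta> i) (W \<omega> i) (sqn_not d i (W \<omega>)) \<partial>N)
      \<le> (\<integral>\<omega>. ((W \<omega> i - \<theta> i)\<^sup>2 * ((W \<omega> i)\<^sup>2 + W \<omega> i * \<theta> i + (\<theta> i)\<^sup>2)) * (1 / sqn_not d i (W \<omega>))\<^sup>2 \<partial>N)"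
    proof (rule integral_mono_AE[OF stein_indep(2)[OF i] IP(1)])
      show "AE \<omega> in N. (W \<omega> i - \<theta> i)\<^sup>2 / sqn_not d i (W \<omega>) * kap (\<theta> i) (W \<omega> i) (sqn_not d i (W \<omega>))
        \<le> ((W \<omega> i - \<theta> i)\<^sup>2 * ((W \<omega> i)\<^sup>2 + W \<omega> i * \<theta> i + (\<theta> i)\<^sup>2)) * (1 / sqn_not d i (W \<omega>))\<^sup>2"
        using wpos[OF i]
      proof eventually_elim
        case (elim \<omega>)
        have "(W \<omega> i - \<theta> i)\<^sup>2 / sqn_not d i (W \<omega>) * kap (\<theta> i) (W \<omega> i) (sqn_not d i (W \<omega>))
          \<le> (W \<omega> i - \<theta> i)\<^sup>2 / sqn_not d i (W \<omega>) * (((W \<omega> i)\<^sup>2 + W \<omega> i * \<theta> i + (\<theta> i)\<^sup>2) / sqn_not d i (W \<omega>))"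
          using elim by (intro mult_left_mono kap_le_cubic) auto
        then show ?case by (simp add: power2_eq_square)
      qed
    qed simp_all
    also have "\<dots> = (\<integral>\<omega>. (W \<omega> i - \<theta> i)\<^sup>2 * ((W \<omega> i)\<^sup>2 + W \<omega> i * \<theta> i + (\<theta> i)\<^sup>2) \<partial>N) * ?u2"
      by (rule IP(2)) simp_all
    also have "\<dots> \<le> (C4 + 3 * (\<bar>\<theta> i\<bar> * C4 powr (3/4)) + 3 * (\<theta> i)\<^sup>2 * s2) * ?q"
      using F(2) u2(2)[OF i] C4 s2 by (intro mult_mono) auto
    finally show ?thesis .
  qed
  have x2: "(W \<omega> i)\<^sup>2 = (Y \<omega> i)\<^sup>2 + 2 * \<theta> i * Y \<omega> i + (\<theta> i)\<^sup>2" for \<omega>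
    using i by (simp add: Xof_component power2_eq_square algebra_simps)
  have X2: "integrable N (\<lambda>\<omega>. (W \<omega> i)\<^sup>2)" "(\<integral>\<omega>. (W \<omega> i)\<^sup>2 \<partial>N) = s2 + (\<theta> i)\<^sup>2"
    unfolding x2 using Y2[OF i] Y1[OF i] by (simp_all add: prob_space)
  have B: "(\<integral>\<omega>. rad (W \<omega> i) (sqn_not d i (W \<omega>)) \<partial>N) \<le> 3 * (s2 + (\<theta> i)\<^sup>2) * ?q"
  proof -
    have "integrable N (\<lambda>\<omega>. 3 * (W \<omega> i)\<^sup>2)" using X2 by simp
    note IP = indep_product[OF i, of "\<lambda>x. 3 * x\<^sup>2" "\<lambda>w. (1 / w)\<^sup>2", OF _ _ this u2(1)[OF i]]
    have "(\<integral>\<omega>. rad (W \<omega> i) (sqn_not d i (W \<omega>)) \<partial>N) \<le> (\<integral>\<omega>. 3 * (W \<omega> i)\<^sup>2 * (1 / sqn_not d i (W \<omega>))\<^sup>2 \<partial>N)"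
    proof (rule integral_mono_AE[OF stein_indep(3)[OF i] IP(1)])
      show "AE \<omega> in N. rad (W \<omega> i) (sqn_not d i (W \<omega>)) \<le> 3 * (W \<omega> i)\<^sup>2 * (1 / sqn_not d i (W \<omega>))\<^sup>2"
        using wpos[OF i]
      proof eventually_elim
        case (elim \<omega>)
        then show ?case using rad_bounds(2)[OF elim, of "W \<omega> i"] by (simp add: power_divide)
      qed
    qed simp_all
    also have "\<dots> = (\<integral>\<omega>. 3 * (W \<omega> i)\<^sup>2 \<partial>N) * ?u2" by (rule IP(2)) simp_all
    also have "\<dots> \<le> 3 * (s2 + (\<theta> i)\<^sup>2) * ?q"
      using X2 u2(2)[OF i] s2 by (intro mult_mono) auto
    finally show ?thesis .
  qed
  have nonneg: "0 \<le> (\<integral>\<omega>. (W \<omega> i - \<theta> i)\<^sup>2 / sqn_not d i (W \<omega>) * kap (\<theta> i) (W \<omega> i) (sqn_not d i (W \<omega>)) \<partial>N)"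
    "0 \<le> (\<integral>\<omega>. rad (W \<omega> i) (sqn_not d i (W \<omega>)) \<partial>N)"
    by (intro Bochner_Integration.integral_nonneg, simp add: kap_nonneg)
       (intro Bochner_Integration.integral_nonneg, simp add: rad_def)
  have p: "0 \<le> C4 powr (3/4) * \<bar>\<theta> i\<bar>" "0 \<le> s2 * (\<theta> i)\<^sup>2" "0 \<le> s2\<^sup>2" using s2 by simp_all
  have "s2 * (\<integral>\<omega>. rad (W \<omega> i) (sqn_not d i (W \<omega>)) \<partial>N) \<le> s2 * (3 * (s2 + (\<theta> i)\<^sup>2) * ?q)"
    using B s2 by (intro mult_left_mono) auto
  also have "\<dots> = ?q * (3 * (s2\<^sup>2 + s2 * (\<theta> i)\<^sup>2))" by (simp add: power2_eq_square algebra_simps)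
  also have "\<dots> \<le> ?q * (3 * (C4 / 3 + C4 powr (3/4) * \<bar>\<theta> i\<bar> + 2 * s2 * (\<theta> i)\<^sup>2 + s2\<^sup>2))"
    using q C4 p by (intro mult_left_mono) auto
  finally have up: "s2 * (\<integral>\<omega>. rad (W \<omega> i) (sqn_not d i (W \<omega>)) \<partial>N)
    \<le> ?q * (3 * (C4 / 3 + C4 powr (3/4) * \<bar>\<theta> i\<bar> + 2 * s2 * (\<theta> i)\<^sup>2 + s2\<^sup>2))" .
  have "(C4 + 3 * (\<bar>\<theta> i\<bar> * C4 powr (3/4)) + 3 * (\<theta> i)\<^sup>2 * s2) * ?q
      = ?q * (3 * (C4 / 3 + C4 powr (3/4) * \<bar>\<theta> i\<bar> + s2 * (\<theta> i)\<^sup>2))" by (simp add: algebra_simps)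
  also have "\<dots> \<le> ?q * (3 * (C4 / 3 + C4 powr (3/4) * \<bar>\<theta> i\<bar> + 2 * s2 * (\<theta> i)\<^sup>2 + s2\<^sup>2))"
    using q C4 p by (intro mult_left_mono) auto
  finally have lo: "(\<integral>\<omega>. (W \<omega> i - \<theta> i)\<^sup>2 / sqn_not d i (W \<omega>) * kap (\<theta> i) (W \<omega> i) (sqn_not d i (W \<omega>)) \<partial>N)
    \<le> ?q * (3 * (C4 / 3 + C4 powr (3/4) * \<bar>\<theta> i\<bar> + 2 * s2 * (\<theta> i)\<^sup>2 + s2\<^sup>2))" using A by linarith
  have "\<bar>\<integral>\<omega>. stein d \<theta> s2 i (W \<omega>) \<partial>N\<bar> \<le> ?q * (3 * (C4 / 3 + C4 powr (3/4) * \<bar>\<theta> i\<bar> + 2 * s2 * (\<theta> i)\<^sup>2 + s2\<^sup>2))"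
    unfolding stein_indep(4)[OF i] using up lo nonneg mult_nonneg_nonneg[OF less_imp_le[OF s2] nonneg(2)]
    by (intro abs_leI) linarith+
  then show "\<bar>\<integral>\<omega>. stein d \<theta> s2 i (W \<omega>) \<partial>N\<bar>
    \<le> 3 * ?q * (C4 / 3 + C4 powr (3/4) * \<bar>\<theta> i\<bar> + 2 * s2 * (\<theta> i)\<^sup>2 + s2\<^sup>2)"
    by (simp only: mult.commute[of 3 ?q] mult.assoc)
qed

text \<open>At a fixed value \<open>w\<close> of the reduced norm, the zero bias identity for
  \<open>x / (w + x^2)\<close> turns the inner expectation into \<open>s2\<close> times a difference
  of derivatives at \<open>Z\<close> and at \<open>W i\<close>. This is Lipschitz in the square of
  the argument; integrating over \<open>w\<close> produces \<open>E[1 / w^2]\<close>.\<close>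

lemma stein_zero_bias:
  assumes i: "i < d" and Z: "zero_bias_1d N (\<lambda>\<omega>. W \<omega> i) (\<theta> i) s2 Z"
    and int: "integrable N (\<lambda>\<omega>. \<bar>(W \<omega> i)\<^sup>2 - (Z \<omega>)\<^sup>2\<bar>)"
  shows "\<bar>\<integral>\<omega>. stein d \<theta> s2 i (W \<omega>) \<partial>N\<bar> \<le> 3 * (Cm2 / (real d)\<^sup>2) * s2 * (\<integral>\<omega>. \<bar>(W \<omega> i)\<^sup>2 - (Z \<omega>)\<^sup>2\<bar> \<partial>N)"
proof -
  note [measurable] = Wi[OF i]
  have Zm [measurable]: "Z \<in> borel_measurable N" using Z by (simp add: zero_bias_1d_def)
  let ?D = "\<integral>\<omega>. \<bar>(W \<omega> i)\<^sup>2 - (Z \<omega>)\<^sup>2\<bar> \<partial>N"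
  define h where "h w x = (w - x\<^sup>2) / (w + x\<^sup>2)\<^sup>2" for w x :: real
  define F where "F = (\<lambda>(w, x). (x - \<theta> i) * x / (w + x\<^sup>2) - s2 * h w x)"
  have Fm: "F \<in> borel_measurable (borel \<Otimes>\<^sub>M borel)" unfolding F_def h_def by measurable
  have FW: "F (sqn_not d i (W \<omega>), W \<omega> i) = stein d \<theta> s2 i (W \<omega>)" for \<omega>
    by (simp add: F_def h_def stein_def sqn_split[OF i])
  have inner: "(\<integral>\<omega>. F (w, W \<omega> i) \<partial>N) = s2 * (\<integral>\<omega>. h w (Z \<omega>) - h w (W \<omega> i) \<partial>N)" if w: "0 < w" for w
  proof -
    have hi: "integrable N (\<lambda>\<omega>. h w (f \<omega>))" if [measurable]: "f \<in> borel_measurable N" for f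
      by (rule integrable_const_bound[where B = "1 / w"])
         (use curvature_bound[OF w] in \<open>auto simp: h_def\<close>)
    have bound: "\<bar>x / (w + x\<^sup>2)\<bar> \<le> 1 / w * \<bar>x\<bar>" for x
      using shrink_lipschitz[OF w, of x 0] by simp
    have fi: "integrable N (\<lambda>\<omega>. (W \<omega> i - \<theta> i) * (W \<omega> i / (w + (W \<omega> i)\<^sup>2)))"
    proof (rule Bochner_Integration.integrable_bound[where f = "\<lambda>\<omega>. (Y \<omega> i)\<^sup>2 + 1 / w"])
      have "(x / (w + x\<^sup>2))\<^sup>2 \<le> 1 / w" for x
      proof -
        have R: "0 < w + x\<^sup>2" using w by (simp add: add_pos_nonneg)
        have "(x / (w + x\<^sup>2))\<^sup>2 \<le> (w + x\<^sup>2) / (w + x\<^sup>2)\<^sup>2"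
          unfolding power_divide using w by (intro divide_right_mono) auto
        also have "\<dots> = 1 / (w + x\<^sup>2)" using R by (simp add: power2_eq_square)
        also have "\<dots> \<le> 1 / w" using w R by (intro divide_left_mono) auto
        finally show ?thesis .
      qed
      then have "\<bar>(W \<omega> i - \<theta> i) * (W \<omega> i / (w + (W \<omega> i)\<^sup>2))\<bar> \<le> (W \<omega> i - \<theta> i)\<^sup>2 + 1 / w" for \<omega>
        by (rule abs_mult_le)
      then show "AE \<omega> in N. norm ((W \<omega> i - \<theta> i) * (W \<omega> i / (w + (W \<omega> i)\<^sup>2))) \<le> norm ((Y \<omega> i)\<^sup>2 + 1 / w)"
        using w by (intro AE_I2) (simp only: centered[OF i] real_norm_def, simp add: abs_of_nonneg add_nonneg_nonneg)
    qed (use Y2[OF i] in auto)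
    have "(\<integral>\<omega>. (W \<omega> i - \<theta> i) * (W \<omega> i / (w + (W \<omega> i)\<^sup>2)) \<partial>N) = s2 * (\<integral>\<omega>. h w (Z \<omega>) \<partial>N)"
      using Z[unfolded zero_bias_1d_def, THEN conjunct2, rule_format,
          of "\<lambda>x. x / (w + x\<^sup>2)" "\<lambda>x. h w x"] abs_cont_on_lipschitz[OF shrink_lipschitz[OF w]] shrink_deriv[OF w]
        fi hi[OF Zm] by (simp add: h_def)
    moreover have "(\<integral>\<omega>. F (w, W \<omega> i) \<partial>N)
        = (\<integral>\<omega>. (W \<omega> i - \<theta> i) * (W \<omega> i / (w + (W \<omega> i)\<^sup>2)) \<partial>N) - s2 * (\<integral>\<omega>. h w (W \<omega> i) \<partial>N)"
      using fi hi[OF Wi[OF i]] by (simp add: F_def)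
    ultimately show ?thesis using hi[OF Zm] hi[OF Wi[OF i]] by (simp add: right_diff_distrib)
  qed
  have inner_le: "\<bar>\<integral>\<omega>. F (w, W \<omega> i) \<partial>N\<bar> \<le> 3 * s2 * ?D * (1 / w)\<^sup>2" if w: "0 < w" for w
  proof -
    have "\<bar>\<integral>\<omega>. h w (Z \<omega>) - h w (W \<omega> i) \<partial>N\<bar> \<le> (\<integral>\<omega>. 3 / w\<^sup>2 * \<bar>(W \<omega> i)\<^sup>2 - (Z \<omega>)\<^sup>2\<bar> \<partial>N)"
    proof (rule order_trans[OF integral_abs_bound integral_mono'])
      show "integrable N (\<lambda>\<omega>. 3 / w\<^sup>2 * \<bar>(W \<omega> i)\<^sup>2 - (Z \<omega>)\<^sup>2\<bar>)" using int by simp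
      show "\<bar>h w (Z \<omega>) - h w (W \<omega> i)\<bar> \<le> 3 / w\<^sup>2 * \<bar>(W \<omega> i)\<^sup>2 - (Z \<omega>)\<^sup>2\<bar>" for \<omega>
        using curvature_difference[OF w, of "(Z \<omega>)\<^sup>2" "(W \<omega> i)\<^sup>2"] by (simp add: h_def abs_minus_commute)
    qed simp
    also have "\<dots> = 3 / w\<^sup>2 * ?D" by (rule integral_mult_right_zero)
    finally have "s2 * \<bar>\<integral>\<omega>. h w (Z \<omega>) - h w (W \<omega> i) \<partial>N\<bar> \<le> s2 * (3 / w\<^sup>2 * ?D)"
      using s2 by (intro mult_left_mono) auto
    then show ?thesis unfolding inner[OF w] using s2 by (simp add: abs_mult power_divide mult_ac)
  qed
  have "integrable N (\<lambda>\<omega>. F (sqn_not d i (W \<omega>), W \<omega> i))"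
    unfolding FW by (rule stein_indep(1)[OF i])
  note fub = indep_var_fubini[OF indep[OF i] Fm this]
  have "\<bar>\<integral>\<omega>. stein d \<theta> s2 i (W \<omega>) \<partial>N\<bar> = \<bar>\<integral>\<omega>. (\<integral>\<omega>'. F (sqn_not d i (W \<omega>), W \<omega>' i) \<partial>N) \<partial>N\<bar>"
    using fub(2) unfolding FW by simp
  also have "\<dots> \<le> (\<integral>\<omega>. \<bar>\<integral>\<omega>'. F (sqn_not d i (W \<omega>), W \<omega>' i) \<partial>N\<bar> \<partial>N)" by (rule integral_abs_bound)
  also have "\<dots> \<le> (\<integral>\<omega>. 3 * s2 * ?D * (1 / sqn_not d i (W \<omega>))\<^sup>2 \<partial>N)"
  proof (rule integral_mono_AE)
    show "AE \<omega> in N. \<bar>\<integral>\<omega>'. F (sqn_not d i (W \<omega>), W \<omega>' i) \<partial>N\<bar> \<le> 3 * s2 * ?D * (1 / sqn_not d i (W \<omega>))\<^sup>2"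
      using wpos[OF i] by eventually_elim (rule inner_le)
  qed (use fub(1) u2(1)[OF i] in auto)
  also have "\<dots> = 3 * s2 * ?D * (\<integral>\<omega>. (1 / sqn_not d i (W \<omega>))\<^sup>2 \<partial>N)" by (rule integral_mult_right_zero)
  also have "\<dots> \<le> 3 * s2 * ?D * (Cm2 / (real d)\<^sup>2)"
    using u2(2)[OF i] s2 by (intro mult_left_mono) auto
  finally show ?thesis by (simp add: mult_ac)
qed

end

subsection \<open>Mixtures\<close>

text \<open>The mixture hypothesis concerns probabilities of sets only; it is first lifted to an
  identity of laws. The right hand side is a nonnegative integral, so that it may be compared with
  possibly infinite bounds for the components.\<close>

lemma mixture_integral:
  fixes F :: "rvec \<Rightarrow> real"
  assumes M: "prob_space M" and Y [measurable]: "Y \<in> M \<rightarrow>\<^sub>M Rd d" and mix: "mixture M d Y \<mu> N Ys"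
    and F [measurable]: "F \<in> borel_measurable (Rd d)" and FY: "integrable M (\<lambda>\<omega>. F (Y \<omega>))"
    and FYs: "\<And>s. s \<in> space \<mu> \<Longrightarrow> integrable (N s) (\<lambda>\<omega>. F (Ys s \<omega>))"
  shows "ennreal \<bar>\<integral>\<omega>. F (Y \<omega>) \<partial>M\<bar> \<le> (\<integral>\<^sup>+s. ennreal \<bar>\<integral>\<omega>. F (Ys s \<omega>) \<partial>N s\<bar> \<partial>\<mu>)"
proof -
  interpret M: prob_space M by (rule M)
  interpret \<mu>: prob_space \<mu> using mix by (simp add: mixture_def)
  define K where "K s = distr (N s) (Rd d) (Ys s)" for s
  have Ns: "prob_space (N s)" "Ys s \<in> N s \<rightarrow>\<^sub>M Rd d" if "s \<in> space \<mu>" for s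
    using mix that by (simp_all add: mixture_def)
  have emK: "emeasure (K s) A = ennreal (measure (N s) (Ys s -` A \<inter> space (N s)))"
    if "s \<in> space \<mu>" "A \<in> sets (Rd d)" for s A
  proof -
    interpret N: prob_space "N s" by (rule Ns[OF that(1)])
    show ?thesis using Ns(2)[OF that(1)] that(2) by (simp add: K_def emeasure_distr N.emeasure_eq_measure)
  qed
  have K: "K \<in> \<mu> \<rightarrow>\<^sub>M subprob_algebra (Rd d)"
  proof (rule measurable_subprob_algebra)
    show "subprob_space (K s)" if "s \<in> space \<mu>" for s
      unfolding K_def by (intro prob_space_imp_subprob_space prob_space.prob_space_distr Ns that)
    show "sets (K s) = sets (Rd d)" if "s \<in> space \<mu>" for s by (simp add: K_def)
    fix A assume A: "A \<in> sets (Rd d)"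
    then have "(\<lambda>s. ennreal (measure (N s) (Ys s -` A \<inter> space (N s)))) \<in> borel_measurable \<mu>"
      using mix by (auto simp: mixture_def)
    then show "(\<lambda>s. emeasure (K s) A) \<in> borel_measurable \<mu>"
      by (subst measurable_cong[OF emK[OF _ A]])
  qed
  \<comment> \<open>The laws of the components form a measurable kernel, and \<open>mixture\<close>
    says that the law of \<open>Y\<close> is its composition with \<open>\<mu>\<close>.\<close>
  have law: "distr M (Rd d) Y = \<mu> \<bind> K"
  proof (rule measure_eqI)
    show "sets (distr M (Rd d) Y) = sets (\<mu> \<bind> K)"
      using sets_bind[of \<mu> K "Rd d"] \<mu>.not_empty by (simp add: K_def)
    fix A assume "A \<in> sets (distr M (Rd d) Y)"
    then have A: "A \<in> sets (Rd d)" by simp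
    have "(\<lambda>s. measure (N s) (Ys s -` A \<inter> space (N s))) \<in> borel_measurable \<mu>"
      using mix A by (auto simp: mixture_def)
    then have "integrable \<mu> (\<lambda>s. measure (N s) (Ys s -` A \<inter> space (N s)))"
      by (rule \<mu>.integrable_const_bound[where B = 1, rotated])
         (auto intro!: AE_I2 prob_space.prob_le_1 Ns)
    then have "ennreal (measure M (Y -` A \<inter> space M)) = (\<integral>\<^sup>+s. ennreal (measure (N s) (Ys s -` A \<inter> space (N s))) \<partial>\<mu>)"
      using mix A by (simp add: mixture_def nn_integral_eq_integral)
    also have "\<dots> = (\<integral>\<^sup>+s. emeasure (K s) A \<partial>\<mu>)" by (intro nn_integral_cong) (simp add: emK A)
    also have "\<dots> = emeasure (\<mu> \<bind> K) A" using K A \<mu>.not_empty by (simp add: emeasure_bind)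
    finally show "emeasure (distr M (Rd d) Y) A = emeasure (\<mu> \<bind> K) A"
      using A by (simp add: emeasure_distr M.emeasure_eq_measure)
  qed
  have nn: "(\<integral>\<^sup>+\<omega>. f (Y \<omega>) \<partial>M) = (\<integral>\<^sup>+s. (\<integral>\<^sup>+y. f y \<partial>K s) \<partial>\<mu>)" if [measurable]: "f \<in> borel_measurable (Rd d)" for f :: "rvec \<Rightarrow> ennreal"
    using nn_integral_bind[OF that K] by (simp add: law[symmetric] nn_integral_distr)
  have FK: "integrable (K s) F" "(\<integral>y. F y \<partial>K s) = (\<integral>\<omega>. F (Ys s \<omega>) \<partial>N s)" if "s \<in> space \<mu>" for s
    unfolding K_def using Ns(2)[OF that] FYs[OF that] by (simp_all add: integrable_distr_eq integral_distr)
  \<comment> \<open>Measurability in \<open>s\<close> is available for nonnegative integrals, so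
    signed functions are treated through their positive and negative parts.\<close>
  have part: "integrable \<mu> (\<lambda>s. \<integral>y. G y \<partial>K s) \<and> (\<integral>\<omega>. G (Y \<omega>) \<partial>M) = (\<integral>s. (\<integral>y. G y \<partial>K s) \<partial>\<mu>)"
    if [measurable]: "G \<in> borel_measurable (Rd d)" and G0: "\<And>y. 0 \<le> G y" and GF: "\<And>y. G y \<le> \<bar>F y\<bar>" for G :: "rvec \<Rightarrow> real"
  proof -
    have GK: "integrable (K s) G" if "s \<in> space \<mu>" for s
      by (rule Bochner_Integration.integrable_bound[OF FK(1)[OF that]])
         (use G0 GF in \<open>auto simp: K_def\<close>)
    have GM: "integrable M (\<lambda>\<omega>. G (Y \<omega>))"
      by (rule Bochner_Integration.integrable_bound[OF FY]) (use G0 GF in auto)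
    have eq: "(\<integral>\<^sup>+y. ennreal (G y) \<partial>K s) = ennreal (\<integral>y. G y \<partial>K s)" if "s \<in> space \<mu>" for s
      using GK[OF that] G0 by (intro nn_integral_eq_integral) auto
    have "(\<lambda>s. enn2real (\<integral>\<^sup>+y. ennreal (G y) \<partial>K s)) \<in> borel_measurable \<mu>"
      by (intro borel_measurable_enn2real measurable_compose[OF K nn_integral_measurable_subprob_algebra]) measurable
    moreover have "enn2real (\<integral>\<^sup>+y. ennreal (G y) \<partial>K s) = (\<integral>y. G y \<partial>K s)" if "s \<in> space \<mu>" for s
      using eq[OF that] G0 by (simp add: Bochner_Integration.integral_nonneg)
    ultimately have meas: "(\<lambda>s. \<integral>y. G y \<partial>K s) \<in> borel_measurable \<mu>"
      by (subst (asm) measurable_cong) auto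
    have nnG: "(\<integral>\<^sup>+s. ennreal (\<integral>y. G y \<partial>K s) \<partial>\<mu>) = ennreal (\<integral>\<omega>. G (Y \<omega>) \<partial>M)"
    proof -
      have "(\<integral>\<^sup>+s. ennreal (\<integral>y. G y \<partial>K s) \<partial>\<mu>) = (\<integral>\<^sup>+s. (\<integral>\<^sup>+y. ennreal (G y) \<partial>K s) \<partial>\<mu>)"
        by (intro nn_integral_cong) (simp add: eq)
      also have "\<dots> = (\<integral>\<^sup>+\<omega>. ennreal (G (Y \<omega>)) \<partial>M)" by (rule nn[symmetric]) measurable
      also have "\<dots> = ennreal (\<integral>\<omega>. G (Y \<omega>) \<partial>M)" using GM G0 by (intro nn_integral_eq_integral) auto
      finally show ?thesis .
    qed
    have int: "integrable \<mu> (\<lambda>s. \<integral>y. G y \<partial>K s)"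
      by (rule integrableI_nonneg[OF meas]) (simp_all add: nnG G0 Bochner_Integration.integral_nonneg)
    then have "ennreal (\<integral>s. (\<integral>y. G y \<partial>K s) \<partial>\<mu>) = ennreal (\<integral>\<omega>. G (Y \<omega>) \<partial>M)"
      using nnG by (subst (asm) nn_integral_eq_integral) (simp_all add: G0 Bochner_Integration.integral_nonneg)
    then show ?thesis using int G0 by (simp add: Bochner_Integration.integral_nonneg)
  qed
  let ?p = "\<lambda>y. max 0 (F y)" and ?n = "\<lambda>y. max 0 (- F y)"
  have p: "integrable \<mu> (\<lambda>s. \<integral>y. ?p y \<partial>K s)" "(\<integral>\<omega>. ?p (Y \<omega>) \<partial>M) = (\<integral>s. (\<integral>y. ?p y \<partial>K s) \<partial>\<mu>)"
    using part[of ?p] by auto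
  have n: "integrable \<mu> (\<lambda>s. \<integral>y. ?n y \<partial>K s)" "(\<integral>\<omega>. ?n (Y \<omega>) \<partial>M) = (\<integral>s. (\<integral>y. ?n y \<partial>K s) \<partial>\<mu>)"
    using part[of ?n] by auto
  have split: "(\<integral>x. f x \<partial>A) = (\<integral>x. max 0 (f x) \<partial>A) - (\<integral>x. max 0 (- f x) \<partial>A)" if "integrable A f" for A :: "'x measure" and f :: "'x \<Rightarrow> real"
  proof -
    have "(\<integral>x. max 0 (f x) \<partial>A) - (\<integral>x. max 0 (- f x) \<partial>A) = (\<integral>x. max 0 (f x) - max 0 (- f x) \<partial>A)"
      using integrable_max[OF integrable_zero that] integrable_max[OF integrable_zero integrable_minus[OF that]]
      by (rule Bochner_Integration.integral_diff[symmetric])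
    also have "\<dots> = (\<integral>x. f x \<partial>A)" by (intro Bochner_Integration.integral_cong) auto
    finally show ?thesis by simp
  qed
  have "(\<integral>\<omega>. F (Y \<omega>) \<partial>M) = (\<integral>s. (\<integral>y. ?p y \<partial>K s) - (\<integral>y. ?n y \<partial>K s) \<partial>\<mu>)"
    using p n by (simp add: split[OF FY])
  moreover have int: "integrable \<mu> (\<lambda>s. (\<integral>y. ?p y \<partial>K s) - (\<integral>y. ?n y \<partial>K s))" using p n by simp
  ultimately have "ennreal \<bar>\<integral>\<omega>. F (Y \<omega>) \<partial>M\<bar> \<le> ennreal (\<integral>s. \<bar>(\<integral>y. ?p y \<partial>K s) - (\<integral>y. ?n y \<partial>K s)\<bar> \<partial>\<mu>)"
    by (simp add: ennreal_leI integral_abs_bound)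
  also have "\<dots> = (\<integral>\<^sup>+s. ennreal \<bar>(\<integral>y. ?p y \<partial>K s) - (\<integral>y. ?n y \<partial>K s)\<bar> \<partial>\<mu>)"
    using integrable_abs[OF int] by (intro nn_integral_eq_integral[symmetric]) auto
  also have "\<dots> = (\<integral>\<^sup>+s. ennreal \<bar>\<integral>\<omega>. F (Ys s \<omega>) \<partial>N s\<bar> \<partial>\<mu>)"
    by (intro nn_integral_cong) (simp add: split[OF FK(1), symmetric] FK(2))
  finally show ?thesis .
qed

context isotropic_setting
begin

lemma indep_setting:
  assumes "mixture_hyps M d Y \<theta> s2 \<mu> N Ys Cm2" and "s \<in> space \<mu>"
  shows "indep_setting (N s) d (Ys s) \<theta> s2 Cm2"
  using assms s2_pos
  unfolding mixture_hyps_def mixture_def indep_setting_def indep_setting_axioms_def by blast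

lemma stein_mixture:
  assumes mix: "mixture_hyps M d Y \<theta> s2 \<mu> N Ys Cm2" and i: "i < d"
  shows "ennreal \<bar>\<integral>\<omega>. stein d \<theta> s2 i (X \<omega>) \<partial>M\<bar>
    \<le> (\<integral>\<^sup>+s. ennreal \<bar>\<integral>\<omega>. stein d \<theta> s2 i (Xof d (Ys s) \<theta> \<omega>) \<partial>N s\<bar> \<partial>\<mu>)"
proof -
  have "Y \<in> M \<rightarrow>\<^sub>M Rd d" using setting by (simp add: setting_def mean_zero_cov_def)
  moreover have "(\<lambda>y. stein d \<theta> s2 i (Xof d (\<lambda>y. y) \<theta> y)) \<in> borel_measurable (Rd d)"
    by (intro measurable_stein measurable_Xof measurable_ident_sets i) simp
  moreover have "mixture M d Y \<mu> N Ys" using mix by (simp add: mixture_hyps_def)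
  ultimately show ?thesis
    \<comment> \<open>\<open>Xof d (\<lambda>y. y) \<theta>\<close> is translation by
      \<open>\<theta>\<close> on \<open>Rd d\<close>, which expresses Stein's term as a function of
      the centred vector.\<close>
    using mixture_integral[OF prob_space_axioms, of Y d \<mu> N Ys "\<lambda>y. stein d \<theta> s2 i (Xof d (\<lambda>y. y) \<theta> y)"]
      stein_integrable[OF i] indep_setting.stein_indep(1)[OF indep_setting[OF mix] i]
    by (simp add: Xof_def)
qed

lemma Bstar_le_sum:
  assumes "0 \<le> lam"
  shows "Bstar M d S X Xz lam \<le> lam * (\<Sum>i<d. \<bar>\<integral>\<omega>. stein d \<theta> s2 i (X \<omega>) \<partial>M\<bar>)"
  unfolding Bstar_stein using assms by (simp add: mult_left_mono sum_abs)

lemma mixture_fourth_moment_bound: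
  assumes mix: "mixture_hyps M d Y \<theta> s2 \<mu> N Ys Cm2" and lam: "0 \<le> lam"
    and C4: "\<And>s i. s \<in> space \<mu> \<Longrightarrow> i < d \<Longrightarrow> (\<integral>\<^sup>+\<omega>. ennreal ((Ys s \<omega> i) ^ 4) \<partial>N s) \<le> ennreal C4"
  shows "Bstar M d S X Xz lam \<le> 25 * Cm2 * lam / (8 * (real d)\<^sup>2)
      * (real d * C4 / 3 + C4 powr (3/4) * norm1 d \<theta> + 2 * s2 * sqn d \<theta> + real d * s2\<^sup>2)"
    and "0 \<le> Cm2" "0 < C4"
proof -
  have \<mu>: "prob_space \<mu>" using mix by (simp add: mixture_hyps_def mixture_def)
  interpret \<mu>: prob_space \<mu> by (rule \<mu>)
  \<comment> \<open>One component suffices to determine the signs of the constants.\<close>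
  obtain s0 where s0: "s0 \<in> space \<mu>" using \<mu>.not_empty by blast
  show Cm2: "0 \<le> Cm2" by (rule indep_setting.u2(3)[OF indep_setting[OF mix s0] d_pos])
  show C40: "0 < C4" by (rule indep_setting.stein_fourth_moment(2)[OF indep_setting[OF mix s0] d_pos C4[OF s0 d_pos]])
  define k where "k i = C4 / 3 + C4 powr (3/4) * \<bar>\<theta> i\<bar> + 2 * s2 * (\<theta> i)\<^sup>2 + s2\<^sup>2" for i
  have k: "0 \<le> k i" for i using C40 s2_pos by (simp add: k_def add_nonneg_nonneg)
  let ?q = "3 * (Cm2 / (real d)\<^sup>2)"
  have "\<bar>\<integral>\<omega>. stein d \<theta> s2 i (X \<omega>) \<partial>M\<bar> \<le> ?q * k i" if i: "i < d" for i
  proof -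
    have "ennreal \<bar>\<integral>\<omega>. stein d \<theta> s2 i (X \<omega>) \<partial>M\<bar> \<le> (\<integral>\<^sup>+s. ennreal (?q * k i) \<partial>\<mu>)"
    proof (rule order_trans[OF stein_mixture[OF mix i] nn_integral_mono])
      fix s assume s: "s \<in> space \<mu>"
      show "ennreal \<bar>\<integral>\<omega>. stein d \<theta> s2 i (Xof d (Ys s) \<theta> \<omega>) \<partial>N s\<bar> \<le> ennreal (?q * k i)"
        unfolding k_def
        by (intro ennreal_leI indep_setting.stein_fourth_moment(1)[OF indep_setting[OF mix s] i C4[OF s i]])
    qed
    also have "\<dots> = ennreal (?q * k i)" by (simp add: \<mu>.emeasure_space_1)
    finally show ?thesis using Cm2 k[of i] by (subst (asm) ennreal_le_iff) auto
  qed
  then have "(\<Sum>i<d. \<bar>\<integral>\<omega>. stein d \<theta> s2 i (X \<omega>) \<partial>M\<bar>) \<le> (\<Sum>i<d. ?q * k i)" by (intro sum_mono) simp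
  then have "lam * (\<Sum>i<d. \<bar>\<integral>\<omega>. stein d \<theta> s2 i (X \<omega>) \<partial>M\<bar>) \<le> lam * (\<Sum>i<d. ?q * k i)"
    using lam by (rule mult_left_mono)
  also have "\<dots> = 3 * (Cm2 * lam / (real d)\<^sup>2) * (\<Sum>i<d. k i)" by (simp only: sum_distrib_left[symmetric]) simp
  \<comment> \<open>The separate estimates give 3 in place of \<open>25 / 8\<close>.\<close>
  also have "\<dots> \<le> 25 / 8 * (Cm2 * lam / (real d)\<^sup>2) * (\<Sum>i<d. k i)"
    using Cm2 lam k by (intro mult_right_mono sum_nonneg) auto
  also have "\<dots> = 25 * Cm2 * lam / (8 * (real d)\<^sup>2) * (\<Sum>i<d. k i)" by simp
  also have "(\<Sum>i<d. k i) = real d * C4 / 3 + C4 powr (3/4) * norm1 d \<theta> + 2 * s2 * sqn d \<theta> + real d * s2\<^sup>2"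
    by (simp add: k_def sum.distrib sum_distrib_left[symmetric] norm1_def sqn_def)
  finally show "Bstar M d S X Xz lam \<le> 25 * Cm2 * lam / (8 * (real d)\<^sup>2)
      * (real d * C4 / 3 + C4 powr (3/4) * norm1 d \<theta> + 2 * s2 * sqn d \<theta> + real d * s2\<^sup>2)"
    using Bstar_le_sum[OF lam] by linarith
qed

lemma mixture_zero_bias_bound:
  assumes mix: "mixture_hyps M d Y \<theta> s2 \<mu> N Ys Cm2" and lam: "0 \<le> lam"
    and Z: "\<And>s i. s \<in> space \<mu> \<Longrightarrow> i < d \<Longrightarrow> zero_bias_1d (N s) (\<lambda>\<omega>. Xof d (Ys s) \<theta> \<omega> i) (\<theta> i) s2 (Zs s i)"
    and m: "\<And>i. i < d \<Longrightarrow> (\<lambda>s. \<integral>\<^sup>+\<omega>. ennreal \<bar>(Xof d (Ys s) \<theta> \<omega> i)\<^sup>2 - (Zs s i \<omega>)\<^sup>2\<bar> \<partial>N s) \<in> borel_measurable \<mu>"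
  shows "ennreal (Bstar M d S X Xz lam) \<le> ennreal (25 * Cm2 * lam * s2 / (8 * (real d)\<^sup>2))
    * (\<Sum>i<d. \<integral>\<^sup>+s. (\<integral>\<^sup>+\<omega>. ennreal \<bar>(Xof d (Ys s) \<theta> \<omega> i)\<^sup>2 - (Zs s i \<omega>)\<^sup>2\<bar> \<partial>N s) \<partial>\<mu>)"
proof -
  have \<mu>: "prob_space \<mu>" using mix by (simp add: mixture_hyps_def mixture_def)
  interpret \<mu>: prob_space \<mu> by (rule \<mu>)
  obtain s0 where s0: "s0 \<in> space \<mu>" using \<mu>.not_empty by blast
  define D where "D i s = (\<integral>\<^sup>+\<omega>. ennreal \<bar>(Xof d (Ys s) \<theta> \<omega> i)\<^sup>2 - (Zs s i \<omega>)\<^sup>2\<bar> \<partial>N s)" for i s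
  let ?q = "3 * (Cm2 / (real d)\<^sup>2) * s2"
  \<comment> \<open>Strict positivity matters: where the zero bias discrepancy \<open>D i s\<close>
    is infinite, the product with \<open>?q\<close> must be infinite too, whereas
    \<open>0 * \<infinity> = 0\<close>.\<close>
  have q: "0 < ?q"
  proof -
    interpret I: indep_setting "N s0" d "Ys s0" \<theta> s2 Cm2 by (rule indep_setting[OF mix s0])
    have "0 < Cm2"
    proof (rule ccontr)
      assume "\<not> 0 < Cm2"
      then have "Cm2 / (real d)\<^sup>2 \<le> 0" by (simp add: divide_nonpos_nonneg)
      moreover have "0 \<le> (\<integral>\<omega>. (1 / sqn_not d 0 (I.W \<omega>))\<^sup>2 \<partial>N s0)" by simp
      ultimately have "(\<integral>\<omega>. (1 / sqn_not d 0 (I.W \<omega>))\<^sup>2 \<partial>N s0) = 0" using I.u2(2)[OF d_pos] by linarith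
      then have "AE \<omega> in N s0. (1 / sqn_not d 0 (I.W \<omega>))\<^sup>2 = 0"
        using I.u2(1)[OF d_pos] by (subst (asm) integral_nonneg_eq_0_iff_AE) auto
      then have "AE \<omega> in N s0. False" using I.wpos[OF d_pos] by eventually_elim simp
      then show False by simp
    qed
    then show ?thesis using s2_pos d_pos by simp
  qed
  have T: "ennreal \<bar>\<integral>\<omega>. stein d \<theta> s2 i (X \<omega>) \<partial>M\<bar> \<le> ennreal ?q * (\<integral>\<^sup>+s. D i s \<partial>\<mu>)" if i: "i < d" for i
  proof -
    have "ennreal \<bar>\<integral>\<omega>. stein d \<theta> s2 i (X \<omega>) \<partial>M\<bar> \<le> (\<integral>\<^sup>+s. ennreal ?q * D i s \<partial>\<mu>)"
    proof (rule order_trans[OF stein_mixture[OF mix i] nn_integral_mono])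
      fix s assume s: "s \<in> space \<mu>"
      interpret I: indep_setting "N s" d "Ys s" \<theta> s2 Cm2 by (rule indep_setting[OF mix s])
      have Zm: "Zs s i \<in> borel_measurable (N s)" using Z[OF s i] by (simp add: zero_bias_1d_def)
      note [measurable] = Zm I.Wi[OF i]
      show "ennreal \<bar>\<integral>\<omega>. stein d \<theta> s2 i (I.W \<omega>) \<partial>N s\<bar> \<le> ennreal ?q * D i s"
      proof (cases "D i s = \<infinity>")
        case True
        have "ennreal ?q \<noteq> 0" using q by (simp only: ennreal_eq_0_iff not_le)
        then have "ennreal ?q * D i s = \<top>" unfolding True by (simp only: infinity_ennreal_def ennreal_mult_top if_False)
        then show ?thesis by (simp only: top_greatest)
      next
        case False
        have int: "integrable (N s) (\<lambda>\<omega>. \<bar>(I.W \<omega> i)\<^sup>2 - (Zs s i \<omega>)\<^sup>2\<bar>)"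
        proof (rule integrableI_nonneg)
          show "(\<integral>\<^sup>+\<omega>. ennreal \<bar>(I.W \<omega> i)\<^sup>2 - (Zs s i \<omega>)\<^sup>2\<bar> \<partial>N s) < \<infinity>"
            using False by (simp add: D_def less_top)
        qed auto
        then have "D i s = ennreal (\<integral>\<omega>. \<bar>(I.W \<omega> i)\<^sup>2 - (Zs s i \<omega>)\<^sup>2\<bar> \<partial>N s)"
          unfolding D_def by (intro nn_integral_eq_integral) auto
        then show ?thesis
          using I.stein_zero_bias[OF i Z[OF s i] int] q
          by (simp add: ennreal_mult[symmetric] ennreal_leI less_imp_le)
      qed
    qed
    also have "\<dots> = ennreal ?q * (\<integral>\<^sup>+s. D i s \<partial>\<mu>)"
      using m[OF i] unfolding D_def by (rule nn_integral_cmult)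
    finally show ?thesis .
  qed
  have "ennreal (Bstar M d S X Xz lam) \<le> ennreal (lam * (\<Sum>i<d. \<bar>\<integral>\<omega>. stein d \<theta> s2 i (X \<omega>) \<partial>M\<bar>))"
    by (intro ennreal_leI Bstar_le_sum lam)
  also have "\<dots> = ennreal lam * (\<Sum>i<d. ennreal \<bar>\<integral>\<omega>. stein d \<theta> s2 i (X \<omega>) \<partial>M\<bar>)"
    using lam by (simp add: ennreal_mult sum_nonneg sum_ennreal)
  also have "\<dots> \<le> ennreal lam * (\<Sum>i<d. ennreal ?q * (\<integral>\<^sup>+s. D i s \<partial>\<mu>))"
    by (intro mult_left_mono sum_mono T) auto
  also have "\<dots> = ennreal (lam * ?q) * (\<Sum>i<d. \<integral>\<^sup>+s. D i s \<partial>\<mu>)"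
    by (simp only: sum_distrib_left[symmetric] ennreal_mult[OF lam less_imp_le[OF q]]) (rule mult.assoc[symmetric])
  also have "\<dots> \<le> ennreal (25 * Cm2 * lam * s2 / (8 * (real d)\<^sup>2)) * (\<Sum>i<d. \<integral>\<^sup>+s. D i s \<partial>\<mu>)"
  proof (intro mult_right_mono ennreal_leI)
    have "25 * Cm2 * lam * s2 / (8 * (real d)\<^sup>2) = 25 / 24 * (lam * ?q)" by simp
    then show "lam * ?q \<le> 25 * Cm2 * lam * s2 / (8 * (real d)\<^sup>2)"
      using mult_nonneg_nonneg[OF lam less_imp_le[OF q]] by linarith
  qed auto
  finally show ?thesis unfolding D_def .
qed

section \<open>Quantitative risk difference in the isotropic case\<close>

lemma largest_eigenvalue: "largest_eigenvalue d S s2"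
proof -
  have row: "(\<Sum>j<d. S i j * v j) = s2 * v i" if "i < d" for i and v :: rvec
  proof -
    have "(\<Sum>j<d. S i j * v j) = (\<Sum>j<d. if j = i then s2 * v i else 0)"
      using that by (intro sum.cong) (auto simp: S_eq)
    then show ?thesis using that by simp
  qed
  define v where "v = (\<lambda>i\<in>{..<d}. 1 :: real)"
  have "v 0 \<noteq> zvec d 0" using d_pos by (simp add: v_def zvec_def)
  then have "v \<noteq> zvec d" by metis
  moreover have "v \<in> space (Rd d)" by (simp add: v_def Rd_def space_PiM)
  ultimately have "is_eigenvalue d S s2" unfolding is_eigenvalue_def using row by blast
  moreover have "k = s2" if k: "is_eigenvalue d S k" for k
  proof -
    obtain v where v: "v \<in> space (Rd d)" "v \<noteq> zvec d" "\<forall>i<d. (\<Sum>j<d. S i j * v j) = k * v i"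
      using k unfolding is_eigenvalue_def by blast
    have "sqn d v \<noteq> 0" using v(1,2) by (simp add: sqn_eq_0_iff)
    then obtain i where "i < d" "v i \<noteq> 0" unfolding sqn_def by (metis (no_types, lifting) lessThan_iff power_zero_numeral sum.neutral)
    then show ?thesis using v(3) row[OF \<open>i < d\<close>, of v] by auto
  qed
  ultimately show ?thesis unfolding largest_eigenvalue_def by blast
qed

text \<open>Jensen's inequality by the tangent line of \<open>1 / r\<close> at the expected squared
  norm; second moments suffice.\<close>

lemma inverse_sqn_ge: "1 / (sqn d \<theta> + real d * s2) \<le> (\<integral>\<omega>. 1 / sqn d (X \<omega>) \<partial>M)"
proof -
  define c where "c = sqn d \<theta> + real d * s2"
  have c: "0 < c" using d_pos s2_pos by (simp add: c_def add_nonneg_pos)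
  have x2: "(X \<omega> i)\<^sup>2 = (X \<omega> i - \<theta> i)\<^sup>2 + 2 * \<theta> i * (X \<omega> i - \<theta> i) + (\<theta> i)\<^sup>2" for i \<omega>
    by (simp add: power2_eq_square algebra_simps)
  have Xi2: "integrable M (\<lambda>\<omega>. (X \<omega> i)\<^sup>2)" "(\<integral>\<omega>. (X \<omega> i)\<^sup>2 \<partial>M) = s2 + (\<theta> i)\<^sup>2" if i: "i < d" for i
  proof -
    have m: "(\<lambda>\<omega>. X \<omega> i - \<theta> i) \<in> borel_measurable M" using Xi[OF i] by measurable
    have i1: "integrable M (\<lambda>\<omega>. 2 * \<theta> i * (X \<omega> i - \<theta> i))"
      using integrable_power_mono[OF m centered_square_integrable[OF i], of 1] by (intro integrable_mult_right) simp
    show "integrable M (\<lambda>\<omega>. (X \<omega> i)\<^sup>2)"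
      unfolding x2[of _ i] using centered_square_integrable[OF i] i1
      by (intro Bochner_Integration.integrable_add integrable_const)
    have "(\<integral>\<omega>. (X \<omega> i)\<^sup>2 \<partial>M) = (\<integral>\<omega>. (X \<omega> i - \<theta> i)\<^sup>2 \<partial>M) + (\<integral>\<omega>. 2 * \<theta> i * (X \<omega> i - \<theta> i) \<partial>M) + (\<integral>\<omega>. (\<theta> i)\<^sup>2 \<partial>M)"
      unfolding x2[of _ i] using centered_square_integrable[OF i] i1
      by (simp only: Bochner_Integration.integral_add Bochner_Integration.integrable_add integrable_const)
    also have "(\<integral>\<omega>. 2 * \<theta> i * (X \<omega> i - \<theta> i) \<partial>M) = 0"
      using centered_expectation[OF i] by (simp only: integral_mult_right_zero)
    finally show "(\<integral>\<omega>. (X \<omega> i)\<^sup>2 \<partial>M) = s2 + (\<theta> i)\<^sup>2" using variance[OF i] by (simp add: prob_space)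
  qed
  have R: "integrable M (\<lambda>\<omega>. sqn d (X \<omega>))" "(\<integral>\<omega>. sqn d (X \<omega>) \<partial>M) = c"
    using Xi2 by (auto simp: sqn_def c_def sum.distrib intro!: Bochner_Integration.integrable_sum)
  have "(\<integral>\<omega>. 2 / c - sqn d (X \<omega>) / c\<^sup>2 \<partial>M) \<le> (\<integral>\<omega>. 1 / sqn d (X \<omega>) \<partial>M)"
  proof (rule integral_mono_AE)
    show "AE \<omega> in M. 2 / c - sqn d (X \<omega>) / c\<^sup>2 \<le> 1 / sqn d (X \<omega>)"
      using sqn_X_pos
    proof eventually_elim
      case (elim \<omega>)
      have "0 \<le> (sqn d (X \<omega>) - c)\<^sup>2 / (sqn d (X \<omega>) * c\<^sup>2)" using elim by simp
      also have "\<dots> = 1 / sqn d (X \<omega>) - (2 / c - sqn d (X \<omega>) / c\<^sup>2)"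
        using elim c by (simp add: field_simps power2_eq_square)
      finally show ?case by simp
    qed
  qed (use R inverse_sqn_integrable in auto)
  also have "(\<integral>\<omega>. 2 / c - sqn d (X \<omega>) / c\<^sup>2 \<partial>M) = 1 / c"
    using R c by (simp add: prob_space power2_eq_square)
  finally show ?thesis by (simp add: c_def)
qed

lemma risk_difference:
  assumes lam: "0 \<le> lam" "lam \<le> 2 * s2 * (real d - 2)"
  shows "risk M d \<theta> X lam \<le> risk M d \<theta> X 0
    - lam * (2 * s2 * (real d - 2) - lam) / (sqn d \<theta> + real d * s2) + 2 * Bstar M d S X Xz lam"
proof -
  have "trace d S = real d * s2" by (simp add: trace_def S_eq)
  then have t: "2 * (trace d S - 2 * s2) = 2 * s2 * (real d - 2)" by (simp add: algebra_simps)
  have "(\<integral>\<omega>. lam / sqn d (X \<omega>) * (lam - 2 * s2 * (real d - 2)) \<partial>M)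
      = (\<integral>\<omega>. - (lam * (2 * s2 * (real d - 2) - lam)) * (1 / sqn d (X \<omega>)) \<partial>M)"
    by (intro Bochner_Integration.integral_cong) (simp_all add: field_simps)
  also have "\<dots> = - (lam * (2 * s2 * (real d - 2) - lam)) * (\<integral>\<omega>. 1 / sqn d (X \<omega>) \<partial>M)"
    by (rule integral_mult_right_zero)
  also have "\<dots> \<le> - (lam * (2 * s2 * (real d - 2) - lam)) * (1 / (sqn d \<theta> + real d * s2))"
    using lam by (intro mult_left_mono_neg inverse_sqn_ge) auto
  finally have "(\<integral>\<omega>. lam / sqn d (X \<omega>) * (lam - 2 * s2 * (real d - 2)) \<partial>M)
      \<le> - (lam * (2 * s2 * (real d - 2) - lam) / (sqn d \<theta> + real d * s2))" by simp
  moreover have "risk M d \<theta> X 0 = (\<integral>\<omega>. sqdist d (X \<omega>) \<theta> \<partial>M)" by (simp add: risk_eq)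
  ultimately show ?thesis using risk_le[OF largest_eigenvalue lam(1)] unfolding t by linarith
qed

end

lemma isotropic_settingI: "setting M d Y \<theta> S Xz \<Longrightarrow> isotropic d S s2 \<Longrightarrow> isotropic_setting M d Y \<theta> S Xz s2"
  by (simp add: isotropic_setting_def zero_bias_setting_def isotropic_setting_axioms_def)

subsection \<open>Asymptotic comparison of risks\<close>

text \<open>The gain in \<open>risk_difference\<close> is of order \<open>d^2\<close> divided by a
  denominator of order \<open>d\<close>, hence at least linear in \<open>d\<close>, while
  \<open>Bstar\<close> is of smaller order.\<close>

lemma eventually_risk_less:
  fixes M :: "nat \<Rightarrow> 'a measure"
  assumes H: "\<And>d. 3 \<le> d \<Longrightarrow> setting (M d) d (Y d) (\<theta> d) (S d) (Xz d) \<and> isotropic d (S d) s2 \<and>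
      0 \<le> lam d \<and> lam d \<le> 2 * s2 * (real d - 2) \<and> sqn d (\<theta> d) \<le> K * real d"
    and B: "(\<lambda>d. Bstar (M d) d (S d) (Xof d (Y d) (\<theta> d)) (Xz d) (lam d) / real d) \<longlonglongrightarrow> 0"
    and c: "0 < c" "\<forall>\<^sub>F d in sequentially. c \<le> lam d / (2 * s2 * (real d - 2)) \<and> lam d / (2 * s2 * (real d - 2)) \<le> 1 - c"
  shows "\<forall>\<^sub>F d in sequentially.
    risk (M d) d (\<theta> d) (Xof d (Y d) (\<theta> d)) (lam d) < risk (M d) d (\<theta> d) (Xof d (Y d) (\<theta> d)) 0"
proof -
  have s2: "0 < s2" using H[of 3] by (simp add: isotropic_def)
  have "sqn 3 (\<theta> 3) \<le> K * real 3" using H[of 3] by auto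
  then have "0 \<le> K * real 3" using sqn_nonneg[of 3 "\<theta> 3"] by linarith
  then have K: "0 \<le> K" by simp
  \<comment> \<open>A lower bound for the gain per dimension: \<open>d - 2 \<ge> d / 3\<close> for
    \<open>d \<ge> 3\<close> accounts for the 9, and the denominator of the gain is at most
    \<open>(K + s2) * d\<close>.\<close>
  define e where "e = 4 * s2\<^sup>2 * c\<^sup>2 / (9 * (K + s2))"
  have e: "0 < e" using s2 K c by (simp add: e_def add_nonneg_pos)
  have "\<forall>\<^sub>F d in sequentially. Bstar (M d) d (S d) (Xof d (Y d) (\<theta> d)) (Xz d) (lam d) / real d < e / 2"
    using B e by (intro order_tendstoD(2)) auto
  then show ?thesis
    using c(2) eventually_ge_at_top[of 3]
  proof eventually_elim
    case (elim d)
    interpret isotropic_setting "M d" d "Y d" "\<theta> d" "S d" "Xz d" s2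
      by (rule isotropic_settingI) (use H[OF elim(3)] in auto)
    let ?B = "Bstar (M d) d (S d) X (Xz d) (lam d)" and ?m = "2 * s2 * (real d - 2)"
    have d: "0 < real d" "real d / 3 \<le> real d - 2" using elim(3) by auto
    have m: "0 < ?m" using d s2 by simp
    have "c * ?m \<le> lam d" and "lam d \<le> (1 - c) * ?m"
      using elim(2) by (simp_all only: pos_le_divide_eq[OF m] pos_divide_le_eq[OF m])
    moreover from this(2) have "c * ?m \<le> ?m - lam d" unfolding left_diff_distrib by linarith
    moreover have "0 \<le> lam d" using H[OF elim(3)] by blast
    ultimately have "(c * ?m) * (c * ?m) \<le> lam d * (?m - lam d)" using c(1) m by (intro mult_mono) auto
    moreover have "(c * (2 * s2 * (real d / 3))) * (c * (2 * s2 * (real d / 3))) \<le> (c * ?m) * (c * ?m)"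
      using c s2 d by (intro mult_mono mult_left_mono) auto
    moreover have "(c * (2 * s2 * (real d / 3))) * (c * (2 * s2 * (real d / 3))) = 4 * s2\<^sup>2 * c\<^sup>2 / 9 * (real d)\<^sup>2"
      by (simp add: power2_eq_square)
    ultimately have n: "4 * s2\<^sup>2 * c\<^sup>2 / 9 * (real d)\<^sup>2 \<le> lam d * (?m - lam d)" by linarith
    have den: "0 < sqn d (\<theta> d) + real d * s2" "sqn d (\<theta> d) + real d * s2 \<le> (K + s2) * real d"
      using H[OF elim(3)] d s2 by (auto simp: algebra_simps add_nonneg_pos)
    have "e * real d = 4 * s2\<^sup>2 * c\<^sup>2 / 9 * (real d)\<^sup>2 / ((K + s2) * real d)"
      using d by (simp add: e_def power2_eq_square)
    also have "\<dots> \<le> lam d * (?m - lam d) / (sqn d (\<theta> d) + real d * s2)"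
      using n den by (intro frac_le) (auto intro: order_trans[OF _ n])
    finally have "e * real d \<le> lam d * (?m - lam d) / (sqn d (\<theta> d) + real d * s2)" .
    moreover have "2 * ?B < e * real d" using elim(1) d by (simp add: divide_less_eq)
    moreover have "risk (M d) d (\<theta> d) X (lam d) \<le> risk (M d) d (\<theta> d) X 0
        - lam d * (?m - lam d) / (sqn d (\<theta> d) + real d * s2) + 2 * ?B"
      using H[OF elim(3)] by (intro risk_difference) auto
    ultimately show ?case by linarith
  qed
qed

lemma norm1_le: "2 * norm1 d x \<le> real d + sqn d x"
proof -
  have "2 * norm1 d x = (\<Sum>i<d. 2 * (\<bar>1\<bar> * \<bar>x i\<bar>))" by (simp add: norm1_def sum_distrib_left)
  also have "\<dots> \<le> (\<Sum>i<d. 1\<^sup>2 + (x i)\<^sup>2)" by (intro sum_mono two_abs_mult_le)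
  finally show ?thesis by (simp add: sum.distrib sqn_def)
qed

text \<open>As \<open>lam d\<close> may grow like \<open>d\<close>, division by \<open>d\<close>
  only compensates this factor: the covariance sum has to tend to zero by itself, while the moment
  part is of order \<open>1 / d\<close>.\<close>

lemma part1_asymptotics:
  fixes M :: "nat \<Rightarrow> 'a measure"
  assumes H: "\<forall>d\<ge>3. setting (M d) d (Y d) (\<theta> d) (S d) (Xz d) \<and> isotropic d (S d) s2 \<and>
      0 \<le> lam d \<and> lam d \<le> 2 * s2 * (real d - 2) \<and>
      part1_moments (M d) d (Y d) (\<theta> d) Cm4 C4 C8 \<and> sqn d (\<theta> d) \<le> K * real d"
    and cov: "(\<lambda>d. cov_sum (M d) d (Y d) (\<theta> d)) \<longlonglongrightarrow> 0"
  shows "(\<lambda>d. Bstar (M d) d (S d) (Xof d (Y d) (\<theta> d)) (Xz d) (lam d) / real d) \<longlonglongrightarrow> 0"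
proof (rule tendsto_sandwich)
  note H = H[rule_format]
  let ?B = "\<lambda>d. Bstar (M d) d (S d) (Xof d (Y d) (\<theta> d)) (Xz d) (lam d)"
  let ?c = "\<lambda>d. cov_sum (M d) d (Y d) (\<theta> d)"
  let ?h = "sqrt Cm4 * (6 * s2 * sqrt C4 + 2 * sqrt C8 + 6 * K * s2)"
  have s2: "0 < s2" using H[of 3] by (simp add: isotropic_def)
  show "\<forall>\<^sub>F d in sequentially. 0 \<le> ?B d / real d" by (simp add: Bstar_def)
  show "\<forall>\<^sub>F d in sequentially. ?B d / real d \<le> 2 * s2 * (?c d + ?h / real d)"
    using eventually_ge_at_top[of 3]
  proof eventually_elim
    case (elim d)
    interpret isotropic_setting "M d" d "Y d" "\<theta> d" "S d" "Xz d" s2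
      by (rule isotropic_settingI) (use H[OF elim] in auto)
    have d: "0 < real d" using elim by simp
    have P: "part1_moments (M d) d (Y d) (\<theta> d) Cm4 C4 C8" and lam: "0 \<le> lam d" and \<theta>: "sqn d (\<theta> d) \<le> K * real d"
      using H[OF elim] by blast+
    have lam': "lam d \<le> 2 * s2 * real d" using H[OF elim] s2 by (auto simp: algebra_simps)
    define g where "g = 6 * real d * s2 * sqrt C4 + 2 * real d * sqrt C8 + 6 * sqn d (\<theta> d) * s2"
    have g: "g \<le> real d * (6 * s2 * sqrt C4 + 2 * sqrt C8 + 6 * K * s2)"
      using mult_right_mono[OF \<theta>, of s2] s2 unfolding g_def by (simp add: algebra_simps)
    have m: "0 \<le> sqrt Cm4 / (real d)\<^sup>2" using part1_bound(2)[OF P lam] by simp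
    have c: "0 \<le> ?c d" by (simp add: cov_sum_def sum_nonneg)
    have "sqrt Cm4 / (real d)\<^sup>2 * g
        \<le> sqrt Cm4 / (real d)\<^sup>2 * (real d * (6 * s2 * sqrt C4 + 2 * sqrt C8 + 6 * K * s2))"
      using g m by (rule mult_left_mono)
    also have "\<dots> = ?h / real d" using d by (simp add: power2_eq_square)
    finally have gh: "sqrt Cm4 / (real d)\<^sup>2 * g \<le> ?h / real d" .
    have "?B d \<le> lam d * (?c d + sqrt Cm4 / (real d)\<^sup>2 * g)"
      using part1_bound(1)[OF P lam] unfolding g_def by (simp only: distrib_left mult.assoc)
    also have "\<dots> \<le> lam d * (?c d + ?h / real d)" using gh lam by (intro mult_left_mono) auto
    also have "\<dots> \<le> 2 * s2 * real d * (?c d + ?h / real d)"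
    proof (rule mult_right_mono[OF lam'])
      have "0 \<le> sqrt Cm4 / (real d)\<^sup>2 * g"
      proof (rule mult_nonneg_nonneg[OF m])
        show "0 \<le> g" using part1_bound(3,4)[OF P lam] s2 by (simp add: g_def sqn_nonneg)
      qed
      then show "0 \<le> ?c d + ?h / real d" using gh c by linarith
    qed
    finally show ?case using d by (simp add: pos_divide_le_eq mult_ac)
  qed
  have "(\<lambda>d. ?h / real d) \<longlonglongrightarrow> 0"
    by (intro tendsto_divide_0[OF tendsto_const] filterlim_at_top_imp_at_infinity filterlim_real_sequentially)
  then have "(\<lambda>d. 2 * s2 * (?c d + ?h / real d)) \<longlonglongrightarrow> 2 * s2 * (0 + 0)" by (intro tendsto_intros cov)
  then show "(\<lambda>d. 2 * s2 * (?c d + ?h / real d)) \<longlonglongrightarrow> 0" by simp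
qed simp

text \<open>Both \<open>lam d\<close> and the moment factor are at most linear in \<open>d\<close>,
  which the prefactor \<open>1 / d^2\<close> cancels; for the 1-norm of \<open>\<theta>\<close> this
  uses \<open>2 * \<bar>x\<bar> \<le> 1 + x^2\<close> in each coordinate.\<close>

lemma mixture_Bstar_bounded:
  fixes M :: "nat \<Rightarrow> 'a measure"
  assumes H: "\<forall>d\<ge>3. setting (M d) d (Y d) (\<theta> d) (S d) (Xz d) \<and> isotropic d (S d) s2 \<and>
      0 \<le> lam d \<and> lam d \<le> 2 * s2 * (real d - 2) \<and>
      mixture_hyps (M d) d (Y d) (\<theta> d) s2 (\<mu> d) (N d) (Ys d) Cm2 \<and>
      (\<forall>s\<in>space (\<mu> d). \<forall>i<d. (\<integral>\<^sup>+\<omega>. ennreal ((Ys d s \<omega> i) ^ 4) \<partial>N d s) \<le> ennreal C4) \<and>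
      sqn d (\<theta> d) \<le> K * real d"
    and d: "3 \<le> d"
  shows "Bstar (M d) d (S d) (Xof d (Y d) (\<theta> d)) (Xz d) (lam d)
    \<le> 25 / 4 * Cm2 * s2 * (C4 / 3 + C4 powr (3/4) * ((1 + K) / 2) + 2 * s2 * K + s2\<^sup>2)"
proof -
  note H = H[rule_format]
  have mix: "mixture_hyps (M d) d (Y d) (\<theta> d) s2 (\<mu> d) (N d) (Ys d) Cm2" and lam: "0 \<le> lam d"
    and \<theta>: "sqn d (\<theta> d) \<le> K * real d"
    and C4: "\<And>s i. s \<in> space (\<mu> d) \<Longrightarrow> i < d \<Longrightarrow> (\<integral>\<^sup>+\<omega>. ennreal ((Ys d s \<omega> i) ^ 4) \<partial>N d s) \<le> ennreal C4"
    using H[OF d] by blast+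
  interpret isotropic_setting "M d" d "Y d" "\<theta> d" "S d" "Xz d" s2
    by (rule isotropic_settingI) (use H[OF d] in auto)
  note b = mixture_fourth_moment_bound[OF mix lam C4]
  let ?k = "C4 / 3 + C4 powr (3/4) * ((1 + K) / 2) + 2 * s2 * K + s2\<^sup>2"
  define k where "k = real d * C4 / 3 + C4 powr (3/4) * norm1 d (\<theta> d) + 2 * s2 * sqn d (\<theta> d) + real d * s2\<^sup>2"
  have d0: "0 < real d" using d by simp
  have lam': "lam d \<le> 2 * s2 * real d" using H[OF d] s2_pos by (auto simp: algebra_simps)
  have "norm1 d (\<theta> d) \<le> real d * ((1 + K) / 2)" using norm1_le[of d "\<theta> d"] \<theta> by (simp add: algebra_simps)
  then have "C4 powr (3/4) * norm1 d (\<theta> d) \<le> C4 powr (3/4) * (real d * ((1 + K) / 2))"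
    by (rule mult_left_mono) simp
  moreover have "2 * s2 * sqn d (\<theta> d) \<le> 2 * s2 * (K * real d)" using \<theta> s2_pos by (intro mult_left_mono) auto
  ultimately have "k \<le> real d * C4 / 3 + C4 powr (3/4) * (real d * ((1 + K) / 2)) + 2 * s2 * (K * real d) + real d * s2\<^sup>2"
    unfolding k_def by linarith
  also have "\<dots> = real d * ?k" by (simp add: field_simps)
  finally have kk: "k \<le> real d * ?k" .
  have k0: "0 \<le> k" using b(3) s2_pos by (simp add: k_def norm1_def sum_nonneg sqn_nonneg)
  have "Bstar (M d) d (S d) X (Xz d) (lam d) \<le> 25 / 8 * (Cm2 / (real d)\<^sup>2) * (lam d * k)"
    using b(1) unfolding k_def by (simp add: mult_ac)
  also have "\<dots> \<le> 25 / 8 * (Cm2 / (real d)\<^sup>2) * (2 * s2 * real d * (real d * ?k))"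
    using kk k0 lam lam' b(2) s2_pos by (intro mult_left_mono mult_mono) auto
  also have "\<dots> = 25 / 4 * Cm2 * s2 * ?k" using d0 by (simp add: power2_eq_square)
  finally show ?thesis .
qed

theorem mainTheorem9:
  shows
  \<comment> \<open>general risk bound\<close>
  "(\<forall>(M::'a measure) d Y \<theta> S Xz \<kappa> lam.
      setting M d Y \<theta> S Xz \<and> largest_eigenvalue d S \<kappa> \<and> 0 \<le> lam \<longrightarrow>
      risk M d \<theta> (Xof d Y \<theta>) lam
        \<le> (\<integral>\<omega>. sqdist d (Xof d Y \<theta> \<omega>) \<theta> \<partial>M)
          + (\<integral>\<omega>. lam / sqn d (Xof d Y \<theta> \<omega>) * (lam - 2 * (trace d S - 2 * \<kappa>)) \<partial>M)
          + 2 * Bstar M d S (Xof d Y \<theta>) Xz lam)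
   \<and>
   \<comment> \<open>formula for B* when Sigma = sigma^2 Id\<close>
   (\<forall>(M::'a measure) d Y \<theta> S Xz s2 lam.
      setting M d Y \<theta> S Xz \<and> isotropic d S s2 \<and> 0 \<le> lam \<longrightarrow>
      Bstar M d S (Xof d Y \<theta>) Xz lam
        = lam * s2 * \<bar>\<Sum>i<d.
             (\<integral>\<omega>. (sqn d (Xz i i \<omega>) - 2 * (Xz i i \<omega> i)\<^sup>2) / (sqn d (Xz i i \<omega>))\<^sup>2 \<partial>M)
           - (\<integral>\<omega>. (sqn d (Xof d Y \<theta> \<omega>) - 2 * (Xof d Y \<theta> \<omega> i)\<^sup>2) / (sqn d (Xof d Y \<theta> \<omega>))\<^sup>2 \<partial>M)\<bar>)
   \<and>
   \<comment> \<open>part (1): bound for every d \<ge> 3\<close>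
   (\<forall>(M::'a measure) d Y \<theta> S Xz s2 lam Cm4 C4 C8.
      setting M d Y \<theta> S Xz \<and> isotropic d S s2 \<and> 3 \<le> d \<and>
      0 \<le> lam \<and> lam \<le> 2 * s2 * (real d - 2) \<and> part1_moments M d Y \<theta> Cm4 C4 C8 \<longrightarrow>
      Bstar M d S (Xof d Y \<theta>) Xz lam
        \<le> lam * cov_sum M d Y \<theta>
          + 6 * lam * sqrt Cm4 / (real d)\<^sup>2
            * (real d * (s2 * sqrt C4 + sqrt C8 / 3) + sqn d \<theta> * (s2 + C4)))
   \<and>
   \<comment> \<open>part (1): asymptotics along a sequence of problems indexed by d\<close>
   (\<forall>(M::nat \<Rightarrow> 'a measure) Y \<theta> S Xz lam s2 Cm4 C4 C8 K.
      (\<forall>d\<ge>3. setting (M d) d (Y d) (\<theta> d) (S d) (Xz d) \<and> isotropic d (S d) s2 \<and>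
         0 \<le> lam d \<and> lam d \<le> 2 * s2 * (real d - 2) \<and>
         part1_moments (M d) d (Y d) (\<theta> d) Cm4 C4 C8 \<and> sqn d (\<theta> d) \<le> K * real d) \<and>
      (\<lambda>d. cov_sum (M d) d (Y d) (\<theta> d)) \<longlonglongrightarrow> 0 \<longrightarrow>
      (\<lambda>d. Bstar (M d) d (S d) (Xof d (Y d) (\<theta> d)) (Xz d) (lam d) / real d) \<longlonglongrightarrow> 0 \<and>
      ((\<exists>c>0. \<forall>\<^sub>F d in sequentially.
          c \<le> lam d / (2 * s2 * (real d - 2)) \<and> lam d / (2 * s2 * (real d - 2)) \<le> 1 - c) \<longrightarrow>
       (\<forall>\<^sub>F d in sequentially.
          risk (M d) d (\<theta> d) (Xof d (Y d) (\<theta> d)) (lam d) < risk (M d) d (\<theta> d) (Xof d (Y d) (\<theta> d)) 0)))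
   \<and>
   \<comment> \<open>part (2): mixtures, bound via zero bias coordinates X*_{s,i}\<close>
   (\<forall>(M::'a measure) d Y \<theta> S Xz s2 lam (\<mu>::'s measure) (N::'s \<Rightarrow> 'b measure) Ys Cm2 (Zs::'s \<Rightarrow> nat \<Rightarrow> 'b \<Rightarrow> real).
      setting M d Y \<theta> S Xz \<and> isotropic d S s2 \<and> 0 \<le> lam \<and> lam \<le> 2 * s2 * (real d - 2) \<and>
      mixture_hyps M d Y \<theta> s2 \<mu> N Ys Cm2 \<and>
      (\<forall>s\<in>space \<mu>. \<forall>i<d.
         indep_rv (N s) (Zs s i) (\<lambda>\<omega>. restrict (Xof d (Ys s) \<theta> \<omega>) ({..<d} - {i}))
           (Rd_not d i) \<and>
         zero_bias_1d (N s) (\<lambda>\<omega>. Xof d (Ys s) \<theta> \<omega> i) (\<theta> i) s2 (Zs s i)) \<and>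
      (\<forall>i<d. (\<lambda>s. \<integral>\<^sup>+\<omega>. ennreal \<bar>(Xof d (Ys s) \<theta> \<omega> i)\<^sup>2 - (Zs s i \<omega>)\<^sup>2\<bar> \<partial>N s)
                \<in> borel_measurable \<mu>) \<longrightarrow>
      ennreal (Bstar M d S (Xof d Y \<theta>) Xz lam)
        \<le> ennreal (25 * Cm2 * lam * s2 / (8 * (real d)\<^sup>2))
          * (\<Sum>i<d. \<integral>\<^sup>+s. (\<integral>\<^sup>+\<omega>. ennreal \<bar>(Xof d (Ys s) \<theta> \<omega> i)\<^sup>2 - (Zs s i \<omega>)\<^sup>2\<bar> \<partial>N s) \<partial>\<mu>))
   \<and>
   \<comment> \<open>part (2): bound under fourth moments\<close>
   (\<forall>(M::'a measure) d Y \<theta> S Xz s2 lam (\<mu>::'s measure) (N::'s \<Rightarrow> 'b measure) Ys Cm2 C4.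
      setting M d Y \<theta> S Xz \<and> isotropic d S s2 \<and> 0 \<le> lam \<and> lam \<le> 2 * s2 * (real d - 2) \<and>
      mixture_hyps M d Y \<theta> s2 \<mu> N Ys Cm2 \<and>
      (\<forall>s\<in>space \<mu>. \<forall>i<d. (\<integral>\<^sup>+\<omega>. ennreal ((Ys s \<omega> i) ^ 4) \<partial>N s) \<le> ennreal C4) \<longrightarrow>
      Bstar M d S (Xof d Y \<theta>) Xz lam
        \<le> 25 * Cm2 * lam / (8 * (real d)\<^sup>2)
          * (real d * C4 / 3 + C4 powr (3/4) * norm1 d \<theta> + 2 * s2 * sqn d \<theta> + real d * s2\<^sup>2))
   \<and>
   \<comment> \<open>part (2): asymptotics along a sequence of problems indexed by d\<close>
   (\<forall>(M::nat \<Rightarrow> 'a measure) Y \<theta> S Xz lam s2 (\<mu>::nat \<Rightarrow> 's measure) (N::nat \<Rightarrow> 's \<Rightarrow> 'b measure)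
       Ys Cm2 C4 K.
      (\<forall>d\<ge>3. setting (M d) d (Y d) (\<theta> d) (S d) (Xz d) \<and> isotropic d (S d) s2 \<and>
         0 \<le> lam d \<and> lam d \<le> 2 * s2 * (real d - 2) \<and>
         mixture_hyps (M d) d (Y d) (\<theta> d) s2 (\<mu> d) (N d) (Ys d) Cm2 \<and>
         (\<forall>s\<in>space (\<mu> d). \<forall>i<d. (\<integral>\<^sup>+\<omega>. ennreal ((Ys d s \<omega> i) ^ 4) \<partial>N d s) \<le> ennreal C4) \<and>
         sqn d (\<theta> d) \<le> K * real d) \<longrightarrow>
      (\<exists>B. \<forall>d\<ge>3. Bstar (M d) d (S d) (Xof d (Y d) (\<theta> d)) (Xz d) (lam d) \<le> B) \<and>
      ((\<exists>c>0. \<forall>\<^sub>F d in sequentially.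
          c \<le> lam d / (2 * s2 * (real d - 2)) \<and> lam d / (2 * s2 * (real d - 2)) \<le> 1 - c) \<longrightarrow>
       (\<forall>\<^sub>F d in sequentially.
          risk (M d) d (\<theta> d) (Xof d (Y d) (\<theta> d)) (lam d) < risk (M d) d (\<theta> d) (Xof d (Y d) (\<theta> d)) 0)))"
proof (intro conjI allI impI, goal_cases)
  case (1 M d Y \<theta> S Xz \<kappa> lam)
  then have "zero_bias_setting M d Y \<theta> S Xz" unfolding zero_bias_setting_def by blast
  then show ?case by (rule zero_bias_setting.risk_le) (use 1 in blast)+
next
  case (2 M d Y \<theta> S Xz s2 lam)
  then interpret isotropic_setting M d Y \<theta> S Xz s2 by (intro isotropic_settingI) auto
  have "\<bar>lam\<bar> = lam" using 2 by simp
  then show ?case using Bstar_formula[of lam] by (simp only:)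
next
  case (3 M d Y \<theta> S Xz s2 lam Cm4 C4 C8)
  then have "isotropic_setting M d Y \<theta> S Xz s2" by (intro isotropic_settingI) auto
  then show ?case using 3 by (intro isotropic_setting.part1_bound_paper) auto
next
  case (4 M Y \<theta> S Xz lam s2 Cm4 C4 C8 K)
  show ?case by (rule part1_asymptotics[OF conjunct1[OF 4] conjunct2[OF 4]])
next
  case (5 M Y \<theta> S Xz lam s2 Cm4 C4 C8 K)
  obtain c where c: "0 < c" "\<forall>\<^sub>F d in sequentially.
      c \<le> lam d / (2 * s2 * (real d - 2)) \<and> lam d / (2 * s2 * (real d - 2)) \<le> 1 - c"
    using 5(2) by blast
  have "(\<lambda>d. Bstar (M d) d (S d) (Xof d (Y d) (\<theta> d)) (Xz d) (lam d) / real d) \<longlonglongrightarrow> 0"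
    by (rule part1_asymptotics[OF conjunct1[OF 5(1)] conjunct2[OF 5(1)]])
  then show ?case using c by (intro eventually_risk_less) (use 5(1) in blast)+
next
  case (6 M d Y \<theta> S Xz s2 lam \<mu> N Ys Cm2 Zs)
  then have "isotropic_setting M d Y \<theta> S Xz s2" by (intro isotropic_settingI) auto
  then show ?case using 6 by (intro isotropic_setting.mixture_zero_bias_bound) auto
next
  case (7 M d Y \<theta> S Xz s2 lam \<mu> N Ys Cm2 C4)
  then have "isotropic_setting M d Y \<theta> S Xz s2" by (intro isotropic_settingI) auto
  then show ?case using 7 by (intro isotropic_setting.mixture_fourth_moment_bound(1)) auto
next
  case (8 M Y \<theta> S Xz lam s2 \<mu> N Ys Cm2 C4 K)
  show ?case by (intro exI allI impI) (rule mixture_Bstar_bounded[OF 8])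
next
  case (9 M Y \<theta> S Xz lam s2 \<mu> N Ys Cm2 C4 K)
  obtain c where c: "0 < c" "\<forall>\<^sub>F d in sequentially.
      c \<le> lam d / (2 * s2 * (real d - 2)) \<and> lam d / (2 * s2 * (real d - 2)) \<le> 1 - c"
    using 9(2) by blast
  have "(\<lambda>d. Bstar (M d) d (S d) (Xof d (Y d) (\<theta> d)) (Xz d) (lam d) / real d) \<longlonglongrightarrow> 0"
  proof (rule tendsto_sandwich)
    let ?B = "25 / 4 * Cm2 * s2 * (C4 / 3 + C4 powr (3/4) * ((1 + K) / 2) + 2 * s2 * K + s2\<^sup>2)"
    show "\<forall>\<^sub>F d in sequentially. 0 \<le> Bstar (M d) d (S d) (Xof d (Y d) (\<theta> d)) (Xz d) (lam d) / real d"
      by (simp add: Bstar_def)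
    show "\<forall>\<^sub>F d in sequentially. Bstar (M d) d (S d) (Xof d (Y d) (\<theta> d)) (Xz d) (lam d) / real d \<le> ?B / real d"
      using eventually_ge_at_top[of 3]
      by eventually_elim (intro divide_right_mono mixture_Bstar_bounded[OF 9(1)], simp_all)
    show "(\<lambda>d. ?B / real d) \<longlonglongrightarrow> 0"
      by (intro tendsto_divide_0[OF tendsto_const] filterlim_at_top_imp_at_infinity filterlim_real_sequentially)
  qed simp
  then show ?case using c by (intro eventually_risk_less) (use 9(1) in blast)+
qed

end
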